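(* Let $n\ge1$, $\alpha\in\mathbb{R}\setminus\pi\mathbb{Z}$ and $1<p\le2\le q<\infty$. There is a constant $C_{\alpha,p,q,n}$ such that the following holds. Let $\{T_j^\alpha\}_{j\in\mathbb{Z}}$ be a family of operators of the form $T_j^\alpha=M_\alpha^{-1}T_jM_\alpha$, where each $T_j$ is a Fourier multiplier operator whose symbol is supported in the dyadic annulus $2^{j-1}\le|\xi|\le2^{j+1}$. If $$\sup_{j\in\mathbb{Z}}\|T_j^\alpha\|_{L^p(\mathbb{R}^n)\to L^q(\mathbb{R}^n)}<\infty,$$ then for each $f\in L^p(\mathbb{R}^n)$ the series $$T^\alpha(f):=\sum_{j\in\mathbb{Z}}T_j^\alpha(f)$$ converges in $L^q(\mathbb{R}^n)$, and $$\|T^\alpha\|_{L^p(\mathbb{R}^n)\to L^q(\mathbb{R}^n)}\le C_{\alpha,p,q,n}\,\sup_{j\in\mathbb{Z}}\|T_j^\alpha\|_{L^p(\mathbb{R}^n)\to L^q(\mathbb{R}^n)}.$$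
   Context: $M_\alpha f(x)=e^{i\pi|x|^2\cot\alpha}f(x)$ is the chirp multiplier and $M_\alpha^{-1}$ is multiplication by $e^{-i\pi|x|^2\cot\alpha}$. A Fourier multiplier operator with symbol $m$ (bounded measurable) is $g\mapsto(m\,\widehat g)^\vee$, where $\widehat g(\xi)=\int_{\mathbb{R}^n}e^{-2\pi ix\cdot\xi}g(x)\,dx$ and $\vee$ is the inverse Fourier transform; it is initially defined on Schwartz functions and, when bounded from $L^p$ to $L^q$, extended by density to $L^p(\mathbb{R}^n)$. *)

theory Defs
  imports "HOL-Analysis.Analysis"
begin

text \<open>
  Elements of \<open>L\<^sup>p\<close> are represented by Lebesgue measurable functions (not by classes modulo
  null sets); limits are in norm, hence unique only up to null sets. The norm takes values in \<^typ>\<open>ennreal\<close>, so it makes sense for every measurable function.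
\<close>

definition Lp_norm :: "real \<Rightarrow> (real^'n \<Rightarrow> complex) \<Rightarrow> ennreal" where
  "Lp_norm p f =
     (let I = (\<integral>\<^sup>+ x. ennreal (norm (f x) powr p) \<partial>lebesgue)
      in if I = \<infinity> then \<infinity> else ennreal (enn2real I powr (1 / p)))"

definition Lp :: "real \<Rightarrow> (real^'n \<Rightarrow> complex) set" where
  "Lp p = {f \<in> borel_measurable lebesgue. Lp_norm p f < \<infinity>}"

text \<open>
  The operator norm from \<open>L\<^sup>p\<close> to \<open>L\<^sup>q\<close> is the least admissible constant; it is \<open>\<infinity>\<close> exactly when
  there is no finite one.
\<close>

definition Lp_op_norm ::
  "real \<Rightarrow> real \<Rightarrow> ((real^'n \<Rightarrow> complex) \<Rightarrow> (real^'n \<Rightarrow> complex)) \<Rightarrow> ennreal" where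
  "Lp_op_norm p q T = Inf {C. \<forall>f\<in>Lp p. Lp_norm q (T f) \<le> C * Lp_norm p f}"

definition partial_deriv :: "'n \<Rightarrow> (real^'n \<Rightarrow> complex) \<Rightarrow> (real^'n \<Rightarrow> complex)" where
  "partial_deriv i f = (\<lambda>x. frechet_derivative f (at x) (axis i 1))"

text \<open>
  Iterated partial derivatives are \<open>fold partial_deriv is f\<close>, where the list \<open>is\<close> records the
  directions. A function is smooth iff all of them are (totally) differentiable.
\<close>

definition schwartz :: "(real^'n \<Rightarrow> complex) set" where
  "schwartz = {f. \<forall>is. fold partial_deriv is f differentiable_on UNIV \<and>
                    (\<forall>k::nat. bounded (range (\<lambda>x. norm x ^ k *\<^sub>R fold partial_deriv is f x)))}"

definition fourier :: "(real^'n \<Rightarrow> complex) \<Rightarrow> (real^'n \<Rightarrow> complex)" where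
  "fourier g = (\<lambda>\<xi>. LINT x|lebesgue. exp (- (2 * of_real pi * \<i> * of_real (x \<bullet> \<xi>))) * g x)"

definition inv_fourier :: "(real^'n \<Rightarrow> complex) \<Rightarrow> (real^'n \<Rightarrow> complex)" where
  "inv_fourier g = (\<lambda>x. LINT \<xi>|lebesgue. exp (2 * of_real pi * \<i> * of_real (x \<bullet> \<xi>)) * g \<xi>)"

text \<open>
  Extension by density: the \<open>L\<^sup>q\<close>-limit of \<open>T g\<^sub>k\<close> for Schwartz functions \<open>g\<^sub>k\<close> tending to \<open>f\<close> in \<open>L\<^sup>p\<close>.
  If \<open>T\<close> is linear and bounded from \<open>L\<^sup>p\<close> to \<open>L\<^sup>q\<close> on Schwartz functions, such a limit exists and is
  unique up to null sets.
\<close>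

definition density_extension ::
  "real \<Rightarrow> real \<Rightarrow> ((real^'n \<Rightarrow> complex) \<Rightarrow> (real^'n \<Rightarrow> complex)) \<Rightarrow>
     (real^'n \<Rightarrow> complex) \<Rightarrow> (real^'n \<Rightarrow> complex)" where
  "density_extension p q T f =
     (SOME h. h \<in> Lp q \<and>
        (\<forall>g :: nat \<Rightarrow> (real^'n \<Rightarrow> complex).
           range g \<subseteq> schwartz \<and> (\<lambda>k. Lp_norm p (\<lambda>x. g k x - f x)) \<longlonglongrightarrow> 0 \<longrightarrow>
           (\<lambda>k. Lp_norm q (\<lambda>x. T (g k) x - h x)) \<longlonglongrightarrow> 0))"

text \<open>
  The Fourier multiplier operator with symbol \<open>m\<close>, viewed as an operator from \<open>L\<^sup>p\<close> to \<open>L\<^sup>q\<close>. If it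
  is unbounded on Schwartz functions, its values off the Schwartz space are irrelevant: its
  \<^const>\<open>Lp_op_norm\<close> is \<open>\<infinity>\<close> already because of its values on Schwartz functions.
\<close>

definition multiplier_op ::
  "real \<Rightarrow> real \<Rightarrow> (real^'n \<Rightarrow> complex) \<Rightarrow> (real^'n \<Rightarrow> complex) \<Rightarrow> (real^'n \<Rightarrow> complex)" where
  "multiplier_op p q m =
     (let T = (\<lambda>g. inv_fourier (\<lambda>\<xi>. m \<xi> * fourier g \<xi>))
      in (\<lambda>f. if f \<in> schwartz then T f else density_extension p q T f))"

definition dyadic_symbol :: "int \<Rightarrow> (real^'n \<Rightarrow> complex) \<Rightarrow> bool" where
  "dyadic_symbol j m \<longleftrightarrow>
     m \<in> borel_measurable lebesgue \<and> bounded (range m) \<and>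
     (\<forall>\<xi>. m \<xi> \<noteq> 0 \<longrightarrow> 2 powi (j - 1) \<le> norm \<xi> \<and> norm \<xi> \<le> 2 powi (j + 1))"

definition chirp :: "real \<Rightarrow> (real^'n \<Rightarrow> complex) \<Rightarrow> (real^'n \<Rightarrow> complex)" where
  "chirp \<alpha> f = (\<lambda>x. exp (\<i> * of_real (pi * (norm x)\<^sup>2 * cot \<alpha>)) * f x)"

definition inv_chirp :: "real \<Rightarrow> (real^'n \<Rightarrow> complex) \<Rightarrow> (real^'n \<Rightarrow> complex)" where
  "inv_chirp \<alpha> f = (\<lambda>x. exp (- (\<i> * of_real (pi * (norm x)\<^sup>2 * cot \<alpha>))) * f x)"

text \<open>
  Convergence in \<open>L\<^sup>q\<close> of a series indexed by the integers: the net of all finite partial sums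
  converges (as in \<^const>\<open>has_sum\<close>), so no order of summation has to be chosen.
\<close>

definition Lp_has_sum ::
  "real \<Rightarrow> (int \<Rightarrow> real^'n \<Rightarrow> complex) \<Rightarrow> (real^'n \<Rightarrow> complex) \<Rightarrow> bool" where
  "Lp_has_sum q u h \<longleftrightarrow>
     h \<in> Lp q \<and>
     ((\<lambda>F. Lp_norm q (\<lambda>x. (\<Sum>j\<in>F. u j x) - h x)) \<longlongrightarrow> 0) (finite_subsets_at_top UNIV)"

definition Lp_sum :: "real \<Rightarrow> (int \<Rightarrow> real^'n \<Rightarrow> complex) \<Rightarrow> (real^'n \<Rightarrow> complex)" where
  "Lp_sum q u = (SOME h. Lp_has_sum q u h)"

end

theory Submission
  imports Defs
begin

text \<open>
  The chirps are isometries of every \<open>L\<^sup>p\<close>, so only the multiplier operators \<open>T\<^sub>j\<close> themselves matter.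
  Let \<open>\<psi>\<^sub>j\<close> be the dilates of an even integrable kernel whose Fourier transform is 1 on the annulus
  \<open>1/2 \<le> |\<xi>| \<le> 2\<close> and 0 at the origin; then \<open>T\<^sub>j f = \<psi>\<^sub>j * T\<^sub>j f = T\<^sub>j (\<psi>\<^sub>j * f)\<close>. Instead of the
  Littlewood-Paley theorem it suffices to have, for \<open>q \<ge> 2\<close>,
  \<open>\<parallel>\<Sum>\<^sub>j \<psi>\<^sub>j * h\<^sub>j\<parallel>\<^sub>q\<^sup>2 \<le> C \<Sum>\<^sub>j \<parallel>h\<^sub>j\<parallel>\<^sub>q\<^sup>2\<close> and its dual \<open>\<Sum>\<^sub>j \<parallel>\<psi>\<^sub>j * f\<parallel>\<^sub>p\<^sup>2 \<le> C \<parallel>f\<parallel>\<^sub>p\<^sup>2\<close> for \<open>1 < p \<le> 2\<close>.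
  With \<open>S\<close> the sum of the terms below \<open>j\<close> and \<open>g = \<psi>\<^sub>j * h\<^sub>j\<close>, one expands \<open>|S + g|\<^sup>q\<close> to second
  order. The linear term \<open>\<integral> |S| powr (q - 2) * Re (cnj S * g)\<close> is small because \<open>\<psi>\<^sub>j\<close> has mean zero while \<open>S\<close>
  varies on larger scales only, and the quadratic term is at most a multiple of
  \<open>\<parallel>S\<parallel>\<^sub>q powr (q - 2) * \<parallel>h\<^sub>j\<parallel>\<^sub>q\<^sup>2\<close>; summing over \<open>j\<close> gives the claim by induction on the number of terms.
\<close>

section \<open>The Lebesgue spaces of a measure\<close>

text \<open>The two square-sum bounds combine to \<open>\<parallel>\<Sum> T_j f\<parallel>_q^2 \<le>
  C \<Sum> \<parallel>T_j f\<parallel>_q^2 \<le> C A^2 \<Sum> \<parallel>\<psi>_j * f\<parallel>_p^2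
  \<le> C' A^2 \<parallel>f\<parallel>_p^2\<close>, with A the common operator bound; this is where
  p \<le> 2 \<le> q enters. Smoothness and decay of the kernel are measured with exponent one half:
  an explicit kernel with piecewise linear Fourier transform decays only like |x|^(-2), so its first
  moment diverges, while its half-order moment is finite and still makes the scales i and j interact
  only by a factor 2^(-|i - j| / 2). Convolution with such a kernel leaves the Schwartz class in
  general, so the operators have to be controlled on the intersection of L^1 and L^p, by
  approximation in both norms at once. On the rest of L^p an operator value is a choice, determined
  only up to null sets; estimates are therefore shown for Schwartz functions and carried over by
  limits. Finally, Fubini is applied for \<open>lborel\<close>, whereas symbols and members of L^p
  are merely Lebesgue measurable; Borel representatives are substituted before convolving.\<close>

definition lp_space :: "'a measure \<Rightarrow> real \<Rightarrow> ('a \<Rightarrow> 'b::{banach,second_countable_topology}) set" where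
  "lp_space M p = {f \<in> borel_measurable M. integrable M (\<lambda>x. norm (f x) powr p)}"

text \<open>Meaningful on \<open>lp_space\<close> only: elsewhere the Bochner integral is 0 by convention.\<close>

definition lp_norm :: "'a measure \<Rightarrow> real \<Rightarrow> ('a \<Rightarrow> 'b::{banach,second_countable_topology}) \<Rightarrow> real" where
  "lp_norm M p f = (\<integral>x. norm (f x) powr p \<partial>M) powr (1 / p)"

lemma lp_spaceD:
  assumes "f \<in> lp_space M p"
  shows lp_space_measurable: "f \<in> borel_measurable M"
    and lp_space_integrable: "integrable M (\<lambda>x. norm (f x) powr p)"
  using assms by (auto simp: lp_space_def)

lemma lp_norm_nonneg [simp]: "0 \<le> lp_norm M p f"
  by (simp add: lp_norm_def)

lemma lp_norm_powr: "0 < p \<Longrightarrow> lp_norm M p f powr p = (\<integral>x. norm (f x) powr p \<partial>M)"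
  by (simp add: lp_norm_def powr_powr integral_nonneg_AE)

lemma lp_norm_le_iff:
  assumes "0 < p" "0 \<le> B"
  shows "lp_norm M p f \<le> B \<longleftrightarrow> (\<integral>x. norm (f x) powr p \<partial>M) \<le> B powr p"
  using assms lp_norm_powr[of p M f]
  by (metis less_eq_real_def linorder_not_le lp_norm_nonneg powr_less_mono2 powr_mono2)

lemma lp_norm_mono:
  assumes "0 < p" and f: "f \<in> lp_space M p" and [measurable]: "g \<in> borel_measurable M"
    and le: "AE x in M. norm (g x) \<le> norm (f x)"
  shows "g \<in> lp_space M p" and "lp_norm M p g \<le> lp_norm M p f"
proof -
  have 1: "AE x in M. norm (g x) powr p \<le> norm (f x) powr p"
    using le by eventually_elim (use \<open>0 < p\<close> in \<open>auto intro: powr_mono2\<close>)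
  have 2: "integrable M (\<lambda>x. norm (g x) powr p)"
    by (rule Bochner_Integration.integrable_bound[OF lp_space_integrable[OF f]]) (use 1 in auto)
  then show "g \<in> lp_space M p" by (simp add: lp_space_def)
  have "(\<integral>x. norm (g x) powr p \<partial>M) \<le> (\<integral>x. norm (f x) powr p \<partial>M)"
    by (rule integral_mono_AE[OF 2 lp_space_integrable[OF f] 1])
  then show "lp_norm M p g \<le> lp_norm M p f"
    unfolding lp_norm_def using \<open>0 < p\<close> by (intro powr_mono2) (auto intro: integral_nonneg_AE)
qed

lemma lp_norm_eq_norm:
  assumes "0 < p" "f \<in> lp_space M p" "g \<in> borel_measurable M"
    and "AE x in M. norm (g x) = norm (f x)"
  shows "g \<in> lp_space M p" and "lp_norm M p g = lp_norm M p f"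
proof -
  have 1: "AE x in M. norm (g x) \<le> norm (f x)" "AE x in M. norm (f x) \<le> norm (g x)"
    using assms(4) by auto
  show g: "g \<in> lp_space M p" by (rule lp_norm_mono[OF assms(1,2,3) 1(1)])
  show "lp_norm M p g = lp_norm M p f"
    using lp_norm_mono(2)[OF assms(1,2,3) 1(1)]
      lp_norm_mono(2)[OF assms(1) g lp_space_measurable[OF assms(2)] 1(2)] by simp
qed

lemma lp_norm_cong_AE:
  assumes "f \<in> borel_measurable M" "g \<in> borel_measurable M" "AE x in M. f x = g x"
  shows "lp_norm M p f = lp_norm M p g"
proof -
  have "(\<integral>x. norm (f x) powr p \<partial>M) = (\<integral>x. norm (g x) powr p \<partial>M)"
    using assms by (intro integral_cong_AE) auto
  then show ?thesis by (simp add: lp_norm_def)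
qed

lemma lp_space_norm [simp]: "0 < p \<Longrightarrow> f \<in> lp_space M p \<Longrightarrow> (\<lambda>x. norm (f x)) \<in> lp_space M p"
  by (auto simp: lp_space_def)

lemma lp_norm_norm [simp]: "lp_norm M p (\<lambda>x. norm (f x)) = lp_norm M p f"
  by (auto simp: lp_norm_def)

lemma lp_norm_zero [simp]: "lp_norm M p (\<lambda>x. 0) = 0"
  by (simp add: lp_norm_def)

lemma lp_space_zero [simp]: "(\<lambda>x. 0) \<in> lp_space M p"
  by (simp add: lp_space_def)

lemma lp_norm_eq_0D:
  assumes "0 < p" "f \<in> lp_space M p" "lp_norm M p f = 0"
  shows "AE x in M. f x = 0"
proof -
  have "(\<integral>x. norm (f x) powr p \<partial>M) = 0"
    using lp_norm_powr[OF assms(1), of M f] assms by simp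
  then have "AE x in M. norm (f x) powr p = 0"
    using integral_nonneg_eq_0_iff_AE[OF lp_space_integrable[OF assms(2)]] by simp
  then show ?thesis by (rule AE_mp) auto
qed

lemma lp_scaleR:
  fixes f :: "'a \<Rightarrow> 'b::{banach,second_countable_topology}"
  assumes "0 < p" "f \<in> lp_space M p"
  shows "(\<lambda>x. c *\<^sub>R f x) \<in> lp_space M p" "lp_norm M p (\<lambda>x. c *\<^sub>R f x) = \<bar>c\<bar> * lp_norm M p f"
  using assms by (auto simp: lp_space_def lp_norm_def powr_mult powr_powr)

lemma lp_mult:
  fixes f :: "'a \<Rightarrow> complex"
  assumes "0 < p" "f \<in> lp_space M p"
  shows "(\<lambda>x. c * f x) \<in> lp_space M p" "lp_norm M p (\<lambda>x. c * f x) = norm c * lp_norm M p f"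
  using assms by (auto simp: lp_space_def lp_norm_def powr_mult powr_powr norm_mult)

text \<open>Convexity of \<open>x powr p\<close> at the points a / s and b / t with weights s / (s +
  t) and t / (s + t). With s and t just above the two norms it integrates to Minkowski's
  inequality.\<close>

lemma powr_add_le_weighted:
  fixes a b s t p :: real
  assumes "1 \<le> p" "0 \<le> a" "0 \<le> b" "0 < s" "0 < t"
  shows "(a + b) powr p \<le> (s + t) powr p * (s / (s + t) * (a / s) powr p + t / (s + t) * (b / t) powr p)"
proof -
  \<comment> \<open>The case of one vanishing summand, treated apart so that convexity is used at
    positive points only; it reduces to \<open>((x + z) / z) powr (p - 1) \<ge> 1\<close>.\<close>
  have aux: "y powr p \<le> (x + z) powr p * (z / (x + z) * (y / z) powr p)"
    if "0 < x" "0 < z" "0 \<le> y" for x y z :: real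
  proof -
    have "1 \<le> ((x + z) / z) powr (p - 1)"
      using that assms by (intro ge_one_powr_ge_zero) (auto simp: field_simps)
    then have "y powr p * 1 \<le> y powr p * ((x + z) / z) powr (p - 1)"
      by (intro mult_left_mono) auto
    also have "\<dots> = (x + z) powr p * (z / (x + z) * (y / z) powr p)"
      using that by (simp add: powr_divide powr_diff field_simps)
    finally show ?thesis by simp
  qed
  consider "a = 0" | "b = 0" | "0 < a" "0 < b" using assms by linarith
  then show ?thesis
  proof cases
    case 1 then show ?thesis using aux[of s t b] assms by simp
  next
    case 2 then show ?thesis using aux[of t s a] assms by (simp add: add.commute)
  next
    case 3
    have "((1 - t / (s + t)) * (a / s) + t / (s + t) * (b / t)) powr p
        \<le> (1 - t / (s + t)) * (a / s) powr p + t / (s + t) * (b / t) powr p"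
      using convex_onD[OF powr_convex[OF assms(1)], of "t / (s + t)" "a / s" "b / t"] 3 assms
      by (simp add: field_simps)
    moreover have "1 - t / (s + t) = s / (s + t)" using assms by (simp add: field_simps)
    moreover have "s / (s + t) * (a / s) + t / (s + t) * (b / t) = (a + b) / (s + t)"
    proof -
      have "s / (s + t) * (a / s) = a / (s + t)" "t / (s + t) * (b / t) = b / (s + t)"
        using assms by auto
      then show ?thesis by (simp add: add_divide_distrib)
    qed
    ultimately have "((a + b) / (s + t)) powr p \<le> s / (s + t) * (a / s) powr p + t / (s + t) * (b / t) powr p"
      by simp
    then have "(s + t) powr p * ((a + b) / (s + t)) powr p
       \<le> (s + t) powr p * (s / (s + t) * (a / s) powr p + t / (s + t) * (b / t) powr p)"
      by (intro mult_left_mono) auto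
    then show ?thesis using assms by (simp add: powr_divide)
  qed
qed

lemma lp_add:
  assumes p: "1 \<le> p" and f: "f \<in> lp_space M p" and g: "g \<in> lp_space M p"
  shows "(\<lambda>x. f x + g x) \<in> lp_space M p"
    and "lp_norm M p (\<lambda>x. f x + g x) \<le> lp_norm M p f + lp_norm M p g"
proof -
  note [measurable] = lp_space_measurable[OF f] lp_space_measurable[OF g]
  note intf = lp_space_integrable[OF f] and intg = lp_space_integrable[OF g]
  have bound: "norm (f x + g x) powr p \<le>
      (s + t) powr p * (s / (s + t) * (norm (f x) powr p / s powr p) + t / (s + t) * (norm (g x) powr p / t powr p))"
    if "0 < s" "0 < t" for s t x
  proof -
    have "norm (f x + g x) powr p \<le> (norm (f x) + norm (g x)) powr p"
      using p by (intro powr_mono2) (auto intro: norm_triangle_ineq)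
    also have "\<dots> \<le> (s + t) powr p * (s / (s + t) * (norm (f x) / s) powr p + t / (s + t) * (norm (g x) / t) powr p)"
      by (rule powr_add_le_weighted) (use p that in auto)
    finally show ?thesis by (simp add: powr_divide)
  qed
  have int: "integrable M (\<lambda>x. norm (f x + g x) powr p)"
    by (rule Bochner_Integration.integrable_bound[of M "\<lambda>x. (1 + 1) powr p * (1 / (1 + 1) * (norm (f x) powr p / 1 powr p) + 1 / (1 + 1) * (norm (g x) powr p / 1 powr p))"])
       (use intf intg bound[of 1 1] in \<open>auto intro!: AE_I2 order_trans[OF _ abs_ge_self]\<close>)
  then show "(\<lambda>x. f x + g x) \<in> lp_space M p" by (simp add: lp_space_def)
  show "lp_norm M p (\<lambda>x. f x + g x) \<le> lp_norm M p f + lp_norm M p g"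
  proof (rule field_le_epsilon)
    fix e :: real assume "0 < e"
    \<comment> \<open>The extra e / 2 keeps s and t positive, so vanishing norms need no separate
      treatment.\<close>
    define s where "s = lp_norm M p f + e / 2"
    define t where "t = lp_norm M p g + e / 2"
    have st: "0 < s" "0 < t" "lp_norm M p f \<le> s" "lp_norm M p g \<le> t"
      using \<open>0 < e\<close> by (auto simp: s_def t_def add_nonneg_pos)
    have A: "(\<integral>x. norm (f x) powr p \<partial>M) / s powr p \<le> 1" "(\<integral>x. norm (g x) powr p \<partial>M) / t powr p \<le> 1"
      using st lp_norm_le_iff[of p s M f] lp_norm_le_iff[of p t M g] p by (auto simp: divide_le_eq)
    have "(\<integral>x. norm (f x + g x) powr p \<partial>M) \<le> (\<integral>x. (s + t) powr p * (s / (s + t) * (norm (f x) powr p / s powr p) + t / (s + t) * (norm (g x) powr p / t powr p)) \<partial>M)"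
      using int intf intg bound[OF st(1,2)] by (intro integral_mono) auto
    also have "\<dots> = (s + t) powr p * (s / (s + t) * ((\<integral>x. norm (f x) powr p \<partial>M) / s powr p) + t / (s + t) * ((\<integral>x. norm (g x) powr p \<partial>M) / t powr p))"
      using intf intg by simp
    also have "\<dots> \<le> (s + t) powr p * (s / (s + t) * 1 + t / (s + t) * 1)"
      using A st by (intro mult_left_mono add_mono) auto
    also have "\<dots> = (s + t) powr p" using st by (simp add: add_divide_distrib[symmetric])
    finally have "lp_norm M p (\<lambda>x. f x + g x) \<le> s + t"
      using lp_norm_le_iff[of p "s + t" M "\<lambda>x. f x + g x"] st p by auto
    then show "lp_norm M p (\<lambda>x. f x + g x) \<le> lp_norm M p f + lp_norm M p g + e"
      by (simp add: s_def t_def)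
  qed
qed

lemma lp_minus:
  assumes "0 < p" "f \<in> lp_space M p"
  shows "(\<lambda>x. - f x) \<in> lp_space M p" "lp_norm M p (\<lambda>x. - f x) = lp_norm M p f"
  using assms by (auto simp: lp_space_def lp_norm_def)

lemma lp_diff:
  assumes p: "1 \<le> p" and f: "f \<in> lp_space M p" and g: "g \<in> lp_space M p"
  shows "(\<lambda>x. f x - g x) \<in> lp_space M p"
    and "lp_norm M p (\<lambda>x. f x - g x) \<le> lp_norm M p f + lp_norm M p g"
  using lp_add[OF p f lp_minus(1)[OF _ g]] lp_minus(2)[of p g M] p g by auto

lemma lp_norm_diff_commute: "lp_norm M p (\<lambda>x. f x - g x) = lp_norm M p (\<lambda>x. g x - f x)"
  by (simp add: lp_norm_def norm_minus_commute)

lemma lp_norm_triangle_sub: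
  assumes p: "1 \<le> p" and f: "f \<in> lp_space M p" and g: "g \<in> lp_space M p"
  shows "lp_norm M p f \<le> lp_norm M p g + lp_norm M p (\<lambda>x. f x - g x)"
  using lp_add(2)[OF p g lp_diff(1)[OF p f g]] by simp

lemma lp_norm_triangle3:
  assumes p: "1 \<le> p" and f: "f \<in> lp_space M p" and g: "g \<in> lp_space M p" and h: "h \<in> lp_space M p"
  shows "lp_norm M p (\<lambda>x. f x - h x) \<le> lp_norm M p (\<lambda>x. f x - g x) + lp_norm M p (\<lambda>x. g x - h x)"
  using lp_add(2)[OF p lp_diff(1)[OF p f g] lp_diff(1)[OF p g h]] by simp

lemma lp_sum:
  assumes p: "1 \<le> p" and f: "\<And>i. i \<in> I \<Longrightarrow> f i \<in> lp_space M p"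
  shows "(\<lambda>x. \<Sum>i\<in>I. f i x) \<in> lp_space M p"
    and "lp_norm M p (\<lambda>x. \<Sum>i\<in>I. f i x) \<le> (\<Sum>i\<in>I. lp_norm M p (f i))"
proof -
  have "(\<lambda>x. \<Sum>i\<in>I. f i x) \<in> lp_space M p \<and> lp_norm M p (\<lambda>x. \<Sum>i\<in>I. f i x) \<le> (\<Sum>i\<in>I. lp_norm M p (f i))"
    using f
  proof (induction I rule: infinite_finite_induct)
    case (insert i I)
    then have IH: "(\<lambda>x. \<Sum>i\<in>I. f i x) \<in> lp_space M p" "lp_norm M p (\<lambda>x. \<Sum>i\<in>I. f i x) \<le> (\<Sum>i\<in>I. lp_norm M p (f i))"
      and i: "f i \<in> lp_space M p" by auto
    show ?case using lp_add[OF p i IH(1)] IH insert.hyps by auto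
  qed auto
  then show "(\<lambda>x. \<Sum>i\<in>I. f i x) \<in> lp_space M p"
    and "lp_norm M p (\<lambda>x. \<Sum>i\<in>I. f i x) \<le> (\<Sum>i\<in>I. lp_norm M p (f i))" by auto
qed

text \<open>Weighted arithmetic-geometric means with weights 1/q, 1/q and (q - 2)/q. In this form q
  = 2, where the conjugate exponent of the third factor would be infinite, is no exception.\<close>

lemma Youngs_inequality_three:
  fixes a b c q :: real
  assumes q: "2 \<le> q" and "0 \<le> a" "0 \<le> b" "0 \<le> c"
  shows "a * b * c powr (q - 2) \<le> (a powr q + b powr q + (q - 2) * c powr q) / q"
proof (cases "a = 0 \<or> b = 0 \<or> c = 0")
  case True then show ?thesis using assms by auto
next
  case False
  then have pos: "0 < a" "0 < b" "0 < c" using assms by auto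
  have "a * b * c powr (q - 2) = ((a * b) powr (q/2)) powr (2/q) * (c powr q) powr ((q - 2) / q)"
    using pos q by (simp add: powr_powr)
  also have "\<dots> \<le> 2/q * (a * b) powr (q/2) + (q - 2) / q * c powr q"
    using pos q by (intro Youngs_inequality_0) (auto simp: field_simps)
  also have "(a * b) powr (q/2) \<le> (a powr q + b powr q) / 2"
  proof -
    have "2 * (a powr (q/2)) * (b powr (q/2)) \<le> (a powr (q/2))\<^sup>2 + (b powr (q/2))\<^sup>2"
      by (rule sum_squares_bound)
    moreover have "(x powr (q/2))\<^sup>2 = x powr q" if "0 < x" for x :: real
      using that by (simp add: powr_power)
    ultimately show ?thesis using pos by (simp add: powr_mult)
  qed
  finally show ?thesis using q by (simp add: add_divide_distrib mult_left_mono divide_right_mono)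
qed

text \<open>Hoelder's inequality with exponents q, q and q / (q - 2), obtained from Young's
  inequality after dividing each function by its norm. It serves both the linear and the quadratic
  term of the expansion of |S + g|^q. For q = 2 the third factor is the indicator of h \<noteq>
  0.\<close>

lemma Holder_three:
  assumes q: "2 \<le> q" and f: "f \<in> lp_space M q" and g: "g \<in> lp_space M q" and h: "h \<in> lp_space M q"
  shows "integrable M (\<lambda>x. norm (f x) * norm (g x) * norm (h x) powr (q - 2))"
    and "(\<integral>x. norm (f x) * norm (g x) * norm (h x) powr (q - 2) \<partial>M)
      \<le> lp_norm M q f * lp_norm M q g * lp_norm M q h powr (q - 2)"
proof -
  note [measurable] = lp_space_measurable[OF f] lp_space_measurable[OF g] lp_space_measurable[OF h]
  note intf = lp_space_integrable[OF f] and intg = lp_space_integrable[OF g] and inth = lp_space_integrable[OF h]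
  show int: "integrable M (\<lambda>x. norm (f x) * norm (g x) * norm (h x) powr (q - 2))"
    by (rule Bochner_Integration.integrable_bound[of M "\<lambda>x. (norm (f x) powr q + norm (g x) powr q + (q - 2) * norm (h x) powr q) / q"])
      (use intf intg inth q Youngs_inequality_three[OF q] in \<open>auto intro!: AE_I2\<close>)
  show "(\<integral>x. norm (f x) * norm (g x) * norm (h x) powr (q - 2) \<partial>M)
      \<le> lp_norm M q f * lp_norm M q g * lp_norm M q h powr (q - 2)" (is "?I \<le> _")
  proof (cases "lp_norm M q f = 0 \<or> lp_norm M q g = 0 \<or> lp_norm M q h = 0")
    case True
    then have "AE x in M. f x = 0 \<or> g x = 0 \<or> h x = 0"
      using lp_norm_eq_0D[OF _ f] lp_norm_eq_0D[OF _ g] lp_norm_eq_0D[OF _ h] q by fastforce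
    then have "AE x in M. norm (f x) * norm (g x) * norm (h x) powr (q - 2) = 0"
      by (rule AE_mp) auto
    then have "?I = 0" by (rule integral_eq_zero_AE)
    then show ?thesis by simp
  next
    case False
    define s t r where "s = lp_norm M q f" and "t = lp_norm M q g" and "r = lp_norm M q h"
    have pos: "0 < s" "0 < t" "0 < r" using False by (auto simp: s_def t_def r_def less_le)
    have I: "(\<integral>x. norm (f x) powr q \<partial>M) = s powr q" "(\<integral>x. norm (g x) powr q \<partial>M) = t powr q"
       "(\<integral>x. norm (h x) powr q \<partial>M) = r powr q"
      using q by (simp_all add: s_def t_def r_def lp_norm_powr)
    have "?I / (s * t * r powr (q - 2)) = (\<integral>x. norm (f x) * norm (g x) * norm (h x) powr (q - 2) / (s * t * r powr (q - 2)) \<partial>M)"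
      by simp
    also have "\<dots> = (\<integral>x. (norm (f x) / s) * (norm (g x) / t) * (norm (h x) / r) powr (q - 2) \<partial>M)"
      by (simp add: powr_divide)
    also have "\<dots> \<le> (\<integral>x. (norm (f x) powr q / s powr q + norm (g x) powr q / t powr q + (q - 2) * (norm (h x) powr q / r powr q)) / q \<partial>M)"
    proof (rule integral_mono)
      show "integrable M (\<lambda>x. norm (f x) / s * (norm (g x) / t) * (norm (h x) / r) powr (q - 2))"
        using integrable_divide_zero[OF int, of "s * t * r powr (q - 2)"] by (simp add: powr_divide)
      show "norm (f x) / s * (norm (g x) / t) * (norm (h x) / r) powr (q - 2) \<le>
         (norm (f x) powr q / s powr q + norm (g x) powr q / t powr q + (q - 2) * (norm (h x) powr q / r powr q)) / q" for x
        using Youngs_inequality_three[OF q, of "norm (f x) / s" "norm (g x) / t" "norm (h x) / r"] pos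
        by (simp add: powr_divide)
    qed (use intf intg inth in auto)
    also have "\<dots> = 1" using intf intg inth pos q by (simp add: I)
    finally show ?thesis using pos by (simp add: s_def t_def r_def divide_le_eq)
  qed
qed

lemma Holder_inequality_lp:
  assumes pq: "1 < p" "1 < q" "1/p + 1/q = 1" and f: "f \<in> lp_space M p" and g: "g \<in> lp_space M q"
  shows "integrable M (\<lambda>x. norm (f x) * norm (g x))"
    and "(\<integral>x. norm (f x) * norm (g x) \<partial>M) \<le> lp_norm M p f * lp_norm M q g"
proof -
  note [measurable] = lp_space_measurable[OF f] lp_space_measurable[OF g]
  note intf = lp_space_integrable[OF f] and intg = lp_space_integrable[OF g]
  show int: "integrable M (\<lambda>x. norm (f x) * norm (g x))"
    by (rule Bochner_Integration.integrable_bound[of M "\<lambda>x. norm (f x) powr p / p + norm (g x) powr q / q"])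
      (use intf intg pq Youngs_inequality[OF pq] in \<open>auto intro!: AE_I2\<close>)
  show "(\<integral>x. norm (f x) * norm (g x) \<partial>M) \<le> lp_norm M p f * lp_norm M q g" (is "?I \<le> _")
  proof (cases "lp_norm M p f = 0 \<or> lp_norm M q g = 0")
    case True
    then have "AE x in M. f x = 0 \<or> g x = 0"
      using lp_norm_eq_0D[OF _ f] lp_norm_eq_0D[OF _ g] pq by fastforce
    then have "AE x in M. norm (f x) * norm (g x) = 0" by (rule AE_mp) auto
    then have "?I = 0" by (rule integral_eq_zero_AE)
    then show ?thesis by simp
  next
    case False
    define s t where "s = lp_norm M p f" and "t = lp_norm M q g"
    have pos: "0 < s" "0 < t" using False by (auto simp: s_def t_def less_le)
    have I: "(\<integral>x. norm (f x) powr p \<partial>M) = s powr p" "(\<integral>x. norm (g x) powr q \<partial>M) = t powr q"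
      using pq by (simp_all add: s_def t_def lp_norm_powr)
    have "?I / (s * t) = (\<integral>x. norm (f x) * norm (g x) / (s * t) \<partial>M)"
      by simp
    also have "\<dots> \<le> (\<integral>x. norm (f x) powr p / s powr p / p + norm (g x) powr q / t powr q / q \<partial>M)"
    proof (rule integral_mono)
      show "norm (f x) * norm (g x) / (s * t) \<le> norm (f x) powr p / s powr p / p + norm (g x) powr q / t powr q / q" for x
        using Youngs_inequality[OF pq, of "norm (f x) / s" "norm (g x) / t"] pos
        by (simp add: powr_divide)
    qed (use intf intg int in auto)
    also have "\<dots> = 1" using intf intg pos pq by (simp add: I)
    finally show ?thesis using pos by (simp add: s_def t_def divide_le_eq)
  qed
qed

text \<open>Gives membership of a pointwise limit and its norm bound together, with no convergence
  in norm required.\<close>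

lemma lp_Fatou:
  assumes p: "0 < p" and f: "\<And>k. f k \<in> lp_space M p" and B: "\<And>k. lp_norm M p (f k) \<le> B"
    and [measurable]: "g \<in> borel_measurable M" and lim: "AE x in M. (\<lambda>k. f k x) \<longlonglongrightarrow> g x"
  shows "g \<in> lp_space M p" and "lp_norm M p g \<le> B"
proof -
  note [measurable] = lp_space_measurable[OF f]
  have B0: "0 \<le> B" using B[of 0] lp_norm_nonneg order_trans by blast
  have "(\<integral>\<^sup>+ x. ennreal (norm (g x) powr p) \<partial>M) = (\<integral>\<^sup>+ x. liminf (\<lambda>k. ennreal (norm (f k x) powr p)) \<partial>M)"
  proof (rule nn_integral_cong_AE)
    show "AE x in M. ennreal (norm (g x) powr p) = liminf (\<lambda>k. ennreal (norm (f k x) powr p))"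
      using lim
    proof eventually_elim
      fix x assume "(\<lambda>k. f k x) \<longlonglongrightarrow> g x"
      then have "(\<lambda>k. ennreal (norm (f k x) powr p)) \<longlonglongrightarrow> ennreal (norm (g x) powr p)"
        using p by (intro tendsto_ennrealI tendsto_powr' tendsto_norm) auto
      then show "ennreal (norm (g x) powr p) = liminf (\<lambda>k. ennreal (norm (f k x) powr p))"
        by (rule lim_imp_Liminf[OF trivial_limit_sequentially, symmetric])
    qed
  qed
  also have "\<dots> \<le> liminf (\<lambda>k. \<integral>\<^sup>+ x. ennreal (norm (f k x) powr p) \<partial>M)"
    by (rule nn_integral_liminf) auto
  also have "\<dots> \<le> liminf (\<lambda>k. ennreal (B powr p))"
  proof (intro Liminf_mono always_eventually allI)
    fix k
    show "(\<integral>\<^sup>+ x. ennreal (norm (f k x) powr p) \<partial>M) \<le> ennreal (B powr p)"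
      using lp_space_integrable[OF f] B[of k] lp_norm_le_iff[OF p B0, of M "f k"]
      by (subst nn_integral_eq_integral) auto
  qed
  also have "\<dots> = ennreal (B powr p)" by (simp add: Liminf_const)
  finally have *: "(\<integral>\<^sup>+ x. ennreal (norm (g x) powr p) \<partial>M) \<le> ennreal (B powr p)" .
  then have int: "integrable M (\<lambda>x. norm (g x) powr p)"
    by (intro integrableI_bounded) (auto simp: order_le_less_trans)
  then show "g \<in> lp_space M p" by (simp add: lp_space_def)
  have "(\<integral>x. norm (g x) powr p \<partial>M) \<le> B powr p"
    using * by (simp add: nn_integral_eq_integral[OF int])
  then show "lp_norm M p g \<le> B" using lp_norm_le_iff[OF p B0] by blast
qed

lemma lp_complete:
  fixes f :: "nat \<Rightarrow> 'a \<Rightarrow> 'b::{banach,second_countable_topology}"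
  assumes p: "1 \<le> p" and f: "\<And>k. f k \<in> lp_space M p"
    and Cauchy: "\<And>e. 0 < e \<Longrightarrow> \<exists>N. \<forall>m\<ge>N. \<forall>n\<ge>N. lp_norm M p (\<lambda>x. f m x - f n x) < e"
  shows "\<exists>g \<in> lp_space M p. (\<lambda>k. lp_norm M p (\<lambda>x. f k x - g x)) \<longlonglongrightarrow> 0"
proof -
  note [measurable] = lp_space_measurable[OF f]
  have p0: "0 < p" using p by simp
  obtain N where N: "\<And>k m n. m \<ge> N k \<Longrightarrow> n \<ge> N k \<Longrightarrow> lp_norm M p (\<lambda>x. f m x - f n x) < (1/2) ^ k"
    using Cauchy[of "(1/2) ^ k" for k] by (metis zero_less_power half_gt_zero_iff zero_less_one)
  \<comment> \<open>A fast subsequence without recursion: the sum dominates every N i with i \<le>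
    k, and the summand k makes r tend to infinity.\<close>
  define r where "r k = (\<Sum>i\<le>k. N i) + k" for k
  have rN: "N k \<le> r k" for k unfolding r_def by (rule trans_le_add1, rule member_le_sum) auto
  have rS: "N k \<le> r (Suc k)" for k unfolding r_def by (rule trans_le_add1, rule member_le_sum) auto
  have rk: "k \<le> r k" for k by (simp add: r_def)
  define d where "d k x = f (r (Suc k)) x - f (r k) x" for k x
  have d: "d k \<in> lp_space M p" "lp_norm M p (d k) \<le> (1/2) ^ k" for k
    unfolding d_def using lp_diff(1)[OF p f f] N[OF rS rN, of k] by auto
  note [measurable] = lp_space_measurable[OF d(1)]
  define G where "G n x = (\<Sum>k<n. norm (d k x))" for n x
  have G: "G n \<in> lp_space M p" "lp_norm M p (G n) \<le> 2" for n
  proof -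
    have *: "(\<lambda>x. norm (d k x)) \<in> lp_space M p" for k using d(1) p by auto
    show "G n \<in> lp_space M p" unfolding G_def using lp_sum(1)[OF p *, of "\<lambda>k. k" "{..<n}"] by simp
    have "lp_norm M p (G n) \<le> (\<Sum>k<n. lp_norm M p (\<lambda>x. norm (d k x)))"
      unfolding G_def by (rule lp_sum(2)[OF p *])
    also have "\<dots> \<le> (\<Sum>k<n. (1/2) ^ k)" using d(2) by (intro sum_mono) simp
    also have "\<dots> \<le> 2" by (simp add: sum_gp_strict)
    finally show "lp_norm M p (G n) \<le> 2" .
  qed
  note [measurable] = lp_space_measurable[OF G(1)]
  have mono: "incseq (\<lambda>n. ennreal (G n x powr p))" for x
    unfolding incseq_def G_def using p
    by (auto intro!: ennreal_leI powr_mono2 sum_mono2 sum_nonneg)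
  have "(\<integral>\<^sup>+x. (SUP n. ennreal (G n x powr p)) \<partial>M) = (SUP n. (\<integral>\<^sup>+x. ennreal (G n x powr p) \<partial>M))"
    by (rule nn_integral_monotone_convergence_SUP) (use mono in \<open>auto simp: incseq_def le_fun_def\<close>)
  also have "\<dots> \<le> ennreal (2 powr p)"
  proof (rule SUP_least)
    fix n
    have Gn: "\<bar>G n x\<bar> = G n x" for x by (simp add: G_def sum_nonneg)
    show "(\<integral>\<^sup>+x. ennreal (G n x powr p) \<partial>M) \<le> ennreal (2 powr p)"
      using lp_space_integrable[OF G(1)[of n]] G(2)[of n] lp_norm_le_iff[OF p0, of 2 M "G n"]
      by (subst nn_integral_eq_integral) (auto simp: Gn)
  qed
  also have "\<dots> < \<infinity>" by simp
  finally have "AE x in M. (SUP n. ennreal (G n x powr p)) \<noteq> \<infinity>"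
    by (intro nn_integral_noteq_infinite) auto
  then have conv: "AE x in M. convergent (\<lambda>k. f (r k) x)"
  proof eventually_elim
    fix x assume "(SUP n. ennreal (G n x powr p)) \<noteq> \<infinity>"
    then obtain s where s: "0 \<le> s" "(SUP n. ennreal (G n x powr p)) = ennreal s"
      by (cases "SUP n. ennreal (G n x powr p)") auto
    have "G n x \<le> s powr (1/p)" for n
    proof -
      have "ennreal (G n x powr p) \<le> ennreal s" using s(2) by (metis SUP_upper UNIV_I)
      then have "G n x powr p \<le> s" using s(1) by simp
      then have "(G n x powr p) powr (1/p) \<le> s powr (1/p)" using p by (intro powr_mono2) auto
      moreover have "0 \<le> G n x" by (simp add: G_def sum_nonneg)
      ultimately show ?thesis using p by (simp add: powr_powr)
    qed
    then have "summable (\<lambda>k. norm (d k x))"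
      unfolding G_def by (intro summableI_nonneg_bounded) auto
    then have "summable (\<lambda>k. d k x)" by (rule summable_norm_cancel)
    then have "convergent (\<lambda>n. \<Sum>k<n. d k x)" by (simp add: summable_iff_convergent)
    moreover have "(\<Sum>k<n. d k x) = f (r n) x - f (r 0) x" for n
      unfolding d_def by (rule sum_lessThan_telescope)
    ultimately have "convergent (\<lambda>n. f (r n) x - f (r 0) x)" by simp
    then have "convergent (\<lambda>n. f (r n) x - f (r 0) x + f (r 0) x)"
      by (intro convergent_add convergent_const)
    then show "convergent (\<lambda>k. f (r k) x)" by simp
  qed
  \<comment> \<open>Where the subsequence diverges, \<open>lim\<close> returns an unspecified value;
    this happens on a null set only and does not affect measurability.\<close>
  define g where "g x = lim (\<lambda>k. f (r k) x)" for x
  have [measurable]: "g \<in> borel_measurable M" unfolding g_def by (rule borel_measurable_lim_metric) auto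
  have lim: "AE x in M. (\<lambda>k. f (r k) x) \<longlonglongrightarrow> g x"
    using conv by eventually_elim (simp add: g_def convergent_LIMSEQ_iff)
  \<comment> \<open>Fatou's lemma along the subsequence, with \<open>f m\<close> held fixed, turns
    the Cauchy property into convergence of the whole sequence.\<close>
  have est: "(\<lambda>x. f m x - g x) \<in> lp_space M p \<and> lp_norm M p (\<lambda>x. f m x - g x) \<le> (1/2) ^ k" if "m \<ge> N k" for m k
  proof -
    have a: "(\<lambda>x. f m x - f (r (i + N k)) x) \<in> lp_space M p" for i by (rule lp_diff(1)[OF p f f])
    have "N k \<le> r (i + N k)" for i using rk[of "i + N k"] by linarith
    then have b: "lp_norm M p (\<lambda>x. f m x - f (r (i + N k)) x) \<le> (1/2) ^ k" for i
      using N[OF that] less_imp_le by blast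
    have c: "AE x in M. (\<lambda>i. f m x - f (r (i + N k)) x) \<longlonglongrightarrow> f m x - g x"
      using lim
    proof eventually_elim
      fix x assume "(\<lambda>k. f (r k) x) \<longlonglongrightarrow> g x"
      then have "(\<lambda>i. f (r (i + N k)) x) \<longlonglongrightarrow> g x" by (rule LIMSEQ_ignore_initial_segment)
      then show "(\<lambda>i. f m x - f (r (i + N k)) x) \<longlonglongrightarrow> f m x - g x" by (intro tendsto_intros)
    qed
    show ?thesis
      using lp_Fatou[OF p0 a b _ c] by auto
  qed
  have "(\<lambda>x. f (N 0) x - (f (N 0) x - g x)) \<in> lp_space M p"
    using lp_diff(1)[OF p f] est[of 0 "N 0"] by blast
  then have "g \<in> lp_space M p" by simp
  moreover have "(\<lambda>k. lp_norm M p (\<lambda>x. f k x - g x)) \<longlonglongrightarrow> 0"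
  proof (rule LIMSEQ_I)
    fix e :: real assume "0 < e"
    then obtain k where k: "(1/2) ^ k < e" using real_arch_pow_inv[of e "1/2"] by auto
    show "\<exists>no. \<forall>n\<ge>no. norm (lp_norm M p (\<lambda>x. f n x - g x) - 0) < e"
      using est[of k] k by (intro exI[of _ "N k"]) (auto intro: order_le_less_trans)
  qed
  ultimately show ?thesis by blast
qed

section \<open>Pointwise inequalities for powers of real and complex numbers\<close>

lemma powr_tangent:
  fixes p c u :: real
  assumes "1 \<le> p" "0 \<le> c" "0 \<le> u"
  shows "p * c powr (p - 1) * u \<le> u powr p + (p - 1) * c powr p"
proof (cases "c = 0 \<or> u = 0")
  case True then show ?thesis using assms by auto
next
  case False
  then have pos: "0 < c" "0 < u" using assms by auto
  have "c powr (p - 1) * u = (c powr p) powr ((p - 1) / p) * (u powr p) powr (1 / p)"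
    using pos assms by (simp add: powr_powr)
  also have "\<dots> \<le> (p - 1) / p * c powr p + 1 / p * u powr p"
    using pos assms by (intro Youngs_inequality_0) (auto simp: field_simps)
  finally have "p * (c powr (p - 1) * u) \<le> p * ((p - 1) / p * c powr p + 1 / p * u powr p)"
    using assms by (intro mult_left_mono) auto
  also have "\<dots> = u powr p + (p - 1) * c powr p"
    using assms by (simp add: distrib_left)
  finally show ?thesis by (simp add: mult.assoc)
qed

text \<open>The tangent of \<open>x powr (\<theta> + 1)\<close> at the right endpoint B lies below
  the graph at A.\<close>

lemma powr_Suc_diff_le:
  fixes A B \<theta> :: real
  assumes "0 \<le> \<theta>" "0 \<le> A" "A \<le> B"
  shows "B powr (\<theta> + 1) - A powr (\<theta> + 1) \<le> (\<theta> + 1) * B powr \<theta> * (B - A)"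
proof -
  have "(\<theta> + 1) * B powr \<theta> * A \<le> A powr (\<theta> + 1) + \<theta> * B powr (\<theta> + 1)"
    using powr_tangent[of "\<theta> + 1" B A] assms by simp
  moreover have "B powr \<theta> * B = B powr (\<theta> + 1)"
    using assms by (simp add: powr_add)
  ultimately show ?thesis by (simp add: algebra_simps)
qed

lemma powr_mult_self: "0 \<le> (x::real) \<Longrightarrow> x powr \<theta> * x = x powr (\<theta> + 1)"
  by (simp add: powr_add)

text \<open>If b has the smaller modulus, the difference is \<open>norm a powr \<theta>\<close>
  times a - b plus \<open>norm a powr \<theta> - norm b powr \<theta>\<close> times b. The second
  part is at most the difference of the powers with exponent \<theta> + 1, to which the tangent
  bound applies, even where \<theta> < 1.\<close>

lemma signed_power_Lipschitz:
  fixes a b :: complex and \<theta> :: real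
  assumes "0 \<le> \<theta>"
  shows "norm (norm a powr \<theta> *\<^sub>R a - norm b powr \<theta> *\<^sub>R b) \<le> (\<theta> + 2) * norm (a - b) * (norm a powr \<theta> + norm b powr \<theta>)"
proof -
  have *: "norm (norm a powr \<theta> *\<^sub>R a - norm b powr \<theta> *\<^sub>R b) \<le> (\<theta> + 2) * norm (a - b) * (norm a powr \<theta> + norm b powr \<theta>)"
    if le: "norm b \<le> norm a" for a b :: complex
  proof -
    have mono: "norm b powr \<theta> \<le> norm a powr \<theta>" using assms le by (intro powr_mono2) auto
    have "norm a powr \<theta> *\<^sub>R a - norm b powr \<theta> *\<^sub>R b = norm a powr \<theta> *\<^sub>R (a - b) + (norm a powr \<theta> - norm b powr \<theta>) *\<^sub>R b"
      by (simp add: algebra_simps)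
    also have "norm \<dots> \<le> norm a powr \<theta> * norm (a - b) + (norm a powr \<theta> - norm b powr \<theta>) * norm b"
      using mono by (intro norm_triangle_le) auto
    also have "(norm a powr \<theta> - norm b powr \<theta>) * norm b \<le> norm a powr (\<theta> + 1) - norm b powr (\<theta> + 1)"
      using mult_left_mono[OF le, of "norm a powr \<theta>"] powr_mult_self[of "norm a" \<theta>] powr_mult_self[of "norm b" \<theta>]
      by (simp add: algebra_simps)
    also have "\<dots> \<le> (\<theta> + 1) * norm a powr \<theta> * (norm a - norm b)"
      by (rule powr_Suc_diff_le) (use assms le in auto)
    also have "\<dots> \<le> (\<theta> + 1) * norm a powr \<theta> * norm (a - b)"
      using assms by (intro mult_left_mono) (auto simp: norm_triangle_ineq2)
    also have "norm a powr \<theta> * norm (a - b) + \<dots> = (\<theta> + 2) * norm (a - b) * norm a powr \<theta>"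
      by (simp add: algebra_simps)
    also have "\<dots> \<le> (\<theta> + 2) * norm (a - b) * (norm a powr \<theta> + norm b powr \<theta>)"
      using assms by (intro mult_left_mono) auto
    finally show ?thesis by simp
  qed
  show ?thesis
  proof (cases "norm b \<le> norm a")
    case False
    then show ?thesis using *[of a b] by (simp add: norm_minus_commute add.commute)
  qed (rule *)
qed

text \<open>A second-order Taylor bound without derivatives. Convexity of
  \<open>x powr (q/2)\<close> in the variable x = |.|^2 yields a first-order bound with the weight
  at a + b; moving the weight to a costs only a term of second order in b.\<close>

lemma norm_add_powr_le:
  fixes a b :: complex and q :: real
  assumes q: "2 \<le> q"
  shows "norm (a + b) powr q \<le> norm a powr q + q * (norm a powr (q - 2) * Re (cnj a * b))
           + q\<^sup>2 * ((norm a + norm b) powr (q - 2) * (norm b)\<^sup>2)"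
proof -
  define A B M \<theta> where "A = norm a" and "B = norm (a + b)" and "M = norm a + norm b" and "\<theta> = q - 2"
  have nn: "0 \<le> A" "0 \<le> B" "A \<le> M" "B \<le> M" "0 \<le> \<theta>"
    using q by (auto simp: A_def B_def M_def \<theta>_def norm_triangle_ineq)
  have sq: "(x\<^sup>2) powr r = x powr (2 * r)" if "0 \<le> x" for x r :: real
    using that by (metis powr_numeral powr_powr)
  \<comment> \<open>The tangent is taken at B^2, since an upper bound for \<open>B powr q\<close> is
    wanted; the price is the weight \<open>B powr \<theta>\<close> instead of
    \<open>A powr \<theta>\<close>.\<close>
  have "q/2 * (B\<^sup>2) powr (q/2 - 1) * A\<^sup>2 \<le> (A\<^sup>2) powr (q/2) + (q/2 - 1) * (B\<^sup>2) powr (q/2)"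
    using q by (intro powr_tangent) auto
  then have 0: "q/2 * B powr \<theta> * A\<^sup>2 \<le> A powr q + (q/2 - 1) * B powr q"
    using nn by (simp add: sq \<theta>_def right_diff_distrib)
  have "B powr \<theta> * B\<^sup>2 = B powr q"
    using nn by (simp add: \<theta>_def powr_diff)
  then have 1: "B powr q \<le> A powr q + q/2 * (B powr \<theta> * (B\<^sup>2 - A\<^sup>2))"
    using 0 by (simp add: algebra_simps)
  \<comment> \<open>For 2 < q < 3 the exponent \<theta> lies below 1 and
    \<open>x powr \<theta>\<close> is not Lipschitz near 0. Multiplying its difference by Y + X
    raises the exponent to \<theta> + 1, where the tangent bound works.\<close>
  have 2: "(Y powr \<theta> - X powr \<theta>) * (Y\<^sup>2 - X\<^sup>2) \<le> 2 * (\<theta> + 1) * (M powr \<theta> * (Y - X)\<^sup>2)"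
    if "0 \<le> X" "X \<le> Y" "Y \<le> M" for X Y
  proof -
    have "X powr \<theta> \<le> Y powr \<theta>" using that nn by (intro powr_mono2) auto
    then have "(Y powr \<theta> - X powr \<theta>) * (Y + X) \<le> (Y powr \<theta> - X powr \<theta>) * (2 * Y)"
      using that by (intro mult_left_mono) auto
    also have "\<dots> \<le> 2 * (Y powr (\<theta> + 1) - X powr (\<theta> + 1))"
      using powr_mult_self[of X \<theta>] powr_mult_self[of Y \<theta>] that mult_left_mono[of X Y "X powr \<theta>"]
      by (simp add: algebra_simps)
    also have "\<dots> \<le> 2 * ((\<theta> + 1) * Y powr \<theta> * (Y - X))"
      using powr_Suc_diff_le[of \<theta> X Y] that nn by simp
    also have "\<dots> \<le> 2 * ((\<theta> + 1) * M powr \<theta> * (Y - X))"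
      using that nn by (intro mult_left_mono mult_right_mono powr_mono2) auto
    finally have "(Y powr \<theta> - X powr \<theta>) * (Y + X) * (Y - X) \<le> 2 * ((\<theta> + 1) * M powr \<theta> * (Y - X)) * (Y - X)"
      using that by (intro mult_right_mono) auto
    then show ?thesis by (simp add: algebra_simps power2_eq_square)
  qed
  have 3: "(B powr \<theta> - A powr \<theta>) * (B\<^sup>2 - A\<^sup>2) \<le> 2 * (\<theta> + 1) * (M powr \<theta> * (B - A)\<^sup>2)"
  proof (cases "A \<le> B")
    case False
    then show ?thesis using 2[of B A] nn by (simp add: algebra_simps power2_commute)
  qed (use 2 nn in auto)
  have BA: "B\<^sup>2 - A\<^sup>2 = 2 * Re (cnj a * b) + (norm b)\<^sup>2"
    unfolding A_def B_def cmod_power2 by (simp add: power2_eq_square algebra_simps)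
  have "\<bar>B - A\<bar> \<le> norm b" unfolding A_def B_def
    using norm_triangle_ineq3[of "a + b" a] by simp
  then have "(B - A)\<^sup>2 \<le> (norm b)\<^sup>2" by (metis abs_le_square_iff abs_norm_cancel)
  then have 4: "2 * (\<theta> + 1) * (M powr \<theta> * (B - A)\<^sup>2) \<le> 2 * (\<theta> + 1) * (M powr \<theta> * (norm b)\<^sup>2)"
    using nn by (intro mult_left_mono) auto
  have 5: "A powr \<theta> * (norm b)\<^sup>2 \<le> M powr \<theta> * (norm b)\<^sup>2"
    using nn by (intro mult_right_mono powr_mono2) auto
  have "B powr q \<le> A powr q + q/2 * (A powr \<theta> * (B\<^sup>2 - A\<^sup>2)) + q/2 * ((B powr \<theta> - A powr \<theta>) * (B\<^sup>2 - A\<^sup>2))"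
    using 1 by (simp add: algebra_simps)
  also have "\<dots> \<le> A powr q + q/2 * (A powr \<theta> * (B\<^sup>2 - A\<^sup>2)) + q/2 * (2 * (\<theta> + 1) * (M powr \<theta> * (norm b)\<^sup>2))"
    using q 3 4 by (intro add_left_mono mult_left_mono) auto
  also have "q/2 * (A powr \<theta> * (B\<^sup>2 - A\<^sup>2)) = q * (A powr \<theta> * Re (cnj a * b)) + q/2 * (A powr \<theta> * (norm b)\<^sup>2)"
    unfolding BA by (simp add: algebra_simps)
  also have "q/2 * (A powr \<theta> * (norm b)\<^sup>2) \<le> q/2 * (M powr \<theta> * (norm b)\<^sup>2)"
    using 5 q by (intro mult_left_mono) auto
  also have "A powr q + (q * (A powr \<theta> * Re (cnj a * b)) + q/2 * (M powr \<theta> * (norm b)\<^sup>2)) + q/2 * (2 * (\<theta> + 1) * (M powr \<theta> * (norm b)\<^sup>2))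
      = A powr q + q * (A powr \<theta> * Re (cnj a * b)) + (q/2 + q * (\<theta> + 1)) * (M powr \<theta> * (norm b)\<^sup>2)"
    by (simp add: algebra_simps)
  \<comment> \<open>With \<theta> = q - 2 the coefficient equals q^2 - q/2.\<close>
  also have "(q/2 + q * (\<theta> + 1)) * (M powr \<theta> * (norm b)\<^sup>2) \<le> q\<^sup>2 * (M powr \<theta> * (norm b)\<^sup>2)"
    using q by (intro mult_right_mono) (auto simp: \<theta>_def power2_eq_square algebra_simps)
  finally show ?thesis by (simp add: A_def B_def M_def \<theta>_def)
qed

section \<open>Convolutions and square sums\<close>

lemma lborel_integral_affine:
  fixes f :: "'a::euclidean_space \<Rightarrow> 'b::{banach,second_countable_topology}" and t :: 'a
  assumes "c \<noteq> 0" "f \<in> borel_measurable borel"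
  shows "(\<integral>x. f x \<partial>lborel) = \<bar>c\<bar> ^ DIM('a) *\<^sub>R (\<integral>x. f (t + c *\<^sub>R x) \<partial>lborel)"
  using assms by (subst lborel_affine[OF assms(1), of t]) (simp add: integral_density integral_distr)

lemma lborel_integrable_affine:
  fixes f :: "'a::euclidean_space \<Rightarrow> 'b::{banach,second_countable_topology}" and t :: 'a
  assumes "c \<noteq> 0" "integrable lborel f"
  shows "integrable lborel (\<lambda>x. f (t + c *\<^sub>R x))"
proof -
  have [measurable]: "f \<in> borel_measurable borel" using assms(2) by auto
  have "integrable (density (distr lborel borel (\<lambda>x. t + c *\<^sub>R x)) (\<lambda>_. ennreal (\<bar>c\<bar>^DIM('a)))) f"
    using assms lborel_affine[of c t] by (simp add: ennreal_power)
  then have "integrable lborel (\<lambda>x. \<bar>c\<bar> ^ DIM('a) *\<^sub>R f (t + c *\<^sub>R x))"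
    using assms(1) by (subst (asm) integrable_density) (auto simp: integrable_distr_eq)
  then show ?thesis
    using assms(1) integrable_scaleR_right[of "inverse (\<bar>c\<bar> ^ DIM('a))" lborel "\<lambda>x. \<bar>c\<bar> ^ DIM('a) *\<^sub>R f (t + c *\<^sub>R x)"]
    by simp
qed

lemma lborel_integral_shift:
  fixes f :: "'a::euclidean_space \<Rightarrow> 'b::{banach,second_countable_topology}"
  assumes "f \<in> borel_measurable borel"
  shows "(\<integral>x. f (x + t) \<partial>lborel) = (\<integral>x. f x \<partial>lborel)" "(\<integral>x. f (x - t) \<partial>lborel) = (\<integral>x. f x \<partial>lborel)"
    "(\<integral>x. f (t - x) \<partial>lborel) = (\<integral>x. f x \<partial>lborel)"
  using lborel_integral_affine[OF _ assms, of 1 t] lborel_integral_affine[OF _ assms, of 1 "-t"]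
    lborel_integral_affine[OF _ assms, of "-1" t] by (simp_all add: add.commute)

lemma lborel_integrable_shift:
  fixes f :: "'a::euclidean_space \<Rightarrow> 'b::{banach,second_countable_topology}"
  assumes "integrable lborel f"
  shows "integrable lborel (\<lambda>x. f (x + t))" "integrable lborel (\<lambda>x. f (x - t))" "integrable lborel (\<lambda>x. f (t - x))"
  using lborel_integrable_affine[OF _ assms, of 1 t] lborel_integrable_affine[OF _ assms, of 1 "-t"]
    lborel_integrable_affine[OF _ assms, of "-1" t] by (simp_all add: add.commute)

lemma lp_shift:
  fixes f :: "'a::euclidean_space \<Rightarrow> 'b::{banach,second_countable_topology}"
  assumes "f \<in> lp_space lborel p"
  shows "(\<lambda>x. f (x - t)) \<in> lp_space lborel p" "lp_norm lborel p (\<lambda>x. f (x - t)) = lp_norm lborel p f"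
proof -
  have [measurable]: "f \<in> borel_measurable borel" using lp_space_measurable[OF assms] by simp
  show "(\<lambda>x. f (x - t)) \<in> lp_space lborel p"
    using lborel_integrable_shift(2)[OF lp_space_integrable[OF assms], of t] by (simp add: lp_space_def)
  show "lp_norm lborel p (\<lambda>x. f (x - t)) = lp_norm lborel p f"
    unfolding lp_norm_def using lborel_integral_shift(2)[of "\<lambda>x. norm (f x) powr p" t] by simp
qed

text \<open>The common shape of the interchanges of convolution integrals below: an integrable
  weight against a family of functions with uniformly bounded L^1 norms.\<close>

lemma Fubini_kernel:
  fixes \<phi> :: "'a::euclidean_space \<Rightarrow> real" and G :: "'a \<Rightarrow> 'a \<Rightarrow> 'b::{banach,second_countable_topology}"
  assumes \<phi>: "integrable lborel \<phi>" and [measurable]: "(\<lambda>(y, x). G y x) \<in> borel_measurable (borel \<Otimes>\<^sub>M borel)"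
    and int: "\<And>y. integrable lborel (G y)" and B: "\<And>y. (\<integral>x. norm (G y x) \<partial>lborel) \<le> B"
  shows "integrable lborel (\<lambda>x. \<integral>y. \<phi> y *\<^sub>R G y x \<partial>lborel)"
    and "integrable lborel (\<lambda>y. \<phi> y *\<^sub>R (\<integral>x. G y x \<partial>lborel))"
    and "(\<integral>x. (\<integral>y. \<phi> y *\<^sub>R G y x \<partial>lborel) \<partial>lborel) = (\<integral>y. \<phi> y *\<^sub>R (\<integral>x. G y x \<partial>lborel) \<partial>lborel)"
proof -
  have [measurable]: "\<phi> \<in> borel_measurable borel" using \<phi> by auto
  have m: "(\<lambda>(y, x). \<phi> y *\<^sub>R G y x) \<in> borel_measurable (lborel \<Otimes>\<^sub>M lborel)"
    by (auto cong: measurable_cong_sets)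
  have "integrable (lborel \<Otimes>\<^sub>M lborel) (\<lambda>(y, x). \<phi> y *\<^sub>R G y x)"
  proof (rule lborel_pair.Fubini_integrable)
    have "integrable lborel (\<lambda>y. \<bar>\<phi> y\<bar> * (\<integral>x. norm (G y x) \<partial>lborel))"
    proof (rule Bochner_Integration.integrable_bound[of _ "\<lambda>y. B * \<phi> y"])
      show "AE y in lborel. norm (\<bar>\<phi> y\<bar> * (\<integral>x. norm (G y x) \<partial>lborel)) \<le> norm (B * \<phi> y)"
      proof (rule AE_I2)
        fix y
        have "0 \<le> (\<integral>x. norm (G y x) \<partial>lborel)" by simp
        then show "norm (\<bar>\<phi> y\<bar> * (\<integral>x. norm (G y x) \<partial>lborel)) \<le> norm (B * \<phi> y)"
          using B[of y] mult_left_mono[of "\<integral>x. norm (G y x) \<partial>lborel" "\<bar>B\<bar>" "\<bar>\<phi> y\<bar>"]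
          by (simp add: abs_mult mult.commute)
      qed
    qed (use \<phi> in auto)
    then show "integrable lborel (\<lambda>x. \<integral>y. norm (case (x, y) of (y, x) \<Rightarrow> \<phi> y *\<^sub>R G y x) \<partial>lborel)"
      by simp
  qed (use m int in auto)
  note I = this
  show "integrable lborel (\<lambda>y. \<phi> y *\<^sub>R (\<integral>x. G y x \<partial>lborel))"
    using lborel_pair.integrable_fst'[OF I] by simp
  show "integrable lborel (\<lambda>x. \<integral>y. \<phi> y *\<^sub>R G y x \<partial>lborel)"
    using lborel_pair.integrable_snd[OF I] by simp
  show "(\<integral>x. (\<integral>y. \<phi> y *\<^sub>R G y x \<partial>lborel) \<partial>lborel) = (\<integral>y. \<phi> y *\<^sub>R (\<integral>x. G y x \<partial>lborel) \<partial>lborel)"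
    using lborel_pair.Fubini_integral[OF I] by simp
qed

section \<open>Convolution with bounded integrable kernels\<close>

definition conv :: "('a::euclidean_space \<Rightarrow> real) \<Rightarrow> ('a \<Rightarrow> complex) \<Rightarrow> 'a \<Rightarrow> complex" where
  "conv \<phi> f x = (\<integral>y. \<phi> y *\<^sub>R f (x - y) \<partial>lborel)"

text \<open>Boundedness, on top of integrability, makes the convolution with any L^p function
  converge at every point, so that no exceptional null sets have to be carried along.\<close>

definition bdd_kernel :: "('a::euclidean_space \<Rightarrow> real) \<Rightarrow> bool" where
  "bdd_kernel \<phi> \<longleftrightarrow> integrable lborel \<phi> \<and> bounded (range \<phi>)"

lemma bdd_kernelD:
  assumes "bdd_kernel \<phi>"
  shows "integrable lborel \<phi>" "\<phi> \<in> borel_measurable borel"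
  using assms by (auto simp: bdd_kernel_def)

lemma bdd_kernel_bound:
  assumes "bdd_kernel \<phi>"
  obtains C where "\<And>x. \<bar>\<phi> x\<bar> \<le> C"
  using assms by (auto simp: bdd_kernel_def bounded_iff)

lemma bdd_kernel_diff_shift:
  assumes "bdd_kernel \<phi>"
  shows "bdd_kernel (\<lambda>z. \<phi> z - \<phi> (z - y))"
proof -
  obtain C where C: "\<And>x. \<bar>\<phi> x\<bar> \<le> C" using bdd_kernel_bound[OF assms] by blast
  have "\<bar>\<phi> z - \<phi> (z - y)\<bar> \<le> C + C" for z
    using abs_triangle_ineq4[of "\<phi> z" "\<phi> (z - y)"] C[of z] C[of "z - y"] by linarith
  then show ?thesis
    unfolding bdd_kernel_def bounded_iff
    using bdd_kernelD(1)[OF assms] lborel_integrable_shift(2)[of \<phi> y] by auto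
qed

lemma bdd_kernel_integrable_mult:
  fixes g :: "'a::euclidean_space \<Rightarrow> 'b::{banach,second_countable_topology}"
  assumes \<phi>: "bdd_kernel \<phi>" and g: "integrable lborel g"
  shows "integrable lborel (\<lambda>y. \<phi> y *\<^sub>R g (x - y))"
proof -
  obtain C where C: "\<And>x. \<bar>\<phi> x\<bar> \<le> C" using bdd_kernel_bound[OF \<phi>] by blast
  have [measurable]: "\<phi> \<in> borel_measurable borel" "g \<in> borel_measurable borel"
    using bdd_kernelD[OF \<phi>] g by auto
  show ?thesis
  proof (rule Bochner_Integration.integrable_bound)
    show "integrable lborel (\<lambda>y. C *\<^sub>R g (x - y))"
      using lborel_integrable_shift(3)[OF g, of x] by auto
    show "AE y in lborel. norm (\<phi> y *\<^sub>R g (x - y)) \<le> norm (C *\<^sub>R g (x - y))"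
      using C by (intro AE_I2) (auto intro!: mult_right_mono order_trans[OF _ abs_ge_self])
  qed auto
qed

text \<open>Since \<open>norm f \<le> 1 + norm f powr p\<close>, the integrability of \<phi> handles
  the first part and its boundedness the second.\<close>

lemma conv_integrable:
  assumes p: "1 \<le> p" and \<phi>: "bdd_kernel \<phi>" and f: "f \<in> lp_space lborel p"
  shows "integrable lborel (\<lambda>y. \<phi> y *\<^sub>R f (x - y))"
proof -
  have [measurable]: "\<phi> \<in> borel_measurable borel" "f \<in> borel_measurable borel"
    using bdd_kernelD[OF \<phi>] lp_space_measurable[OF f] by auto
  show ?thesis
  proof (rule Bochner_Integration.integrable_bound)
    show "integrable lborel (\<lambda>y. \<bar>\<phi> y\<bar> + \<bar>\<phi> y *\<^sub>R norm (f (x - y)) powr p\<bar>)"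
      using bdd_kernelD(1)[OF \<phi>] bdd_kernel_integrable_mult[OF \<phi> lp_space_integrable[OF f], of x] by auto
    show "AE y in lborel. norm (\<phi> y *\<^sub>R f (x - y)) \<le> norm (\<bar>\<phi> y\<bar> + \<bar>\<phi> y *\<^sub>R norm (f (x - y)) powr p\<bar>)"
    proof (rule AE_I2)
      fix y
      have "norm (f (x - y)) \<le> 1 + norm (f (x - y)) powr p"
      proof (cases "norm (f (x - y)) \<le> 1")
        case False
        then have "norm (f (x - y)) powr 1 \<le> norm (f (x - y)) powr p" using p by (intro powr_mono) auto
        then show ?thesis by simp
      qed (simp add: add_increasing2)
      then have "\<bar>\<phi> y\<bar> * norm (f (x - y)) \<le> \<bar>\<phi> y\<bar> * (1 + norm (f (x - y)) powr p)"
        by (intro mult_left_mono) auto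
      then show "norm (\<phi> y *\<^sub>R f (x - y)) \<le> norm (\<bar>\<phi> y\<bar> + \<bar>\<phi> y *\<^sub>R norm (f (x - y)) powr p\<bar>)"
        by (simp add: abs_mult distrib_left)
    qed
  qed auto
qed

lemma conv_measurable [measurable]:
  assumes [measurable]: "\<phi> \<in> borel_measurable borel" "f \<in> borel_measurable borel"
  shows "conv \<phi> f \<in> borel_measurable borel"
  unfolding conv_def[abs_def]
  by (rule sigma_finite_measure.borel_measurable_lebesgue_integral) (auto intro: sigma_finite_lborel)

text \<open>Young's inequality for L^1 against L^p: Jensen's inequality for the measure |\<phi>(y)|
  dy of mass K, pointwise in x, followed by Fubini and translation invariance.\<close>

lemma conv_lp:
  assumes p: "1 \<le> p" and \<phi>: "bdd_kernel \<phi>" and f: "f \<in> lp_space lborel p"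
  shows "conv \<phi> f \<in> lp_space lborel p"
    and "lp_norm lborel p (conv \<phi> f) \<le> (\<integral>y. \<bar>\<phi> y\<bar> \<partial>lborel) * lp_norm lborel p f"
proof -
  note [measurable] = bdd_kernelD(2)[OF \<phi>]
  have [measurable]: "f \<in> borel_measurable borel" using lp_space_measurable[OF f] by simp
  note int\<phi> = bdd_kernelD(1)[OF \<phi>]
  define K where "K = (\<integral>y. \<bar>\<phi> y\<bar> \<partial>lborel)"
  have K0: "0 \<le> K" by (simp add: K_def)
  have a\<phi>: "bdd_kernel (\<lambda>y. \<bar>\<phi> y\<bar>)" using \<phi> by (auto simp: bdd_kernel_def bounded_iff)
  define J where "J x = (\<integral>y. \<bar>\<phi> y\<bar> *\<^sub>R norm (f (x - y)) powr p \<partial>lborel)" for x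
  have pt: "norm (conv \<phi> f x) powr p \<le> K powr (p - 1) * J x" for x
  proof -
    define m where "m = (\<integral>y. \<bar>\<phi> y\<bar> * norm (f (x - y)) \<partial>lborel)"
    have int1: "integrable lborel (\<lambda>y. \<bar>\<phi> y\<bar> * norm (f (x - y)))"
      using integrable_norm[OF conv_integrable[OF p \<phi> f, of x]] by simp
    have intp: "integrable lborel (\<lambda>y. \<bar>\<phi> y\<bar> * norm (f (x - y)) powr p)"
      using bdd_kernel_integrable_mult[OF a\<phi> lp_space_integrable[OF f], of x] by simp
    have m0: "0 \<le> m" by (simp add: m_def)
    have "norm (conv \<phi> f x) \<le> m"
      unfolding conv_def m_def by (rule order_trans[OF integral_norm_bound]) simp
    then have le: "norm (conv \<phi> f x) powr p \<le> m powr p" using p by (intro powr_mono2) auto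
    show ?thesis
    proof (cases "K = 0")
      case True
      then have "AE y in lborel. \<phi> y = 0"
        using integral_nonneg_eq_0_iff_AE[of lborel "\<lambda>y. \<bar>\<phi> y\<bar>"] int\<phi> by (simp add: K_def)
      then have "AE y in lborel. \<bar>\<phi> y\<bar> * norm (f (x - y)) = 0" by eventually_elim simp
      then have "m = 0" unfolding m_def by (rule integral_eq_zero_AE)
      then have "norm (conv \<phi> f x) powr p \<le> 0" using le by simp
      then show ?thesis using True by simp
    next
      case False
      then have K: "0 < K" using K0 by simp
      \<comment> \<open>The tangent point is the mean of \<open>norm (f (x - y))\<close> over
        |\<phi>| / K. There the tangent line integrates to \<open>c powr p * K\<close>, and Jensen's
        inequality results.\<close>
      define c where "c = m / K"
      have c0: "0 \<le> c" using m0 K by (simp add: c_def)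
      have "(\<integral>y. p * c powr (p - 1) * (\<bar>\<phi> y\<bar> * norm (f (x - y))) \<partial>lborel)
         \<le> (\<integral>y. \<bar>\<phi> y\<bar> * norm (f (x - y)) powr p + (p - 1) * c powr p * \<bar>\<phi> y\<bar> \<partial>lborel)"
      proof (rule integral_mono)
        fix y
        have "\<bar>\<phi> y\<bar> * (p * c powr (p - 1) * norm (f (x - y))) \<le> \<bar>\<phi> y\<bar> * (norm (f (x - y)) powr p + (p - 1) * c powr p)"
          by (intro mult_left_mono powr_tangent) (use p c0 in auto)
        then show "p * c powr (p - 1) * (\<bar>\<phi> y\<bar> * norm (f (x - y))) \<le> \<bar>\<phi> y\<bar> * norm (f (x - y)) powr p + (p - 1) * c powr p * \<bar>\<phi> y\<bar>"
          by (simp add: algebra_simps)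
      qed (use int1 intp int\<phi> in auto)
      also have "\<dots> = J x + (p - 1) * c powr p * K"
        using intp int\<phi> by (simp add: J_def K_def)
      finally have "p * c powr (p - 1) * m \<le> J x + (p - 1) * c powr p * K" by (simp add: m_def)
      moreover have "c powr (p - 1) * m = c powr p * K"
      proof -
        have "m = c * K" using K by (simp add: c_def)
        then show ?thesis using powr_mult_self[OF c0, of "p - 1"] by (simp add: mult.assoc[symmetric])
      qed
      moreover have "p * c powr (p - 1) * m = p * (c powr (p - 1) * m)" by simp
      moreover have "(p - 1) * c powr p * K = p * (c powr p * K) - c powr p * K" by (simp add: algebra_simps)
      ultimately have "c powr p * K \<le> J x" by simp
      then have "K powr (p - 1) * (c powr p * K) \<le> K powr (p - 1) * J x" by (intro mult_left_mono) auto
      moreover have "K powr (p - 1) * (c powr p * K) = m powr p"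
        using K by (simp add: c_def powr_divide powr_diff)
      ultimately show ?thesis using le by simp
    qed
  qed
  have G: "(\<lambda>(y, x). norm (f (x - y)) powr p) \<in> borel_measurable (borel \<Otimes>\<^sub>M borel)" by measurable
  have Gi: "integrable lborel (\<lambda>x. norm (f (x - y)) powr p)"
    and Gb: "(\<integral>x. norm (norm (f (x - y)) powr p) \<partial>lborel) \<le> lp_norm lborel p f powr p" for y
    using lborel_integrable_shift(2)[OF lp_space_integrable[OF f], of y] p
      lborel_integral_shift(2)[of "\<lambda>x. norm (f x) powr p" y] by (simp_all add: lp_norm_powr)
  have Gv: "(\<integral>x. norm (f (x - y)) powr p \<partial>lborel) = lp_norm lborel p f powr p" for y
    using lborel_integral_shift(2)[of "\<lambda>x. norm (f x) powr p" y] p by (simp add: lp_norm_powr)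
  have a: "integrable lborel (\<lambda>y. \<bar>\<phi> y\<bar>)" using int\<phi> by simp
  have Ji: "integrable lborel J" and Jv: "integral\<^sup>L lborel J = K * lp_norm lborel p f powr p"
    using Fubini_kernel(1,3)[OF a G Gi Gb] by (simp_all add: J_def[abs_def] Gv K_def)
  have int: "integrable lborel (\<lambda>x. norm (conv \<phi> f x) powr p)"
    by (rule Bochner_Integration.integrable_bound[of lborel "\<lambda>x. K powr (p - 1) * J x"])
      (use Ji pt in \<open>auto intro!: AE_I2 order_trans[OF _ abs_ge_self]\<close>)
  then show "conv \<phi> f \<in> lp_space lborel p" by (simp add: lp_space_def)
  have "(\<integral>x. norm (conv \<phi> f x) powr p \<partial>lborel) \<le> (\<integral>x. K powr (p - 1) * J x \<partial>lborel)"
    using int Ji pt by (intro integral_mono) auto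
  also have "\<dots> = (K powr (p - 1) * K) * lp_norm lborel p f powr p" by (simp add: Jv)
  also have "\<dots> = (K * lp_norm lborel p f) powr p" using powr_mult_self[OF K0, of "p - 1"] by (simp add: powr_mult)
  finally show "lp_norm lborel p (conv \<phi> f) \<le> K * lp_norm lborel p f"
    using lp_norm_le_iff[of p "K * lp_norm lborel p f"] p K0 by auto
qed

text \<open>A translation of the convolution is a translation of its kernel, so the L^q modulus of
  continuity is inherited from the L^1 modulus of \<phi>, whatever f is.\<close>

lemma conv_diff_left:
  assumes p: "1 \<le> p" and \<phi>: "bdd_kernel \<phi>" and f: "f \<in> lp_space lborel p"
  shows "conv \<phi> f x - conv \<phi> f (x - y) = conv (\<lambda>z. \<phi> z - \<phi> (z - y)) f x"
proof -
  note [measurable] = bdd_kernelD(2)[OF \<phi>]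
  have [measurable]: "f \<in> borel_measurable borel" using lp_space_measurable[OF f] by simp
  have "conv \<phi> f (x - y) = (\<integral>z. \<phi> (z - y) *\<^sub>R f (x - z) \<partial>lborel)"
    unfolding conv_def using lborel_integral_shift(2)[of "\<lambda>z. \<phi> z *\<^sub>R f (x - y - z)" y] by simp
  moreover have "integrable lborel (\<lambda>z. \<phi> (z - y) *\<^sub>R f (x - z))"
    using lborel_integrable_shift(2)[OF conv_integrable[OF p \<phi> f, of "x - y"], of y] by simp
  ultimately show ?thesis
    unfolding conv_def using conv_integrable[OF p \<phi> f, of x] by (simp add: scaleR_diff_left)
qed

lemma conv_diff_right:
  assumes p: "1 \<le> p" and \<phi>: "bdd_kernel \<phi>" and f: "f \<in> lp_space lborel p" and g: "g \<in> lp_space lborel p"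
  shows "conv \<phi> (\<lambda>x. f x - g x) x = conv \<phi> f x - conv \<phi> g x"
  unfolding conv_def using conv_integrable[OF p \<phi> f, of x] conv_integrable[OF p \<phi> g, of x]
  by (simp add: scaleR_diff_right)

section \<open>Pairings with a convolution\<close>

lemma borel_measurable_cnj [measurable (raw)]:
  "f \<in> borel_measurable M \<Longrightarrow> (\<lambda>x. cnj (f x)) \<in> borel_measurable M"
  by (rule borel_measurable_continuous_on[of cnj]) (auto intro!: continuous_intros)

text \<open>Because the kernel has mean zero, \<open>F(x)\<close> may be replaced by \<open>F(x) - F(x - y)\<close> with
  \<open>F = |S| powr (q - 2) * cnj S\<close>, and the smoothness of \<open>S\<close> can be exploited.\<close>

lemma duality_pairing_conv_le:
  fixes S h :: "'a::euclidean_space \<Rightarrow> complex"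
  assumes q: "2 \<le> q" and \<phi>: "bdd_kernel \<phi>" and mean: "(\<integral>y. \<phi> y \<partial>lborel) = 0"
    and S: "S \<in> lp_space lborel q" and h: "h \<in> lp_space lborel q"
    and M: "\<And>y. lp_norm lborel q (\<lambda>x. S x - S (x - y)) \<le> M * sqrt (norm y)"
    and mom: "integrable lborel (\<lambda>y. \<bar>\<phi> y\<bar> * sqrt (norm y))"
  shows "(\<integral>x. norm (S x) powr (q - 2) * Re (cnj (S x) * conv \<phi> h x) \<partial>lborel)
     \<le> 2 * q * M * lp_norm lborel q S powr (q - 2) * lp_norm lborel q h * (\<integral>y. \<bar>\<phi> y\<bar> * sqrt (norm y) \<partial>lborel)"
proof -
  note [measurable] = bdd_kernelD(2)[OF \<phi>]
  have [measurable]: "S \<in> borel_measurable borel" "h \<in> borel_measurable borel"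
    using lp_space_measurable[OF S] lp_space_measurable[OF h] by simp_all
  have q1: "1 \<le> q" "0 < q" using q by auto
  define nS nh where "nS = lp_norm lborel q S" and "nh = lp_norm lborel q h"
  define F where "F x = norm (S x) powr (q - 2) *\<^sub>R cnj (S x)" for x
  have [measurable]: "F \<in> borel_measurable borel" unfolding F_def by measurable
  define G where "G y x = F x * h (x - y)" for y x
  have nF: "norm (F x) = norm (S x) * norm (S x) powr (q - 2)" for x by (simp add: F_def)
  have Gm: "(\<lambda>(y, x). G y x) \<in> borel_measurable (borel \<Otimes>\<^sub>M borel)" unfolding G_def by measurable
  have nG: "norm (G y x) = norm (S x) * norm (h (x - y)) * norm (S x) powr (q - 2)" for x y
    by (simp add: G_def norm_mult nF)
  have Gi: "integrable lborel (G y)" and Gb: "(\<integral>x. norm (G y x) \<partial>lborel) \<le> nS * nh * nS powr (q - 2)" for y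
  proof -
    have "integrable lborel (\<lambda>x. norm (G y x))"
      unfolding nG using Holder_three(1)[OF q S lp_shift(1)[OF h] S] by simp
    moreover have "(\<lambda>x. F x * h (x - y)) \<in> borel_measurable borel" by measurable
    then have "G y \<in> borel_measurable lborel" by (simp add: G_def[abs_def])
    ultimately show "integrable lborel (G y)" by (simp add: integrable_norm_iff)
    show "(\<integral>x. norm (G y x) \<partial>lborel) \<le> nS * nh * nS powr (q - 2)"
      unfolding nG nS_def nh_def using Holder_three(2)[OF q S lp_shift(1)[OF h] S] lp_shift(2)[OF h] by simp
  qed
  \<comment> \<open>The pairing of F with \<open>h (x - y)\<close> minus that of
    \<open>F (x - y)\<close> with \<open>h (x - y)\<close>. The latter does not depend on y, by
    translation invariance, and is removed by the vanishing mean of \<phi>; the former difference is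
    small by the modulus of S.\<close>
  define D where "D y = (\<integral>x. (F x - F (x - y)) * h (x - y) \<partial>lborel)" for y
  have GD: "(\<integral>x. G y x \<partial>lborel) = D y + (\<integral>x. F x * h x \<partial>lborel)" for y
  proof -
    have i0: "integrable lborel (\<lambda>x. F (x - y) * h (x - y))"
      using lborel_integrable_shift(2)[OF Gi[of 0], of y] by (simp add: G_def)
    have e0: "(\<integral>x. F (x - y) * h (x - y) \<partial>lborel) = (\<integral>x. F x * h x \<partial>lborel)"
      using lborel_integral_shift(2)[of "\<lambda>x. F x * h x" y] by simp
    have "D y = (\<integral>x. G y x - F (x - y) * h (x - y) \<partial>lborel)" by (simp add: D_def G_def left_diff_distrib)
    also have "\<dots> = (\<integral>x. G y x \<partial>lborel) - (\<integral>x. F x * h x \<partial>lborel)"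
      using Gi[of y] i0 e0 by simp
    finally show ?thesis by simp
  qed
  have Db: "norm (D y) \<le> 2 * q * M * nS powr (q - 2) * nh * sqrt (norm y)" for y
  proof -
    let ?d = "\<lambda>x. S x - S (x - y)"
    have d: "?d \<in> lp_space lborel q" by (rule lp_diff(1)[OF q1(1) S lp_shift(1)[OF S]])
    note H1 = Holder_three[OF q d lp_shift(1)[OF h, of y] S]
    note H2 = Holder_three[OF q d lp_shift(1)[OF h, of y] lp_shift(1)[OF S, of y]]
    have pt: "norm ((F x - F (x - y)) * h (x - y)) \<le>
       q * (norm (?d x) * norm (h (x - y)) * norm (S x) powr (q - 2) + norm (?d x) * norm (h (x - y)) * norm (S (x - y)) powr (q - 2))" for x
    proof -
      have "norm (F x - F (x - y)) \<le> q * norm (?d x) * (norm (S x) powr (q - 2) + norm (S (x - y)) powr (q - 2))"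
        using signed_power_Lipschitz[of "q - 2" "cnj (S x)" "cnj (S (x - y))"] q
        unfolding F_def complex_cnj_diff[symmetric] complex_mod_cnj by simp
      then have "norm (F x - F (x - y)) * norm (h (x - y)) \<le> q * norm (?d x) * (norm (S x) powr (q - 2) + norm (S (x - y)) powr (q - 2)) * norm (h (x - y))"
        by (rule mult_right_mono) simp
      then show ?thesis unfolding norm_mult by (simp add: distrib_left distrib_right mult_ac)
    qed
    have "norm (D y) \<le> (\<integral>x. norm ((F x - F (x - y)) * h (x - y)) \<partial>lborel)"
      unfolding D_def by (rule integral_norm_bound)
    also have "\<dots> \<le> (\<integral>x. q * (norm (?d x) * norm (h (x - y)) * norm (S x) powr (q - 2) + norm (?d x) * norm (h (x - y)) * norm (S (x - y)) powr (q - 2)) \<partial>lborel)"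
      using H1(1) H2(1) pt q1 by (intro integral_mono') (auto intro!: Bochner_Integration.integrable_add integrable_mult_right mult_nonneg_nonneg add_nonneg_nonneg)
    also have "\<dots> = q * ((\<integral>x. norm (?d x) * norm (h (x - y)) * norm (S x) powr (q - 2) \<partial>lborel) + (\<integral>x. norm (?d x) * norm (h (x - y)) * norm (S (x - y)) powr (q - 2) \<partial>lborel))"
      using H1(1) H2(1) by simp
    also have "\<dots> \<le> q * (lp_norm lborel q ?d * nh * nS powr (q - 2) + lp_norm lborel q ?d * nh * nS powr (q - 2))"
      using H1(2) H2(2) q lp_shift(2)[OF h, of y] lp_shift(2)[OF S, of y]
      by (intro mult_left_mono add_mono) (auto simp: nS_def nh_def)
    also have "\<dots> = 2 * q * nS powr (q - 2) * nh * lp_norm lborel q ?d" by (simp add: algebra_simps)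
    also have "\<dots> \<le> 2 * q * nS powr (q - 2) * nh * (M * sqrt (norm y))"
      using M[of y] q by (intro mult_left_mono) (auto simp: nh_def)
    finally show ?thesis by (simp add: algebra_simps)
  qed
  have c: "(\<integral>x. F x * conv \<phi> h x \<partial>lborel) = (\<integral>y. \<phi> y *\<^sub>R D y \<partial>lborel)"
    and ci: "integrable lborel (\<lambda>x. F x * conv \<phi> h x)" and Di: "integrable lborel (\<lambda>y. \<phi> y *\<^sub>R D y)"
  proof -
    have e: "F x * conv \<phi> h x = (\<integral>y. \<phi> y *\<^sub>R G y x \<partial>lborel)" for x
    proof -
      have "F x * conv \<phi> h x = (\<integral>y. F x * (\<phi> y *\<^sub>R h (x - y)) \<partial>lborel)"
        unfolding conv_def by (rule integral_mult_right_zero[symmetric])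
      then show ?thesis by (simp add: G_def)
    qed
    show "integrable lborel (\<lambda>x. F x * conv \<phi> h x)"
      unfolding e by (rule Fubini_kernel(1)[OF bdd_kernelD(1)[OF \<phi>] Gm Gi Gb])
    have i: "integrable lborel (\<lambda>y. \<phi> y *\<^sub>R (D y + (\<integral>x. F x * h x \<partial>lborel)))"
      using Fubini_kernel(2)[OF bdd_kernelD(1)[OF \<phi>] Gm Gi Gb] by (simp add: GD)
    have i2: "integrable lborel (\<lambda>y. \<phi> y *\<^sub>R (\<integral>x. F x * h x \<partial>lborel))"
      using bdd_kernelD(1)[OF \<phi>] by simp
    show Di: "integrable lborel (\<lambda>y. \<phi> y *\<^sub>R D y)"
      using Bochner_Integration.integrable_diff[OF i i2] by (simp add: scaleR_add_right)
    have "(\<integral>x. F x * conv \<phi> h x \<partial>lborel) = (\<integral>y. \<phi> y *\<^sub>R D y + \<phi> y *\<^sub>R (\<integral>x. F x * h x \<partial>lborel) \<partial>lborel)"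
      unfolding e using Fubini_kernel(3)[OF bdd_kernelD(1)[OF \<phi>] Gm Gi Gb] by (simp add: GD scaleR_add_right)
    also have "\<dots> = (\<integral>y. \<phi> y *\<^sub>R D y \<partial>lborel) + (\<integral>y. \<phi> y \<partial>lborel) *\<^sub>R (\<integral>x. F x * h x \<partial>lborel)"
      using Di i2 bdd_kernelD(1)[OF \<phi>] by simp
    finally show "(\<integral>x. F x * conv \<phi> h x \<partial>lborel) = (\<integral>y. \<phi> y *\<^sub>R D y \<partial>lborel)" by (simp add: mean)
  qed
  have "(\<integral>x. norm (S x) powr (q - 2) * Re (cnj (S x) * conv \<phi> h x) \<partial>lborel) = (\<integral>x. Re (F x * conv \<phi> h x) \<partial>lborel)"
    by (simp add: F_def scaleR_conv_of_real algebra_simps)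
  also have "\<dots> = Re (\<integral>y. \<phi> y *\<^sub>R D y \<partial>lborel)" by (simp only: integral_Re[OF ci] c)
  also have "\<dots> \<le> (\<integral>y. norm (\<phi> y *\<^sub>R D y) \<partial>lborel)"
    using complex_Re_le_cmod integral_norm_bound order_trans by blast
  also have "\<dots> \<le> (\<integral>y. (2 * q * M * nS powr (q - 2) * nh) * (\<bar>\<phi> y\<bar> * sqrt (norm y)) \<partial>lborel)"
  proof (rule integral_mono)
    show "integrable lborel (\<lambda>y. norm (\<phi> y *\<^sub>R D y))" by (rule integrable_norm[OF Di])
  next
    fix y
    show "norm (\<phi> y *\<^sub>R D y) \<le> (2 * q * M * nS powr (q - 2) * nh) * (\<bar>\<phi> y\<bar> * sqrt (norm y))"
      using mult_left_mono[OF Db[of y], of "\<bar>\<phi> y\<bar>"] by (simp add: algebra_simps)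
  qed (use mom in auto)
  also have "\<dots> = 2 * q * M * nS powr (q - 2) * nh * (\<integral>y. \<bar>\<phi> y\<bar> * sqrt (norm y) \<partial>lborel)" by simp
  finally show ?thesis by (simp add: nS_def nh_def)
qed

lemma conv_pairing_integrable:
  fixes f h :: "'a::euclidean_space \<Rightarrow> complex"
  assumes pq: "1 < p" "1 < q" "1/p + 1/q = 1" and f: "f \<in> lp_space lborel p" and h: "h \<in> lp_space lborel q"
  shows "integrable lborel (\<lambda>x. f x * h x)" and "norm (\<integral>x. f x * h x \<partial>lborel) \<le> lp_norm lborel p f * lp_norm lborel q h"
    and "(\<integral>x. norm (f x * h x) \<partial>lborel) \<le> lp_norm lborel p f * lp_norm lborel q h"
proof -
  have [measurable]: "f \<in> borel_measurable borel" "h \<in> borel_measurable borel"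
    using lp_space_measurable[OF f] lp_space_measurable[OF h] by simp_all
  note H = Holder_inequality_lp[OF pq f h]
  show "integrable lborel (\<lambda>x. f x * h x)"
    by (rule Bochner_Integration.integrable_bound[OF H(1)]) (auto simp: norm_mult)
  show *: "(\<integral>x. norm (f x * h x) \<partial>lborel) \<le> lp_norm lborel p f * lp_norm lborel q h"
    using H(2) by (simp add: norm_mult)
  show "norm (\<integral>x. f x * h x \<partial>lborel) \<le> lp_norm lborel p f * lp_norm lborel q h"
    by (rule order_trans[OF integral_norm_bound *])
qed

text \<open>The transpose of convolution is convolution with the reflected kernel; for an even
  kernel it is the same operator. The pairing is bilinear, without conjugation.\<close>

lemma conv_even_symmetric:
  fixes f h :: "'a::euclidean_space \<Rightarrow> complex"
  assumes pq: "1 < p" "1 < q" "1/p + 1/q = 1" and f: "f \<in> lp_space lborel p" and h: "h \<in> lp_space lborel q"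
    and \<phi>: "bdd_kernel \<phi>" and even: "\<And>y. \<phi> (- y) = \<phi> y"
  shows "(\<integral>x. conv \<phi> f x * h x \<partial>lborel) = (\<integral>x. f x * conv \<phi> h x \<partial>lborel)"
proof -
  note [measurable] = bdd_kernelD(2)[OF \<phi>]
  have [measurable]: "f \<in> borel_measurable borel" "h \<in> borel_measurable borel"
    using lp_space_measurable[OF f] lp_space_measurable[OF h] by simp_all
  define G where "G y x = f (x - y) * h x" for y x
  define H where "H y x = f x * h (x - y)" for y x
  have Gm: "(\<lambda>(y, x). G y x) \<in> borel_measurable (borel \<Otimes>\<^sub>M borel)" unfolding G_def by measurable
  have Hm: "(\<lambda>(y, x). H y x) \<in> borel_measurable (borel \<Otimes>\<^sub>M borel)" unfolding H_def by measurable
  have Gi: "integrable lborel (G y)" and Gb: "(\<integral>x. norm (G y x) \<partial>lborel) \<le> lp_norm lborel p f * lp_norm lborel q h" for y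
    using conv_pairing_integrable(1,3)[OF pq lp_shift(1)[OF f, of y] h] lp_shift(2)[OF f, of y]
    by (simp_all add: G_def[abs_def])
  have Hi: "integrable lborel (H y)" and Hb: "(\<integral>x. norm (H y x) \<partial>lborel) \<le> lp_norm lborel p f * lp_norm lborel q h" for y
    using conv_pairing_integrable(1,3)[OF pq f lp_shift(1)[OF h, of y]] lp_shift(2)[OF h, of y]
    by (simp_all add: H_def[abs_def])
  have GH: "(\<integral>x. G y x \<partial>lborel) = (\<integral>x. H (- y) x \<partial>lborel)" for y
    using lborel_integral_shift(2)[of "\<lambda>x. f x * h (x + y)" y] by (simp add: G_def H_def)
  have "(\<integral>x. conv \<phi> f x * h x \<partial>lborel) = (\<integral>x. (\<integral>y. \<phi> y *\<^sub>R G y x \<partial>lborel) \<partial>lborel)"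
    unfolding conv_def G_def by (simp flip: integral_mult_left_zero)
  also have "\<dots> = (\<integral>y. \<phi> y *\<^sub>R (\<integral>x. G y x \<partial>lborel) \<partial>lborel)"
    by (rule Fubini_kernel(3)[OF bdd_kernelD(1)[OF \<phi>] Gm Gi Gb])
  also have "\<dots> = (\<integral>y. \<phi> (- y) *\<^sub>R (\<integral>x. H (- y) x \<partial>lborel) \<partial>lborel)" by (simp add: even GH)
  also have "\<dots> = (\<integral>y. \<phi> y *\<^sub>R (\<integral>x. H y x \<partial>lborel) \<partial>lborel)"
    using lborel_integral_shift(3)[of "\<lambda>y. \<phi> y *\<^sub>R (\<integral>x. H y x \<partial>lborel)" 0]
      borel_measurable_integrable[OF Fubini_kernel(2)[OF bdd_kernelD(1)[OF \<phi>] Hm Hi Hb]] by simp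
  also have "\<dots> = (\<integral>x. (\<integral>y. \<phi> y *\<^sub>R H y x \<partial>lborel) \<partial>lborel)"
    by (rule Fubini_kernel(3)[OF bdd_kernelD(1)[OF \<phi>] Hm Hi Hb, symmetric])
  also have "\<dots> = (\<integral>x. f x * conv \<phi> h x \<partial>lborel)"
    unfolding conv_def H_def by (simp flip: integral_mult_right_zero)
  finally show ?thesis .
qed

section \<open>Square-sum inequalities for dyadic families of kernels\<close>

lemma geometric_double_sum_le:
  fixes b :: "nat \<Rightarrow> real"
  shows "(\<Sum>n<N. \<Sum>i<n. (1 / sqrt 2) ^ (n - i) * b i * b n) \<le> 4 * (\<Sum>n<N. (b n)\<^sup>2)"
proof -
  define r :: real where "r = 1 / sqrt 2"
  have r: "0 < r" "r < 1" "1 / (1 - r) \<le> 4"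
  proof -
    \<comment> \<open>A crude rational bound r \<le> 3/4, chosen so that the geometric series sums
      to at most 4.\<close>
    have "(4/3)\<^sup>2 \<le> (2::real)" by (simp add: power2_eq_square)
    then have "4/3 \<le> sqrt 2" using real_le_rsqrt by blast
    then have "r \<le> 3/4" by (simp add: r_def field_simps)
    then have "1/4 \<le> 1 - r" by simp
    then have "1 / (1 - r) \<le> 1 / (1/4)" by (intro divide_left_mono) auto
    then show "0 < r" "r < 1" "1 / (1 - r) \<le> 4" by (auto simp: r_def)
  qed
  have geo: "(\<Sum>i<m. r ^ i) \<le> 4" for m
  proof -
    have "(\<Sum>i<m. r ^ i) = (1 - r ^ m) / (1 - r)" using r by (simp add: sum_gp_strict)
    also have "\<dots> \<le> 1 / (1 - r)" using r by (intro divide_right_mono) auto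
    finally show ?thesis using r by simp
  qed
  have geo1: "(\<Sum>i<n. r ^ (n - i)) \<le> 4" for n
  proof -
    have "(\<Sum>i<n. r ^ (n - i)) = (\<Sum>i<n. r ^ (Suc i))"
      by (rule sum.reindex_bij_witness[of _ "\<lambda>i. n - Suc i" "\<lambda>i. n - Suc i"]) (auto simp: Suc_diff_Suc)
    also have "\<dots> \<le> (\<Sum>i<n. r ^ i)" using r by (intro sum_mono) (auto simp: mult_left_le_one_le)
    finally show ?thesis using geo[of n] by simp
  qed
  have geo2: "(\<Sum>n=Suc i..<N. r ^ (n - i)) \<le> 4" for i
  proof -
    have "(\<Sum>n=Suc i..<N. r ^ (n - i)) = (\<Sum>k<N - Suc i. r ^ Suc k)"
      by (rule sum.reindex_bij_witness[of _ "\<lambda>k. Suc (k + i)" "\<lambda>n. n - Suc i"]) (auto simp: Suc_diff_Suc simp flip: power_Suc)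
    also have "\<dots> \<le> (\<Sum>k<N - Suc i. r ^ k)" using r by (intro sum_mono) (auto simp: mult_left_le_one_le)
    finally show ?thesis using geo[of "N - Suc i"] by simp
  qed
  \<comment> \<open>Schur's test: b i * b n is split by the inequality of means, and the row sums
    and the column sums of the matrix r^(n - i) are both at most 4.\<close>
  have "(\<Sum>n<N. \<Sum>i<n. r ^ (n - i) * b i * b n) \<le> (\<Sum>n<N. \<Sum>i<n. r ^ (n - i) * (b i)\<^sup>2 / 2 + r ^ (n - i) * (b n)\<^sup>2 / 2)"
  proof (intro sum_mono)
    fix n i
    have "b i * b n \<le> (b i)\<^sup>2 / 2 + (b n)\<^sup>2 / 2" using sum_squares_bound[of "b i" "b n"] by simp
    then have "r ^ (n - i) * (b i * b n) \<le> r ^ (n - i) * ((b i)\<^sup>2 / 2 + (b n)\<^sup>2 / 2)"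
      using r by (intro mult_left_mono) auto
    then show "r ^ (n - i) * b i * b n \<le> r ^ (n - i) * (b i)\<^sup>2 / 2 + r ^ (n - i) * (b n)\<^sup>2 / 2"
      by (simp add: algebra_simps)
  qed
  also have "\<dots> = (\<Sum>n<N. \<Sum>i<n. r ^ (n - i) * (b i)\<^sup>2 / 2) + (\<Sum>n<N. \<Sum>i<n. r ^ (n - i) * (b n)\<^sup>2 / 2)"
    by (simp add: sum.distrib)
  also have "(\<Sum>n<N. \<Sum>i<n. r ^ (n - i) * (b n)\<^sup>2 / 2) = (\<Sum>n<N. (\<Sum>i<n. r ^ (n - i)) * ((b n)\<^sup>2 / 2))"
    by (simp add: sum_distrib_right sum_divide_distrib)
  also have "\<dots> \<le> (\<Sum>n<N. 4 * ((b n)\<^sup>2 / 2))" using geo1 by (intro sum_mono mult_right_mono) auto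
  also have "(\<Sum>n<N. \<Sum>i<n. r ^ (n - i) * (b i)\<^sup>2 / 2) = (\<Sum>i<N. \<Sum>n=Suc i..<N. r ^ (n - i) * (b i)\<^sup>2 / 2)"
    by (simp add: sum.nested_swap' lessThan_atLeast0 flip: atLeast0LessThan)
       (subst sum.Sigma, simp, simp, subst sum.Sigma, simp, simp,
        rule sum.reindex_bij_witness[of _ "\<lambda>(i, n). (n, i)" "\<lambda>(n, i). (i, n)"], auto)
  also have "\<dots> = (\<Sum>i<N. (\<Sum>n=Suc i..<N. r ^ (n - i)) * ((b i)\<^sup>2 / 2))"
    by (simp add: sum_distrib_right sum_divide_distrib)
  also have "\<dots> \<le> (\<Sum>i<N. 4 * ((b i)\<^sup>2 / 2))" using geo2 by (intro sum_mono mult_right_mono) auto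
  also have "(\<Sum>i<N. 4 * ((b i)\<^sup>2 / 2)) + (\<Sum>n<N. 4 * ((b n)\<^sup>2 / 2)) = 4 * (\<Sum>n<N. (b n)\<^sup>2)"
    by (simp add: sum_distrib_left sum.distrib[symmetric])
  finally show ?thesis by (simp add: r_def)
qed

text \<open>The powers of \<open>sqrt 2\<close> are those of L^1-normalised dilates by 2^j. What
  matters is the product of a modulus at scale i with a moment at a finer scale n: it has size (1 /
  sqrt 2)^(n - i), which is summable.\<close>

locale dyadic_kernels =
  fixes \<psi> :: "int \<Rightarrow> 'a::euclidean_space \<Rightarrow> real" and K :: real
  assumes bdd: "\<And>j. bdd_kernel (\<psi> j)"
    and mean_zero: "\<And>j. (\<integral>y. \<psi> j y \<partial>lborel) = 0"
    and L1_bound: "\<And>j. (\<integral>y. \<bar>\<psi> j y\<bar> \<partial>lborel) \<le> K"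
    and moment: "\<And>j. integrable lborel (\<lambda>y. \<bar>\<psi> j y\<bar> * sqrt (norm y))"
      "\<And>j. (\<integral>y. \<bar>\<psi> j y\<bar> * sqrt (norm y) \<partial>lborel) \<le> K / sqrt 2 powi j"
    and modulus: "\<And>j y. (\<integral>z. \<bar>\<psi> j z - \<psi> j (z - y)\<bar> \<partial>lborel) \<le> K * sqrt 2 powi j * sqrt (norm y)"
begin

lemma K_nonneg: "0 \<le> K"
proof -
  have "0 \<le> (\<integral>y. \<bar>\<psi> 0 y\<bar> \<partial>lborel)" by simp
  then show ?thesis using L1_bound[of 0] by linarith
qed

lemma conv_modulus:
  assumes q: "1 \<le> q" and h: "h \<in> lp_space lborel q"
  shows "lp_norm lborel q (\<lambda>x. conv (\<psi> j) h x - conv (\<psi> j) h (x - y)) \<le> K * sqrt 2 powi j * sqrt (norm y) * lp_norm lborel q h"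
  unfolding conv_diff_left[OF q bdd h]
  using conv_lp(2)[OF q bdd_kernel_diff_shift[OF bdd, of j y] h] mult_right_mono[OF modulus[of j y], of "lp_norm lborel q h"]
  by simp

text \<open>The 9 is 8 + 1: the linear terms contribute 2 * 4, the 4 coming from
  \<open>geometric_double_sum_le\<close>, and the quadratic terms contribute 1. The q^2 comes from
  \<open>norm_add_powr_le\<close>, and the power of 2 from estimating a partial sum plus the next
  piece by twice the target bound.\<close>

definition sq_const :: "real \<Rightarrow> real" where
  "sq_const q = 9 * q\<^sup>2 * K\<^sup>2 * 2 powr (q - 2)"

text \<open>Iterating the one-step estimate with the current norm on the right would compound
  constants. Instead the final bound y is fixed in advance: as long as the partial sums stay below
  y, the factor \<open>(lp_norm (S n) + K * b n) powr (q - 2)\<close> is at most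
  \<open>(2 * y) powr (q - 2)\<close>, and the increments add up. The choice y^2 =
  \<open>sq_const q * B\<close> closes the loop.\<close>

lemma square_sum_bound_nat:
  fixes h :: "nat \<Rightarrow> 'a \<Rightarrow> complex"
  assumes q: "2 \<le> q" and h: "\<And>i. h i \<in> lp_space lborel q"
  shows "lp_norm lborel q (\<lambda>x. \<Sum>i<N. conv (\<psi> (a + int i)) (h i) x)
          \<le> sqrt (sq_const q * (\<Sum>i<N. (lp_norm lborel q (h i))\<^sup>2))"
proof -
  have q1: "1 \<le> q" "0 < q" using q by auto
  define g where "g i = conv (\<psi> (a + int i)) (h i)" for i
  define b where "b i = lp_norm lborel q (h i)" for i
  have b0: "0 \<le> b i" for i by (simp add: b_def)
  have g: "g i \<in> lp_space lborel q" and gb: "lp_norm lborel q (g i) \<le> K * b i" for i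
    unfolding g_def b_def
    using conv_lp[OF q1(1) bdd h, of "a + int i" i] mult_right_mono[OF L1_bound, of "lp_norm lborel q (h i)" "a + int i"]
    by auto
  define S where "S n x = (\<Sum>i<n. g i x)" for n x
  have S: "S n \<in> lp_space lborel q" for n unfolding S_def by (rule lp_sum(1)[OF q1(1) g])
  define B where "B = (\<Sum>i<N. (b i)\<^sup>2)"
  define y where "y = sqrt (sq_const q * B)"
  have B0: "0 \<le> B" by (simp add: B_def sum_nonneg)
  have sq0: "0 \<le> sq_const q" by (simp add: sq_const_def)
  have sqK: "K\<^sup>2 \<le> sq_const q"
  proof -
    have "1 \<le> q\<^sup>2" "1 \<le> 2 powr (q - 2)" using q by (auto intro: ge_one_powr_ge_zero)
    then have "1 * 1 \<le> (9 * q\<^sup>2) * 2 powr (q - 2)" by (intro mult_mono) auto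
    then have "K\<^sup>2 * 1 \<le> K\<^sup>2 * (9 * q\<^sup>2 * 2 powr (q - 2))" by (intro mult_left_mono) auto
    then show ?thesis by (simp add: sq_const_def algebra_simps)
  qed
  have y0: "0 \<le> y" using B0 sq0 by (simp add: y_def)
  have y2: "y\<^sup>2 = sq_const q * B" using B0 sq0 by (simp add: y_def)
  have Kby: "K * b n \<le> y" if "n < N" for n
  proof -
    have "(b n)\<^sup>2 \<le> B" unfolding B_def using that by (intro member_le_sum) auto
    then have "K\<^sup>2 * (b n)\<^sup>2 \<le> sq_const q * B" using sqK sq0 by (intro mult_mono) auto
    then have "(K * b n)\<^sup>2 \<le> y\<^sup>2" by (simp add: y2 power_mult_distrib)
    then show ?thesis using y0 by (rule power2_le_imp_le)
  qed
  \<comment> \<open>The increment at step n, with a linear part from the interaction with all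
    coarser scales and a quadratic part from the piece itself.\<close>
  define R where "R n = 2 * q\<^sup>2 * K\<^sup>2 * (\<Sum>i<n. (1 / sqrt 2) ^ (n - i) * b i * b n) + q\<^sup>2 * K\<^sup>2 * (b n)\<^sup>2" for n
  have R0: "0 \<le> R n" for n unfolding R_def using b0 by (intro add_nonneg_nonneg mult_nonneg_nonneg sum_nonneg) auto
  have sumR: "(\<Sum>n<N. R n) \<le> 9 * q\<^sup>2 * K\<^sup>2 * B"
  proof -
    have "(\<Sum>n<N. R n) = 2 * q\<^sup>2 * K\<^sup>2 * (\<Sum>n<N. \<Sum>i<n. (1 / sqrt 2) ^ (n - i) * b i * b n) + q\<^sup>2 * K\<^sup>2 * B"
      unfolding R_def B_def by (simp add: sum.distrib sum_distrib_left)
    also have "\<dots> \<le> 2 * q\<^sup>2 * K\<^sup>2 * (4 * B) + q\<^sup>2 * K\<^sup>2 * B"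
      unfolding B_def by (intro add_right_mono mult_left_mono geometric_double_sum_le) auto
    finally show ?thesis by (simp add: algebra_simps)
  qed
  have step: "lp_norm lborel q (S (Suc n)) powr q \<le> lp_norm lborel q (S n) powr q + R n * (lp_norm lborel q (S n) + K * b n) powr (q - 2)" for n
  proof -
    define X where "X = lp_norm lborel q (S n)"
    define M where "M = (\<Sum>i<n. K * sqrt 2 powi (a + int i) * b i)"
    have [measurable]: "S n \<in> borel_measurable borel" "g n \<in> borel_measurable borel"
      using lp_space_measurable[OF S[of n]] lp_space_measurable[OF g[of n]] by simp_all
    have M: "lp_norm lborel q (\<lambda>x. S n x - S n (x - y)) \<le> M * sqrt (norm y)" for y
    proof -
      have "lp_norm lborel q (\<lambda>x. S n x - S n (x - y)) = lp_norm lborel q (\<lambda>x. \<Sum>i<n. g i x - g i (x - y))"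
        by (simp add: S_def sum_subtractf)
      also have "\<dots> \<le> (\<Sum>i<n. lp_norm lborel q (\<lambda>x. g i x - g i (x - y)))"
        by (rule lp_sum(2)[OF q1(1)]) (intro lp_diff(1)[OF q1(1)] g lp_shift(1))
      also have "\<dots> \<le> (\<Sum>i<n. K * sqrt 2 powi (a + int i) * sqrt (norm y) * b i)"
        unfolding g_def b_def by (intro sum_mono conv_modulus q1(1) h)
      finally show ?thesis by (simp add: M_def sum_distrib_left sum_distrib_right mult_ac)
    qed
    have M0: "0 \<le> M" unfolding M_def using K_nonneg b0 by (intro sum_nonneg mult_nonneg_nonneg) auto
    have I1: "integrable lborel (\<lambda>x. norm (S n x) powr (q - 2) * Re (cnj (S n x) * g n x))"
    proof (rule Bochner_Integration.integrable_bound[OF Holder_three(1)[OF q S g S]])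
      show "AE x in lborel. norm (norm (S n x) powr (q - 2) * Re (cnj (S n x) * g n x)) \<le> norm (norm (S n x) * norm (g n x) * norm (S n x) powr (q - 2))"
      proof (rule AE_I2)
        fix x
        have "\<bar>Re (cnj (S n x) * g n x)\<bar> \<le> norm (S n x) * norm (g n x)"
          using abs_Re_le_cmod[of "cnj (S n x) * g n x"] by (simp add: norm_mult)
        then show "norm (norm (S n x) powr (q - 2) * Re (cnj (S n x) * g n x)) \<le> norm (norm (S n x) * norm (g n x) * norm (S n x) powr (q - 2))"
          using mult_left_mono[of "\<bar>Re (cnj (S n x) * g n x)\<bar>" "norm (S n x) * norm (g n x)" "norm (S n x) powr (q - 2)"]
          unfolding real_norm_def abs_mult by (simp add: mult.commute)
      qed
    qed simp
    let ?L = "\<lambda>x. norm (S n x) + norm (g n x)"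
    have L: "?L \<in> lp_space lborel q" "lp_norm lborel q ?L \<le> X + K * b n"
      using lp_add[OF q1(1) lp_space_norm[OF q1(2) S[of n]] lp_space_norm[OF q1(2) g[of n]]] gb[of n]
      by (auto simp: X_def)
    have absL: "\<bar>?L x\<bar> = ?L x" for x by simp
    note H = Holder_three[OF q g[of n] g[of n] L(1), unfolded real_norm_def absL]
    have "(\<integral>x. norm (S (Suc n) x) powr q \<partial>lborel) \<le> (\<integral>x. norm (S n x) powr q + q * (norm (S n x) powr (q - 2) * Re (cnj (S n x) * g n x))
         + q\<^sup>2 * (norm (g n x) * norm (g n x) * ?L x powr (q - 2)) \<partial>lborel)"
    proof (rule integral_mono)
      fix x
      show "norm (S (Suc n) x) powr q \<le> norm (S n x) powr q + q * (norm (S n x) powr (q - 2) * Re (cnj (S n x) * g n x))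
         + q\<^sup>2 * (norm (g n x) * norm (g n x) * ?L x powr (q - 2))"
        using norm_add_powr_le[OF q, of "S n x" "g n x"] by (simp add: S_def power2_eq_square mult.commute)
    qed (use lp_space_integrable[OF S] I1 H(1) in auto)
    also have "\<dots> = X powr q + q * (\<integral>x. norm (S n x) powr (q - 2) * Re (cnj (S n x) * g n x) \<partial>lborel)
         + q\<^sup>2 * (\<integral>x. norm (g n x) * norm (g n x) * ?L x powr (q - 2) \<partial>lborel)"
      using lp_space_integrable[OF S] I1 H(1) q by (simp add: X_def lp_norm_powr)
    also have "\<dots> \<le> X powr q + q * (2 * q * M * X powr (q - 2) * b n * (K / sqrt 2 powi (a + int n)))
         + q\<^sup>2 * ((K * b n) * (K * b n) * (X + K * b n) powr (q - 2))"
    proof (intro add_mono mult_left_mono order_refl)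
      have "(\<integral>x. norm (S n x) powr (q - 2) * Re (cnj (S n x) * g n x) \<partial>lborel) \<le> 2 * q * M * X powr (q - 2) * b n * (\<integral>y. \<bar>\<psi> (a + int n) y\<bar> * sqrt (norm y) \<partial>lborel)"
        unfolding g_def X_def b_def by (rule duality_pairing_conv_le[OF q bdd mean_zero S h M moment(1)])
      also have "\<dots> \<le> 2 * q * M * X powr (q - 2) * b n * (K / sqrt 2 powi (a + int n))"
        using q M0 b0 by (intro mult_left_mono moment(2)) auto
      finally show "(\<integral>x. norm (S n x) powr (q - 2) * Re (cnj (S n x) * g n x) \<partial>lborel) \<le> 2 * q * M * X powr (q - 2) * b n * (K / sqrt 2 powi (a + int n))" .
      have "(\<integral>x. norm (g n x) * norm (g n x) * ?L x powr (q - 2) \<partial>lborel) \<le> lp_norm lborel q (g n) * lp_norm lborel q (g n) * lp_norm lborel q ?L powr (q - 2)"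
        by (rule H(2))
      also have "\<dots> \<le> (K * b n) * (K * b n) * (X + K * b n) powr (q - 2)"
        using gb[of n] L(2) q K_nonneg b0 by (intro mult_mono powr_mono2) auto
      finally show "(\<integral>x. norm (g n x) * norm (g n x) * ?L x powr (q - 2) \<partial>lborel) \<le> (K * b n) * (K * b n) * (X + K * b n) powr (q - 2)" .
    qed (use q in auto)
    finally have fin: "(\<integral>x. norm (S (Suc n) x) powr q \<partial>lborel) \<le> X powr q + q * (2 * q * M * X powr (q - 2) * b n * (K / sqrt 2 powi (a + int n)))
         + q\<^sup>2 * ((K * b n) * (K * b n) * (X + K * b n) powr (q - 2))" .
    \<comment> \<open>M adds the moduli of the coarser pieces; against the moment at scale a + n the
      absolute scale cancels and only n - i remains.\<close>
    have MK: "M * (K / sqrt 2 powi (a + int n)) = K\<^sup>2 * (\<Sum>i<n. (1 / sqrt 2) ^ (n - i) * b i)"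
    proof -
      have "sqrt 2 powi (a + int i) / sqrt 2 powi (a + int n) = (1 / sqrt 2) ^ (n - i)" if "i < n" for i
      proof -
        have "sqrt 2 powi (a + int n) = sqrt 2 powi (a + int i) * sqrt 2 powi int (n - i)"
          using that by (subst power_int_add[symmetric]) (auto simp: of_nat_diff)
        then show ?thesis by (simp add: power_one_over field_simps)
      qed
      then show ?thesis
        unfolding M_def sum_distrib_right sum_distrib_left
        by (intro sum.cong refl) (simp add: power2_eq_square field_simps)
    qed
    have "q * (2 * q * M * X powr (q - 2) * b n * (K / sqrt 2 powi (a + int n)))
       = 2 * q\<^sup>2 * X powr (q - 2) * b n * (M * (K / sqrt 2 powi (a + int n)))"
      by (simp add: power2_eq_square)
    also have "\<dots> = 2 * q\<^sup>2 * K\<^sup>2 * (\<Sum>i<n. (1 / sqrt 2) ^ (n - i) * b i * b n) * X powr (q - 2)"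
      unfolding MK by (simp add: sum_distrib_right[symmetric])
    also have "\<dots> \<le> 2 * q\<^sup>2 * K\<^sup>2 * (\<Sum>i<n. (1 / sqrt 2) ^ (n - i) * b i * b n) * (X + K * b n) powr (q - 2)"
      using q b0 K_nonneg by (intro mult_left_mono powr_mono2 mult_nonneg_nonneg sum_nonneg) (auto simp: X_def)
    finally show ?thesis
      using fin unfolding lp_norm_powr[OF q1(2), of _ "S (Suc n)"] by (simp add: R_def X_def power2_eq_square algebra_simps)
  qed
  \<comment> \<open>Two assertions proved together: the first collects the increments additively,
    the second follows from it by the choice of y and feeds the next step.\<close>
  have main: "n \<le> N \<Longrightarrow> lp_norm lborel q (S n) powr q \<le> (\<Sum>m<n. R m) * (2 * y) powr (q - 2) \<and> lp_norm lborel q (S n) \<le> y" for n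
  proof (induction n)
    case 0
    have "S 0 = (\<lambda>x. 0)" by (auto simp: S_def)
    then show ?case using y0 by simp
  next
    case (Suc n)
    then have IH: "lp_norm lborel q (S n) powr q \<le> (\<Sum>m<n. R m) * (2 * y) powr (q - 2)" "lp_norm lborel q (S n) \<le> y" by auto
    have "lp_norm lborel q (S n) + K * b n \<le> 2 * y" using IH(2) Kby[of n] Suc.prems by simp
    then have "R n * (lp_norm lborel q (S n) + K * b n) powr (q - 2) \<le> R n * (2 * y) powr (q - 2)"
      using R0 q K_nonneg b0 by (intro mult_left_mono powr_mono2) auto
    then have 1: "lp_norm lborel q (S (Suc n)) powr q \<le> (\<Sum>m<Suc n. R m) * (2 * y) powr (q - 2)"
      using step[of n] IH(1) by (simp add: distrib_right)
    have "(\<Sum>m<Suc n. R m) \<le> (\<Sum>m<N. R m)" using Suc.prems R0 by (intro sum_mono2) auto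
    then have "(\<Sum>m<Suc n. R m) * (2 * y) powr (q - 2) \<le> (9 * q\<^sup>2 * K\<^sup>2 * B) * (2 * y) powr (q - 2)"
      using sumR by (intro mult_right_mono) auto
    also have "\<dots> = y\<^sup>2 * y powr (q - 2)" by (simp add: y2 sq_const_def powr_mult)
    also have "\<dots> = y powr q" using y0 by (cases "y = 0") (simp_all add: powr_diff)
    finally have "lp_norm lborel q (S (Suc n)) powr q \<le> y powr q" using 1 by simp
    then have "lp_norm lborel q (S (Suc n)) \<le> y"
      using q1 y0 by (metis linorder_not_le powr_less_mono2)
    with 1 show ?case by simp
  qed
  show ?thesis using main[of N] by (simp add: S_def[abs_def] g_def y_def B_def b_def)
qed

text \<open>A finite set of integers is placed in an interval [-m, m), with zero functions at the
  missing indices, so that the pieces come ordered from coarse to fine.\<close>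

theorem square_sum_bound:
  fixes h :: "int \<Rightarrow> 'a \<Rightarrow> complex"
  assumes q: "2 \<le> q" and J: "finite J" and h: "\<And>j. j \<in> J \<Longrightarrow> h j \<in> lp_space lborel q"
  shows "lp_norm lborel q (\<lambda>x. \<Sum>j\<in>J. conv (\<psi> j) (h j) x)
          \<le> sqrt (sq_const q * (\<Sum>j\<in>J. (lp_norm lborel q (h j))\<^sup>2))"
proof -
  obtain m :: int where m: "\<And>j. j \<in> J \<Longrightarrow> \<bar>j\<bar> < m"
  proof -
    have "\<bar>j\<bar> < Max ((\<lambda>j. \<bar>j\<bar> + 1) ` J)" if "j \<in> J" for j
    proof -
      have "\<bar>j\<bar> + 1 \<le> Max ((\<lambda>j. \<bar>j\<bar> + 1) ` J)" using J that by (intro Max_ge) auto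
      then show ?thesis by linarith
    qed
    then show ?thesis using that by blast
  qed
  define N where "N = nat (2 * m)"
  define h' where "h' i = (if -m + int i \<in> J then h (-m + int i) else (\<lambda>x. 0))" for i
  have h': "h' i \<in> lp_space lborel q" for i using h by (simp add: h'_def)
  define I where "I = {i. i < N \<and> -m + int i \<in> J}"
  have re: "(\<Sum>i<N. F i) = (\<Sum>j\<in>J. F (nat (j + m)))" if "\<And>i. -m + int i \<notin> J \<Longrightarrow> F i = 0" for F :: "nat \<Rightarrow> 'c::comm_monoid_add"
  proof -
    have "(\<Sum>i<N. F i) = (\<Sum>i\<in>I. F i)"
      by (rule sum.mono_neutral_right) (use that in \<open>auto simp: I_def\<close>)
    also have "\<dots> = (\<Sum>j\<in>J. F (nat (j + m)))"
      by (rule sum.reindex_bij_witness[of _ "\<lambda>j. nat (j + m)" "\<lambda>i. -m + int i"])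
         (use m in \<open>force simp: I_def N_def\<close>)+
    finally show ?thesis .
  qed
  have hJ: "h' (nat (j + m)) = h j" "-m + int (nat (j + m)) = j" if "j \<in> J" for j
    using m[OF that] that by (auto simp: h'_def)
  have z: "conv (\<psi> (- m + int i)) (h' i) x = 0" "(lp_norm lborel q (h' i))\<^sup>2 = 0" if "-m + int i \<notin> J" for i x
    using that by (auto simp: h'_def conv_def)
  have "(\<Sum>i<N. conv (\<psi> (- m + int i)) (h' i) x) = (\<Sum>j\<in>J. conv (\<psi> j) (h j) x)" for x
    using hJ by (subst re[OF z(1)]) (auto intro!: sum.cong)
  moreover have "(\<Sum>i<N. (lp_norm lborel q (h' i))\<^sup>2) = (\<Sum>j\<in>J. (lp_norm lborel q (h j))\<^sup>2)"
    using hJ by (subst re[OF z(2)]) (auto intro!: sum.cong)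
  ultimately show ?thesis using square_sum_bound_nat[OF q h', of "-m" "\<lambda>i. i" N] by simp
qed

text \<open>Duality: with test functions satisfying \<parallel>h_j\<parallel>_q = a_j and pairing to
  a_j^2 with \<psi>_j * f, the sum A of the a_j^2 is a pairing of f with \<Sum> \<psi>_j * h_j,
  because even kernels are symmetric. Hence A \<le> \<parallel>f\<parallel>_p * sqrt (c A), and
  since J is finite one may divide by sqrt A.\<close>

theorem square_sum_bound_dual:
  assumes p: "1 < p" "p \<le> 2" and even: "\<And>j y. \<psi> j (- y) = \<psi> j y" and J: "finite J"
    and f: "f \<in> lp_space lborel p"
  shows "(\<Sum>j\<in>J. (lp_norm lborel p (conv (\<psi> j) f))\<^sup>2) \<le> sq_const (p / (p - 1)) * (lp_norm lborel p f)\<^sup>2"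
proof -
  define q where "q = p / (p - 1)"
  have q2: "2 \<le> q" using p by (simp add: q_def field_simps)
  have pq: "1 < p" "1 < q" "1/p + 1/q = 1" using p q2 by (auto simp: q_def field_simps)
  have pq1: "(p - 1) * q = p" using p by (simp add: q_def)
  have pq2: "p / q = p - 1" using p by (simp add: q_def)
  have p1: "1 \<le> p" "0 < p" and q0: "0 < q" "1 \<le> q" using p q2 by auto
  define g where "g j = conv (\<psi> j) f" for j
  define a where "a j = lp_norm lborel p (g j)" for j
  have a0: "0 \<le> a j" for j by (simp add: a_def)
  have g: "g j \<in> lp_space lborel p" for j unfolding g_def by (rule conv_lp(1)[OF p1(1) bdd f])
  have [measurable]: "g j \<in> borel_measurable borel" for j using lp_space_measurable[OF g] by simp
  \<comment> \<open>The extremal function in Hoelder's inequality, scaled from norm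
    \<open>a j powr (p - 1)\<close> to norm \<open>a j\<close>. As \<open>0 powr r = 0\<close> for
    every r, zeros of g j and vanishing a j cause no trouble although p - 2 may be negative.\<close>
  define h where "h j x = a j powr (2 - p) *\<^sub>R (norm (g j x) powr (p - 2) *\<^sub>R cnj (g j x))" for j x
  have [measurable]: "h j \<in> borel_measurable borel" for j unfolding h_def by measurable
  have nh: "norm (h j x) powr q = a j powr ((2 - p) * q) * norm (g j x) powr p" for j x
  proof -
    have "norm (h j x) = a j powr (2 - p) * norm (g j x) powr (p - 1)"
      using powr_mult_self[of "norm (g j x)" "p - 2"] by (simp add: h_def)
    then show ?thesis by (simp add: powr_mult powr_powr pq1)
  qed
  have h: "h j \<in> lp_space lborel q" for j
    using lp_space_integrable[OF g[of j]] by (simp add: lp_space_def nh)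
  have nhq: "lp_norm lborel q (h j) = a j" for j
  proof -
    have "(\<integral>x. norm (h j x) powr q \<partial>lborel) = a j powr ((2 - p) * q) * a j powr p"
      using lp_norm_powr[OF p1(2), of lborel "g j"] by (simp add: nh a_def)
    then have "lp_norm lborel q (h j) = a j powr (2 - p) * a j powr (p - 1)"
      using q0 by (simp add: lp_norm_def powr_mult powr_powr pq2)
    also have "\<dots> = a j" using a0[of j] by (simp add: powr_add[symmetric])
    finally show ?thesis .
  qed
  have gh: "(\<integral>x. g j x * h j x \<partial>lborel) = of_real ((a j)\<^sup>2)" for j
  proof -
    have "g j x * h j x = of_real (a j powr (2 - p) * norm (g j x) powr p)" for x
    proof -
      have "norm (g j x) powr (p - 2) * (norm (g j x))\<^sup>2 = norm (g j x) powr p"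
        by (cases "g j x = 0") (simp_all add: powr_diff)
      moreover have "g j x * h j x = of_real (a j powr (2 - p) * (norm (g j x) powr (p - 2) * (norm (g j x))\<^sup>2))"
        unfolding h_def scaleR_conv_of_real using complex_norm_square[of "g j x"] by (simp add: mult_ac)
      ultimately show ?thesis by simp
    qed
    then have "(\<integral>x. g j x * h j x \<partial>lborel) = of_real (a j powr (2 - p) * a j powr p)"
      using lp_norm_powr[OF p1(2), of lborel "g j"] by (simp add: a_def del: of_real_mult)
    also have "a j powr (2 - p) * a j powr p = (a j)\<^sup>2"
      using a0[of j] by (simp add: powr_add[symmetric])
    finally show ?thesis .
  qed
  define A where "A = (\<Sum>j\<in>J. (a j)\<^sup>2)"
  define c where "c = sq_const q"
  have c0: "0 \<le> c" by (simp add: c_def sq_const_def)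
  have A0: "0 \<le> A" by (simp add: A_def sum_nonneg)
  have ch: "conv (\<psi> j) (h j) \<in> lp_space lborel q" for j by (rule conv_lp(1)[OF q0(2) bdd h])
  have "of_real A = (\<Sum>j\<in>J. \<integral>x. g j x * h j x \<partial>lborel)" by (simp add: gh A_def)
  also have "\<dots> = (\<Sum>j\<in>J. \<integral>x. f x * conv (\<psi> j) (h j) x \<partial>lborel)"
    unfolding g_def by (intro sum.cong refl conv_even_symmetric[OF pq f h bdd even])
  also have "\<dots> = (\<integral>x. f x * (\<Sum>j\<in>J. conv (\<psi> j) (h j) x) \<partial>lborel)"
    unfolding sum_distrib_left by (rule Bochner_Integration.integral_sum[symmetric]) (rule conv_pairing_integrable(1)[OF pq f ch])
  finally have "A = norm (\<integral>x. f x * (\<Sum>j\<in>J. conv (\<psi> j) (h j) x) \<partial>lborel)"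
    using A0 by (metis abs_of_nonneg norm_of_real)
  also have "\<dots> \<le> lp_norm lborel p f * lp_norm lborel q (\<lambda>x. \<Sum>j\<in>J. conv (\<psi> j) (h j) x)"
    by (rule conv_pairing_integrable(2)[OF pq f lp_sum(1)[OF q0(2) ch]])
  also have "\<dots> \<le> lp_norm lborel p f * sqrt (c * A)"
    using square_sum_bound[OF q2 J h] unfolding nhq A_def c_def by (intro mult_left_mono) auto
  finally have "A \<le> (lp_norm lborel p f * sqrt c) * sqrt A" by (simp add: real_sqrt_mult)
  then have "sqrt A * sqrt A \<le> (lp_norm lborel p f * sqrt c) * sqrt A" using A0 by simp
  then have "sqrt A \<le> lp_norm lborel p f * sqrt c"
  proof (cases "A = 0")
    case False
    then have "0 < sqrt A" using A0 by simp
    with \<open>sqrt A * sqrt A \<le> _\<close> show ?thesis by (rule mult_right_le_imp_le)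
  qed (use c0 in auto)
  then have "(sqrt A)\<^sup>2 \<le> (lp_norm lborel p f * sqrt c)\<^sup>2" using A0 by (intro power_mono) auto
  then show ?thesis using A0 c0 by (simp add: A_def c_def q_def a_def g_def power_mult_distrib mult.commute)
qed

end

section \<open>A reproducing kernel for dyadic annuli\<close>

definition unnorm_sinc :: "real \<Rightarrow> real" where
  "unnorm_sinc x = (if x = 0 then 1 else sin x / x)"

lemma abs_cos_diff_le: "\<bar>cos x - cos y\<bar> \<le> \<bar>x - y :: real\<bar>"
proof -
  have "\<bar>cos x - cos y\<bar> = 2 * \<bar>sin ((x + y) / 2)\<bar> * \<bar>sin ((y - x) / 2)\<bar>"
    by (simp add: cos_diff_cos abs_mult)
  also have "\<dots> \<le> 2 * 1 * \<bar>(y - x) / 2\<bar>"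
    by (intro mult_mono abs_sin_x_le_abs_x) auto
  finally show ?thesis by simp
qed

text \<open>As an average of the cosines \<open>cos (s * x)\<close> the quotient shows no
  singularity at 0; its Lipschitz bound is then that of the cosine, integrated over s.\<close>

lemma unnorm_sinc_has_integral: "((\<lambda>s. cos (s * x)) has_integral unnorm_sinc x) {0..1}"
proof (cases "x = 0")
  case True
  then show ?thesis using has_integral_const_real[of "1::real" 0 1] by (simp add: unnorm_sinc_def)
next
  case False
  have "((\<lambda>s. cos (s * x)) has_integral (sin (1 * x) / x - sin (0 * x) / x)) {0..1}"
    by (rule fundamental_theorem_of_calculus)
       (use False in \<open>auto intro!: derivative_eq_intros simp flip: has_real_derivative_iff_has_vector_derivative\<close>)
  then show ?thesis using False by (simp add: unnorm_sinc_def)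
qed

lemma unnorm_sinc_Lipschitz: "\<bar>unnorm_sinc x - unnorm_sinc y\<bar> \<le> \<bar>x - y\<bar>"
proof -
  have "((\<lambda>s. cos (s * x) - cos (s * y)) has_integral unnorm_sinc x - unnorm_sinc y) (cbox 0 1)"
    using has_integral_diff[OF unnorm_sinc_has_integral unnorm_sinc_has_integral] by simp
  then have "norm (unnorm_sinc x - unnorm_sinc y) \<le> \<bar>x - y\<bar> * measure lborel (cbox 0 (1::real))"
  proof (rule has_integral_bound[rotated])
    fix s :: real assume s: "s \<in> cbox 0 1"
    have "\<bar>cos (s * x) - cos (s * y)\<bar> \<le> \<bar>s * x - s * y\<bar>" by (rule abs_cos_diff_le)
    also have "\<dots> = \<bar>s\<bar> * \<bar>x - y\<bar>" by (simp add: right_diff_distrib[symmetric] abs_mult)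
    also have "\<dots> \<le> 1 * \<bar>x - y\<bar>" using s by (intro mult_right_mono) auto
    finally show "norm (cos (s * x) - cos (s * y)) \<le> \<bar>x - y\<bar>" by simp
  qed simp
  then show ?thesis by simp
qed

lemma abs_unnorm_sinc_le_1: "\<bar>unnorm_sinc x\<bar> \<le> 1"
  using abs_sin_x_le_abs_x[of x] by (auto simp: unnorm_sinc_def divide_le_eq_1)

text \<open>A multiple of the de la Vallee-Poussin kernel. The product form removes the singularity at 0.\<close>

definition vp_kernel :: "real \<Rightarrow> real" where
  "vp_kernel x = 24 * pi\<^sup>2 * unnorm_sinc (6 * pi * x) * unnorm_sinc (2 * pi * x)"

text \<open>6 pi and 2 pi are half the sum and half the difference of 8 pi and 4 pi, and 24 pi^2 = 2
  * 6 pi * 2 pi. The frequencies 4 pi = 2 pi * 2 and 8 pi = 2 pi * 4 are the corners of the future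
  Fourier transform.\<close>

lemma vp_kernel_eq: "x \<noteq> 0 \<Longrightarrow> vp_kernel x = (cos (4 * pi * x) - cos (8 * pi * x)) / x\<^sup>2"
  unfolding vp_kernel_def unnorm_sinc_def cos_diff_cos
  by (simp add: field_simps power2_eq_square)

lemma vp_kernel_Lipschitz: "\<bar>vp_kernel x - vp_kernel y\<bar> \<le> 192 * pi ^ 3 * \<bar>x - y\<bar>"
proof -
  let ?s = unnorm_sinc
  have "\<bar>?s (6 * pi * x) * ?s (2 * pi * x) - ?s (6 * pi * y) * ?s (2 * pi * y)\<bar>
     = \<bar>(?s (6 * pi * x) - ?s (6 * pi * y)) * ?s (2 * pi * x) + ?s (6 * pi * y) * (?s (2 * pi * x) - ?s (2 * pi * y))\<bar>"
    by (simp add: algebra_simps)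
  also have "\<dots> \<le> \<bar>?s (6 * pi * x) - ?s (6 * pi * y)\<bar> * \<bar>?s (2 * pi * x)\<bar> + \<bar>?s (6 * pi * y)\<bar> * \<bar>?s (2 * pi * x) - ?s (2 * pi * y)\<bar>"
    unfolding abs_mult[symmetric] by (rule abs_triangle_ineq)
  also have "\<dots> \<le> \<bar>6 * pi * x - 6 * pi * y\<bar> * 1 + 1 * \<bar>2 * pi * x - 2 * pi * y\<bar>"
    by (intro add_mono mult_mono unnorm_sinc_Lipschitz abs_unnorm_sinc_le_1) auto
  also have "\<dots> = 8 * pi * \<bar>x - y\<bar>"
    by (simp add: right_diff_distrib[symmetric] abs_mult)
  finally have "24 * pi\<^sup>2 * \<bar>?s (6 * pi * x) * ?s (2 * pi * x) - ?s (6 * pi * y) * ?s (2 * pi * y)\<bar> \<le> 24 * pi\<^sup>2 * (8 * pi * \<bar>x - y\<bar>)"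
    by (intro mult_left_mono) auto
  also have "24 * pi\<^sup>2 * \<bar>?s (6 * pi * x) * ?s (2 * pi * x) - ?s (6 * pi * y) * ?s (2 * pi * y)\<bar> = \<bar>vp_kernel x - vp_kernel y\<bar>"
  proof -
    have "vp_kernel x - vp_kernel y = 24 * pi\<^sup>2 * (?s (6 * pi * x) * ?s (2 * pi * x) - ?s (6 * pi * y) * ?s (2 * pi * y))"
      by (simp add: vp_kernel_def algebra_simps)
    then show ?thesis by (simp add: abs_mult)
  qed
  finally show ?thesis by (simp add: power3_eq_cube power2_eq_square algebra_simps)
qed

lemma vp_kernel_continuous: "continuous_on UNIV vp_kernel"
proof (rule continuous_on_iff[THEN iffD2], intro ballI allI impI)
  fix x e :: real assume "0 < e"
  have "dist (vp_kernel y) (vp_kernel x) < e" if "dist y x < e / (192 * pi ^ 3)" for y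
    using vp_kernel_Lipschitz[of y x] that by (auto simp: dist_real_def field_simps)
  then show "\<exists>d>0. \<forall>y\<in>UNIV. dist y x < d \<longrightarrow> dist (vp_kernel y) (vp_kernel x) < e"
    using \<open>0 < e\<close> by (intro exI[of _ "e / (192 * pi ^ 3)"]) auto
qed

lemma vp_kernel_measurable [measurable]: "vp_kernel \<in> borel_measurable borel"
  using vp_kernel_continuous by (rule borel_measurable_continuous_onI)

lemma vp_kernel_even: "vp_kernel (- x) = vp_kernel x"
  by (simp add: vp_kernel_def unnorm_sinc_def)

lemma vp_kernel_bound: "\<bar>vp_kernel x\<bar> \<le> (48 * pi\<^sup>2 + 4) * (1 / (1 + x\<^sup>2))"
proof (cases "\<bar>x\<bar> \<le> 1")
  case True
  have "\<bar>vp_kernel x\<bar> \<le> 24 * pi\<^sup>2 * 1 * 1"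
    unfolding vp_kernel_def abs_mult by (intro mult_mono abs_unnorm_sinc_le_1) auto
  moreover have "1 + x\<^sup>2 \<le> 2" using True by (simp add: abs_square_le_1)
  ultimately have "\<bar>vp_kernel x\<bar> * (1 + x\<^sup>2) \<le> (24 * pi\<^sup>2) * 2" by (intro mult_mono) auto
  then have "\<bar>vp_kernel x\<bar> * (1 + x\<^sup>2) \<le> 48 * pi\<^sup>2 + 4" by simp
  then show ?thesis by (simp add: pos_le_divide_eq add_pos_nonneg)
next
  case False
  then have x: "x \<noteq> 0" "1 \<le> x\<^sup>2" by (auto simp: abs_square_le_1 not_le less_imp_le)
       (metis abs_le_square_iff abs_one less_eq_real_def linorder_not_le one_power2)
  have "\<bar>cos (4 * pi * x) - cos (8 * pi * x)\<bar> \<le> 2"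
    using abs_cos_le_one[of "4 * pi * x"] abs_cos_le_one[of "8 * pi * x"] by linarith
  then have "\<bar>vp_kernel x\<bar> \<le> 2 / x\<^sup>2"
    using x by (simp add: vp_kernel_eq abs_divide divide_right_mono)
  also have "\<dots> \<le> 4 * (1 / (1 + x\<^sup>2))" using x by (simp add: field_simps)
  also have "\<dots> \<le> (48 * pi\<^sup>2 + 4) * (1 / (1 + x\<^sup>2))" by (intro mult_right_mono) auto
  finally show ?thesis .
qed

text \<open>The weight can be taken at x because a shift by at most 1 changes 1 + x^2 by a bounded
  factor. Near 0 the global Lipschitz bound suffices; away from 0 numerator and denominator of the
  quotient are varied separately.\<close>

lemma vp_kernel_modulus:
  assumes h: "\<bar>h\<bar> \<le> 1"
  shows "\<bar>vp_kernel (x + h) - vp_kernel x\<bar> \<le> (960 * pi ^ 3 + 96 * pi + 48) * \<bar>h\<bar> * (1 / (1 + x\<^sup>2))"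
proof (cases "\<bar>x\<bar> \<le> 2")
  case True
  have "\<bar>vp_kernel (x + h) - vp_kernel x\<bar> \<le> 192 * pi ^ 3 * \<bar>h\<bar>"
    using vp_kernel_Lipschitz[of "x + h" x] by simp
  moreover have "x\<^sup>2 \<le> 2\<^sup>2" using True by (subst abs_le_square_iff[symmetric]) simp
  ultimately have "\<bar>vp_kernel (x + h) - vp_kernel x\<bar> * (1 + x\<^sup>2) \<le> (192 * pi ^ 3 * \<bar>h\<bar>) * 5"
    by (intro mult_mono) auto
  then have "\<bar>vp_kernel (x + h) - vp_kernel x\<bar> * (1 + x\<^sup>2) \<le> 960 * pi ^ 3 * \<bar>h\<bar>" by simp
  also have "\<dots> \<le> (960 * pi ^ 3 + 96 * pi + 48) * \<bar>h\<bar>" by (intro mult_right_mono) auto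
  finally show ?thesis by (simp add: pos_le_divide_eq add_pos_nonneg)
next
  case False
  define y where "y = x + h"
  define N :: "real \<Rightarrow> real" where "N t = cos (4 * pi * t) - cos (8 * pi * t)" for t
  have y2: "\<bar>x\<bar> / 2 \<le> \<bar>y\<bar>" using False h unfolding y_def by linarith
  have x0: "x \<noteq> 0" "y \<noteq> 0" using False y2 by auto
  have x2: "4 \<le> x\<^sup>2" using False abs_le_square_iff[of 2 x] by simp
  have "(\<bar>x\<bar> / 2)\<^sup>2 \<le> \<bar>y\<bar>\<^sup>2" using y2 by (intro power_mono) auto
  then have "x\<^sup>2 / 4 \<le> y\<^sup>2" by (simp add: power_divide)
  then have "1 / y\<^sup>2 \<le> 1 / (x\<^sup>2 / 4)" using x0 by (intro frac_le) auto
  then have ysq: "1 / y\<^sup>2 \<le> 4 / x\<^sup>2" by simp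
  have N1: "\<bar>N y - N x\<bar> \<le> 12 * pi * \<bar>h\<bar>"
  proof -
    have "\<bar>cos (4 * pi * y) - cos (4 * pi * x)\<bar> \<le> \<bar>4 * pi * y - 4 * pi * x\<bar>"
      "\<bar>cos (8 * pi * y) - cos (8 * pi * x)\<bar> \<le> \<bar>8 * pi * y - 8 * pi * x\<bar>" by (rule abs_cos_diff_le)+
    moreover have "\<bar>4 * pi * y - 4 * pi * x\<bar> = 4 * pi * \<bar>h\<bar>" "\<bar>8 * pi * y - 8 * pi * x\<bar> = 8 * pi * \<bar>h\<bar>"
      by (simp_all add: y_def right_diff_distrib[symmetric] abs_mult)
    ultimately show ?thesis unfolding N_def by linarith
  qed
  have N2: "\<bar>N x\<bar> \<le> 2"
    using abs_cos_le_one[of "4 * pi * x"] abs_cos_le_one[of "8 * pi * x"] unfolding N_def by linarith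
  have D: "\<bar>x\<^sup>2 - y\<^sup>2\<bar> \<le> 3 * \<bar>h\<bar> * x\<^sup>2"
  proof -
    have "x\<^sup>2 - y\<^sup>2 = - h * (x + y)" by (simp add: y_def power2_eq_square algebra_simps)
    then have "\<bar>x\<^sup>2 - y\<^sup>2\<bar> = \<bar>h\<bar> * \<bar>x + y\<bar>" by (simp add: abs_mult)
    also have "\<dots> \<le> \<bar>h\<bar> * (3 * \<bar>x\<bar>)" using h False by (intro mult_left_mono) (auto simp: y_def)
    also have "\<dots> \<le> \<bar>h\<bar> * (3 * x\<^sup>2)"
    proof -
      have "1 * \<bar>x\<bar> \<le> \<bar>x\<bar> * \<bar>x\<bar>" using False by (intro mult_right_mono) auto
      then show ?thesis by (intro mult_left_mono) (auto simp: power2_eq_square)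
    qed
    finally show ?thesis by simp
  qed
  \<comment> \<open>First the numerator changes over the denominator y^2, then 1 / y^2 - 1 / x^2 is
    written as (x^2 - y^2) / (x^2 y^2).\<close>
  have "vp_kernel y - vp_kernel x = (N y - N x) * (1 / y\<^sup>2) + N x * ((x\<^sup>2 - y\<^sup>2) * ((1 / x\<^sup>2) * (1 / y\<^sup>2)))"
    using x0 by (simp add: vp_kernel_eq N_def field_simps)
  also have "\<bar>\<dots>\<bar> \<le> \<bar>N y - N x\<bar> * (1 / y\<^sup>2) + \<bar>N x\<bar> * (\<bar>x\<^sup>2 - y\<^sup>2\<bar> * ((1 / x\<^sup>2) * (1 / y\<^sup>2)))"
    by (rule order_trans[OF abs_triangle_ineq]) (simp add: abs_mult)
  also have "\<dots> \<le> (12 * pi * \<bar>h\<bar>) * (4 / x\<^sup>2) + 2 * ((3 * \<bar>h\<bar> * x\<^sup>2) * ((1 / x\<^sup>2) * (4 / x\<^sup>2)))"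
    using N1 N2 D ysq by (intro add_mono mult_mono mult_nonneg_nonneg order_refl) auto
  also have "\<dots> = (48 * pi + 24) * \<bar>h\<bar> * (1 / x\<^sup>2)" using x0 by (simp add: field_simps)
  also have "\<dots> \<le> (48 * pi + 24) * \<bar>h\<bar> * (2 * (1 / (1 + x\<^sup>2)))"
    using x2 x0 by (intro mult_left_mono) (auto simp: field_simps)
  also have "\<dots> = (96 * pi + 48) * \<bar>h\<bar> * (1 / (1 + x\<^sup>2))" by (simp add: algebra_simps)
  also have "\<dots> \<le> (960 * pi ^ 3 + 96 * pi + 48) * \<bar>h\<bar> * (1 / (1 + x\<^sup>2))"
    by (intro mult_right_mono) auto
  finally show ?thesis by (simp add: y_def)
qed

section \<open>Integrable weights on the line and the Fourier transform of the kernel\<close>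

definition decay_weight :: "real \<Rightarrow> real" where
  "decay_weight x = (1 + sqrt \<bar>x\<bar>) / (1 + x\<^sup>2)"

lemma decay_weight_measurable [measurable]: "decay_weight \<in> borel_measurable borel"
  unfolding decay_weight_def by measurable

lemma decay_weight_pos: "0 < decay_weight x"
  by (simp add: decay_weight_def add_pos_nonneg)

lemma inverse_square_le_decay_weight: "1 / (1 + x\<^sup>2) \<le> decay_weight x"
  by (simp add: decay_weight_def divide_right_mono)

text \<open>The weight is at most 2 on [-1, 1] and at most 2 |x|^(-3/2) outside. This is the
  one-dimensional source of the half-order moment; with |x| in place of its root the integral would
  diverge.\<close>

lemma integrable_decay_weight: "integrable lborel decay_weight"
proof -
  define f where "f x = x powr (-3/2) * indicator {1..} x" for x :: real
  have [measurable]: "f \<in> borel_measurable borel" unfolding f_def by measurable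
  have "(\<integral>\<^sup>+x. ennreal (x powr (-3/2)) * indicator {1..} x \<partial>lborel) = ennreal (0 - (-2 * 1 powr (-1/2)))"
  proof (rule nn_integral_FTC_atLeast[where F = "\<lambda>x. -2 * x powr (-1/2)"])
    show "((\<lambda>x. -2 * x powr (-1/2)) has_real_derivative x powr (-3/2)) (at x)" if "1 \<le> x" for x :: real
      using that by (auto intro!: derivative_eq_intros)
    have "((\<lambda>x::real. -2 * x powr (-1/2)) \<longlongrightarrow> -2 * 0) at_top"
      by (intro tendsto_mult tendsto_const tendsto_neg_powr filterlim_ident) auto
    then show "((\<lambda>x::real. -2 * x powr (-1/2)) \<longlongrightarrow> 0) at_top" by simp
  qed auto
  then have "(\<integral>\<^sup>+x. ennreal (norm (f x)) \<partial>lborel) = 2"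
    by (simp add: f_def ennreal_mult' ennreal_indicator abs_mult)
  then have f: "integrable lborel f" by (intro integrableI_bounded) auto
  have f': "integrable lborel (\<lambda>x. f (- x))" using lborel_integrable_real_affine[OF f, of "-1" 0] by simp
  have i: "integrable lborel (indicator {-1..1} :: real \<Rightarrow> real)" by simp
  show ?thesis
  proof (rule Bochner_Integration.integrable_bound[of lborel "\<lambda>x. 2 * indicator {-1..1} x + 2 * f x + 2 * f (- x)"])
    show "AE x in lborel. norm (decay_weight x) \<le> norm (2 * indicator {-1..1} x + 2 * f x + 2 * f (- x))"
    proof (rule AE_I2)
      fix x :: real
      have f0: "0 \<le> f x" for x by (simp add: f_def)
      have "decay_weight x \<le> 2 * indicator {-1..1} x + 2 * f x + 2 * f (- x)"
      proof (cases "\<bar>x\<bar> \<le> 1")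
        case True
        have "decay_weight x \<le> (1 + 1) / 1" unfolding decay_weight_def using True by (intro frac_le) auto
        moreover have "indicator {-1..1} x = (1::real)" using True by (auto simp: indicator_def)
        ultimately show ?thesis using f0[of x] f0[of "-x"] by simp
      next
        case False
        then have 1: "f x + f (- x) = \<bar>x\<bar> powr (-3/2)" by (auto simp: f_def indicator_def)
        have "1 \<le> sqrt \<bar>x\<bar>" using False by simp
        then have "decay_weight x \<le> (2 * sqrt \<bar>x\<bar>) / x\<^sup>2"
          unfolding decay_weight_def using False by (intro frac_le) auto
        also have "\<dots> = 2 * (\<bar>x\<bar> powr (1/2) * \<bar>x\<bar> powr (-2))"
        proof -
          have "sqrt \<bar>x\<bar> = \<bar>x\<bar> powr (1/2)" by (simp add: powr_half_sqrt)
          moreover have "\<bar>x\<bar> powr (-2) = 1 / \<bar>x\<bar> powr 2" by (rule powr_minus_divide)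
          moreover have "\<bar>x\<bar> powr 2 = x\<^sup>2" by simp
          ultimately show ?thesis by (metis (no_types) times_divide_eq_right mult.right_neutral mult.assoc)
        qed
        also have "\<bar>x\<bar> powr (1/2) * \<bar>x\<bar> powr (-2) = \<bar>x\<bar> powr (-3/2)"
          by (simp add: powr_add[symmetric])
        finally have "decay_weight x \<le> 2 * \<bar>x\<bar> powr (-3/2)" .
        moreover have "0 \<le> (indicator {-1..1} x :: real)" by simp
        ultimately show ?thesis using 1 by linarith
      qed
      then show "norm (decay_weight x) \<le> norm (2 * indicator {-1..1} x + 2 * f x + 2 * f (- x))"
        using decay_weight_pos[of x] by simp
    qed
  qed (use f f' i in auto)
qed

lemma integrable_inverse_square: "integrable lborel (\<lambda>x::real. 1 / (1 + x\<^sup>2))"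
  by (rule Bochner_Integration.integrable_bound[OF integrable_decay_weight])
     (use inverse_square_le_decay_weight decay_weight_pos in \<open>auto simp: less_imp_le abs_of_pos add_nonneg_nonneg\<close>)

lemma vp_kernel_integrable: "integrable lborel vp_kernel"
  by (rule Bochner_Integration.integrable_bound[of _ "\<lambda>x. (48 * pi\<^sup>2 + 4) * (1 / (1 + x\<^sup>2))"])
     (use integrable_mult_right[OF integrable_inverse_square] vp_kernel_bound in \<open>auto intro!: AE_I2 order_trans[OF _ abs_ge_self]\<close>)

text \<open>The Fourier transform of \<^const>\<open>vp_kernel\<close> is a combination of integrals of this kind, and
  scaling shows that they are \<open>|c|\<close> times a constant, whose value is irrelevant.\<close>

definition cos_integral :: "real \<Rightarrow> real" where
  "cos_integral c = (\<integral>x. (1 - cos (c * x)) / x\<^sup>2 \<partial>lborel)"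

lemma one_minus_cos_le: "1 - cos x \<le> x\<^sup>2 / (2::real)"
proof -
  have "1 - cos x = 2 * (sin (x / 2))\<^sup>2" using cos_double_sin[of "x / 2"] by simp
  moreover have "\<bar>sin (x / 2)\<bar>\<^sup>2 \<le> \<bar>x / 2\<bar>\<^sup>2" by (intro power_mono abs_sin_x_le_abs_x) auto
  ultimately show ?thesis by (simp add: power_divide)
qed

text \<open>The quadratic bound at the origin and the boundedness of the cosine at infinity are
  merged into a single majorant.\<close>

lemma cos_integrand_integrable: "integrable lborel (\<lambda>x::real. (1 - cos (c * x)) / x\<^sup>2)"
proof (rule Bochner_Integration.integrable_bound[of _ "\<lambda>x. (4 + c\<^sup>2) * (1 / (1 + x\<^sup>2))"])
  show "AE x in lborel. norm ((1 - cos (c * x)) / x\<^sup>2) \<le> norm ((4 + c\<^sup>2) * (1 / (1 + x\<^sup>2)))"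
  proof (rule AE_I2)
    fix x :: real
    have nn: "0 \<le> 1 - cos (c * x)" by simp
    have "(1 - cos (c * x)) / x\<^sup>2 \<le> (4 + c\<^sup>2) * (1 / (1 + x\<^sup>2))"
    proof (cases "x = 0")
      case False
      have "(1 - cos (c * x)) * (1 + x\<^sup>2) \<le> (4 + c\<^sup>2) * x\<^sup>2"
      proof -
        have "1 - cos (c * x) \<le> (c * x)\<^sup>2 / 2" by (rule one_minus_cos_le)
        moreover have "0 \<le> c\<^sup>2 * x\<^sup>2" by simp
        ultimately have a: "1 - cos (c * x) \<le> c\<^sup>2 * x\<^sup>2" unfolding power_mult_distrib by linarith
        have "1 - cos (c * x) \<le> 4" using cos_ge_minus_one[of "c * x"] by linarith
        then have b: "(1 - cos (c * x)) * x\<^sup>2 \<le> 4 * x\<^sup>2" by (intro mult_right_mono) auto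
        show ?thesis using a b by (simp add: algebra_simps)
      qed
      then show ?thesis using False by (simp add: field_simps add_pos_nonneg)
    qed simp
    then show "norm ((1 - cos (c * x)) / x\<^sup>2) \<le> norm ((4 + c\<^sup>2) * (1 / (1 + x\<^sup>2)))"
      using nn by (simp add: abs_mult)
  qed
qed (use integrable_mult_right[OF integrable_inverse_square] in auto)

lemma cos_integral_scale: "cos_integral c = \<bar>c\<bar> * cos_integral 1"
proof (cases "c = 0")
  case False
  have "cos_integral 1 = \<bar>c\<bar> * (\<integral>x. (1 - cos (c * x)) / (c * x)\<^sup>2 \<partial>lborel)"
    unfolding cos_integral_def using lborel_integral_real_affine[OF False, of "\<lambda>x. (1 - cos x) / x\<^sup>2" 0] by simp
  also have "(\<integral>x. (1 - cos (c * x)) / (c * x)\<^sup>2 \<partial>lborel) = (\<integral>x. (1 / c\<^sup>2) * ((1 - cos (c * x)) / x\<^sup>2) \<partial>lborel)"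
    by (simp add: power_mult_distrib)
  also have "\<dots> = (1 / c\<^sup>2) * cos_integral c" unfolding cos_integral_def by (rule integral_mult_right_zero)
  finally have "\<bar>c\<bar> * cos_integral 1 = (\<bar>c\<bar> * \<bar>c\<bar> * (1 / c\<^sup>2)) * cos_integral c" by simp
  also have "\<bar>c\<bar> * \<bar>c\<bar> * (1 / c\<^sup>2) = 1" using False by (simp add: power2_eq_square)
  finally show ?thesis by simp
qed (simp add: cos_integral_def)

text \<open>The constant will be divided out, so it only has to be nonzero; on [1, 2] the cosine
  stays below cos 1 < 1.\<close>

lemma cos_integral_pos: "0 < cos_integral 1"
proof -
  have c1: "cos 1 < (1::real)" using cos_monotone_0_pi[of 0 1] pi_gt3 by simp
  have "(\<integral>x. (1 - cos 1) / 4 * indicator {1..2::real} x \<partial>lborel) \<le> cos_integral 1"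
    unfolding cos_integral_def
  proof (rule integral_mono)
    fix x :: real
    show "(1 - cos 1) / 4 * indicator {1..2} x \<le> (1 - cos (1 * x)) / x\<^sup>2"
    proof (cases "x \<in> {1..2}")
      case True
      then have "cos x \<le> cos 1" using pi_gt3 by (intro cos_monotone_0_pi_le) auto
      moreover have "x\<^sup>2 \<le> 2\<^sup>2" using True by (intro power_mono) auto
      ultimately have "(1 - cos 1) / 4 \<le> (1 - cos x) / x\<^sup>2" using c1 True by (intro frac_le) auto
      then show ?thesis using True by simp
    qed simp
  next
    show "integrable lborel (\<lambda>x::real. (1 - cos (1 * x)) / x\<^sup>2)" by (rule cos_integrand_integrable)
  qed simp
  then show ?thesis using c1 by simp
qed

text \<open>The product-to-sum formula yields four cosines whose coefficients add up to zero, so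
  each of them can be replaced by its difference from 1, which is integrable against 1 / x^2 and
  scales as |c|.\<close>

lemma vp_kernel_cos_integral:
  "(\<integral>x. vp_kernel x * cos (\<omega> * x) \<partial>lborel)
     = cos_integral 1 / 2 * (\<bar>8 * pi + \<omega>\<bar> + \<bar>8 * pi - \<omega>\<bar> - \<bar>4 * pi + \<omega>\<bar> - \<bar>4 * pi - \<omega>\<bar>)"
proof -
  define e where "e c x = (1 - cos (c * x)) / x\<^sup>2" for c x :: real
  have ei: "integrable lborel (e c)" for c unfolding e_def by (rule cos_integrand_integrable)
  have ev: "integral\<^sup>L lborel (e c) = \<bar>c\<bar> * cos_integral 1" for c
    using cos_integral_scale[of c] by (simp add: cos_integral_def e_def[abs_def])
  have "(\<integral>x. vp_kernel x * cos (\<omega> * x) \<partial>lborel) = (\<integral>x. (1/2) * (e (8*pi+\<omega>) x + e (8*pi-\<omega>) x - e (4*pi+\<omega>) x - e (4*pi-\<omega>) x) \<partial>lborel)"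
  proof (rule integral_cong_AE)
    \<comment> \<open>The identity fails at x = 0: there the functions e vanish by the convention
      for division by zero, while the kernel takes the value 24 pi^2.\<close>
    show "AE x in lborel. vp_kernel x * cos (\<omega> * x) = (1/2) * (e (8*pi+\<omega>) x + e (8*pi-\<omega>) x - e (4*pi+\<omega>) x - e (4*pi-\<omega>) x)"
      using AE_lborel_singleton[of "0::real"]
    proof eventually_elim
      fix x :: real assume x: "x \<noteq> 0"
      have p: "cos ((c + \<omega>) * x) + cos ((c - \<omega>) * x) = 2 * (cos (c * x) * cos (\<omega> * x))" for c
        using cos_times_cos[of "c * x" "\<omega> * x"] by (simp add: algebra_simps)
      have "(1/2) * (e (8*pi+\<omega>) x + e (8*pi-\<omega>) x - e (4*pi+\<omega>) x - e (4*pi-\<omega>) x)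
        = (1/2) * ((cos ((4*pi+\<omega>)*x) + cos ((4*pi-\<omega>)*x)) - (cos ((8*pi+\<omega>)*x) + cos ((8*pi-\<omega>)*x))) / x\<^sup>2"
        using x by (simp add: e_def field_simps)
      also have "\<dots> = (cos (4 * pi * x) - cos (8 * pi * x)) * cos (\<omega> * x) / x\<^sup>2"
        unfolding p by (simp add: algebra_simps)
      finally show "vp_kernel x * cos (\<omega> * x) = (1/2) * (e (8*pi+\<omega>) x + e (8*pi-\<omega>) x - e (4*pi+\<omega>) x - e (4*pi-\<omega>) x)"
        using x by (simp add: vp_kernel_eq)
    qed
  qed (auto simp: e_def)
  also have "\<dots> = (1/2) * (\<bar>8*pi+\<omega>\<bar> * cos_integral 1 + \<bar>8*pi-\<omega>\<bar> * cos_integral 1 - \<bar>4*pi+\<omega>\<bar> * cos_integral 1 - \<bar>4*pi-\<omega>\<bar> * cos_integral 1)"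
    using ei by (simp add: ev)
  finally show ?thesis by (simp add: algebra_simps)
qed

lemma vp_kernel_sin_integral: "(\<integral>x. vp_kernel x * sin (\<omega> * x) \<partial>lborel) = 0"
proof -
  have "(\<integral>x. vp_kernel x * sin (\<omega> * x) \<partial>lborel) = (\<integral>x. - (vp_kernel x * sin (\<omega> * x)) \<partial>lborel)"
    using lborel_integral_real_affine[of "-1" "\<lambda>x. vp_kernel x * sin (\<omega> * x)" 0] by (simp add: vp_kernel_even)
  then show ?thesis by simp
qed

text \<open>The divisor is the integral of \<open>vp_kernel\<close>, the case \<omega> = 0 of
  \<open>vp_kernel_cos_integral\<close>.\<close>

definition vp_normalized :: "real \<Rightarrow> real" where
  "vp_normalized x = vp_kernel x / (4 * pi * cos_integral 1)"

lemma vp_normalized_measurable [measurable]: "vp_normalized \<in> borel_measurable borel"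
  unfolding vp_normalized_def by measurable

lemma vp_normalized_integrable: "integrable lborel vp_normalized"
  unfolding vp_normalized_def using vp_kernel_integrable by simp

text \<open>The kernel is even, so the sine part drops out. The right-hand side is a trapezoid in
  \<xi>: it is 1 for |\<xi>| \<le> 2, 0 for |\<xi>| \<ge> 4 and linear in between.\<close>

lemma vp_normalized_fourier:
  "(\<integral>x. exp (- (2 * of_real pi * \<i> * of_real (x * \<xi>))) * of_real (vp_normalized x) \<partial>lborel) =
     of_real ((\<bar>8 * pi + 2 * pi * \<xi>\<bar> + \<bar>8 * pi - 2 * pi * \<xi>\<bar> - \<bar>4 * pi + 2 * pi * \<xi>\<bar> - \<bar>4 * pi - 2 * pi * \<xi>\<bar>) / (8 * pi))"
proof -
  define \<omega> where "\<omega> = 2 * pi * \<xi>"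
  define c where "c = 4 * pi * cos_integral 1"
  have c: "c \<noteq> 0" using cos_integral_pos by (simp add: c_def)
  have i1: "integrable lborel (\<lambda>x. vp_kernel x * cos (\<omega> * x))"
    by (rule Bochner_Integration.integrable_bound[OF vp_kernel_integrable])
       (auto intro!: AE_I2 simp: abs_mult mult_left_le)
  have i2: "integrable lborel (\<lambda>x. vp_kernel x * sin (\<omega> * x))"
    by (rule Bochner_Integration.integrable_bound[OF vp_kernel_integrable])
       (auto intro!: AE_I2 simp: abs_mult mult_left_le)
  have "exp (- (2 * of_real pi * \<i> * of_real (x * \<xi>))) * of_real (vp_normalized x) =
      complex_of_real (vp_kernel x * cos (\<omega> * x) / c) - \<i> * complex_of_real (vp_kernel x * sin (\<omega> * x) / c)" for x
  proof -
    have "- (2 * of_real pi * \<i> * of_real (x * \<xi>)) = \<i> * of_real (- (\<omega> * x))" by (simp add: \<omega>_def)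
    then have E: "exp (- (2 * of_real pi * \<i> * of_real (x * \<xi>))) = of_real (cos (\<omega> * x)) - \<i> * of_real (sin (\<omega> * x))"
      by (simp only: cis_conv_exp[symmetric]) (simp add: complex_eq_iff)
    show ?thesis unfolding E vp_normalized_def c_def[symmetric] by (simp add: algebra_simps diff_divide_distrib)
  qed
  then have "(\<integral>x. exp (- (2 * of_real pi * \<i> * of_real (x * \<xi>))) * of_real (vp_normalized x) \<partial>lborel)
     = (\<integral>x. complex_of_real (vp_kernel x * cos (\<omega> * x) / c) - \<i> * complex_of_real (vp_kernel x * sin (\<omega> * x) / c) \<partial>lborel)"
    by simp
  also have "\<dots> = (\<integral>x. complex_of_real (vp_kernel x * cos (\<omega> * x) / c) \<partial>lborel) - (\<integral>x. \<i> * complex_of_real (vp_kernel x * sin (\<omega> * x) / c) \<partial>lborel)"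
    using i1 i2 by (intro Bochner_Integration.integral_diff integrable_mult_right integrable_of_real integrable_divide_zero) auto
  also have "\<dots> = of_real ((\<integral>x. vp_kernel x * cos (\<omega> * x) \<partial>lborel) / c) - \<i> * of_real ((\<integral>x. vp_kernel x * sin (\<omega> * x) \<partial>lborel) / c)"
    by (simp only: integral_mult_right_zero integral_complex_of_real integral_divide_zero)
  also have "\<dots> = of_real (cos_integral 1 / 2 * (\<bar>8 * pi + \<omega>\<bar> + \<bar>8 * pi - \<omega>\<bar> - \<bar>4 * pi + \<omega>\<bar> - \<bar>4 * pi - \<omega>\<bar>) / c)"
    unfolding vp_kernel_cos_integral vp_kernel_sin_integral by simp
  also have "cos_integral 1 / 2 * (\<bar>8 * pi + \<omega>\<bar> + \<bar>8 * pi - \<omega>\<bar> - \<bar>4 * pi + \<omega>\<bar> - \<bar>4 * pi - \<omega>\<bar>) / c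
     = (\<bar>8 * pi + \<omega>\<bar> + \<bar>8 * pi - \<omega>\<bar> - \<bar>4 * pi + \<omega>\<bar> - \<bar>4 * pi - \<omega>\<bar>) / (8 * pi)"
    unfolding c_def using cos_integral_pos by simp
  finally show ?thesis by (simp only: \<omega>_def)
qed

lemma vp_normalized_fourier_eq_1:
  assumes "\<bar>\<xi>\<bar> \<le> 2"
  shows "(\<integral>x. exp (- (2 * of_real pi * \<i> * of_real (x * \<xi>))) * of_real (vp_normalized x) \<partial>lborel) = 1"
proof -
  have "\<bar>2 * pi * \<xi>\<bar> \<le> 4 * pi" using assms by (simp add: abs_mult)
  then have "\<bar>8 * pi + 2 * pi * \<xi>\<bar> + \<bar>8 * pi - 2 * pi * \<xi>\<bar> - \<bar>4 * pi + 2 * pi * \<xi>\<bar> - \<bar>4 * pi - 2 * pi * \<xi>\<bar> = 8 * pi"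
    using pi_gt_zero by linarith
  then show ?thesis unfolding vp_normalized_fourier by simp
qed

lemma vp_normalized_fourier_eq_0:
  assumes "4 \<le> \<bar>\<xi>\<bar>"
  shows "(\<integral>x. exp (- (2 * of_real pi * \<i> * of_real (x * \<xi>))) * of_real (vp_normalized x) \<partial>lborel) = 0"
proof -
  have "8 * pi \<le> \<bar>2 * pi * \<xi>\<bar>" using assms by (simp add: abs_mult)
  then have "\<bar>8 * pi + 2 * pi * \<xi>\<bar> + \<bar>8 * pi - 2 * pi * \<xi>\<bar> - \<bar>4 * pi + 2 * pi * \<xi>\<bar> - \<bar>4 * pi - 2 * pi * \<xi>\<bar> = 0"
    using pi_gt_zero by linarith
  then show ?thesis unfolding vp_normalized_fourier by simp
qed

lemma vp_normalized_bounds: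
  obtains C where "1 \<le> C" "\<And>x. \<bar>vp_normalized x\<bar> \<le> C * (1 / (1 + x\<^sup>2))"
    "\<And>x h. \<bar>h\<bar> \<le> 1 \<Longrightarrow> \<bar>vp_normalized (x + h) - vp_normalized x\<bar> \<le> C * \<bar>h\<bar> * (1 / (1 + x\<^sup>2))"
proof -
  define c where "c = 4 * pi * cos_integral 1"
  have c: "0 < c" using cos_integral_pos by (simp add: c_def)
  define A where "A = 48 * pi\<^sup>2 + 4"
  define B where "B = 960 * pi ^ 3 + 96 * pi + 48"
  define C where "C = 1 + A / c + B / c"
  have AB: "0 \<le> A" "0 \<le> B" by (auto simp: A_def B_def)
  have AC: "A / c \<le> C" "B / c \<le> C" "1 \<le> C" using AB c by (auto simp: C_def)
  show ?thesis
  proof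
    show "1 \<le> C" by fact
    fix x :: real
    have w: "0 \<le> 1 / (1 + x\<^sup>2)" by simp
    have "\<bar>vp_normalized x\<bar> = \<bar>vp_kernel x\<bar> / c" using c by (simp add: vp_normalized_def c_def)
    also have "\<dots> \<le> A * (1 / (1 + x\<^sup>2)) / c" unfolding A_def using c by (intro divide_right_mono vp_kernel_bound) auto
    also have "\<dots> = A / c * (1 / (1 + x\<^sup>2))" by simp
    also have "\<dots> \<le> C * (1 / (1 + x\<^sup>2))" by (rule mult_right_mono[OF AC(1) w])
    finally show "\<bar>vp_normalized x\<bar> \<le> C * (1 / (1 + x\<^sup>2))" .
    fix h :: real assume h: "\<bar>h\<bar> \<le> 1"
    have "\<bar>vp_normalized (x + h) - vp_normalized x\<bar> = \<bar>vp_kernel (x + h) - vp_kernel x\<bar> / c"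
      using c by (simp add: vp_normalized_def c_def diff_divide_distrib[symmetric])
    also have "\<dots> \<le> B * \<bar>h\<bar> * (1 / (1 + x\<^sup>2)) / c"
      unfolding B_def using c by (intro divide_right_mono vp_kernel_modulus h) auto
    also have "\<dots> = B / c * (\<bar>h\<bar> * (1 / (1 + x\<^sup>2)))" by simp
    also have "\<dots> \<le> C * (\<bar>h\<bar> * (1 / (1 + x\<^sup>2)))" using w by (intro mult_right_mono[OF AC(2)]) auto
    finally show "\<bar>vp_normalized (x + h) - vp_normalized x\<bar> \<le> C * \<bar>h\<bar> * (1 / (1 + x\<^sup>2))" by simp
  qed
qed

section \<open>Tensor products of the one-dimensional kernel\<close>

lemma lborel_prod_Basis:
  fixes f :: "'a::euclidean_space \<Rightarrow> real \<Rightarrow> 'b::{real_normed_field,banach,second_countable_topology}"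
  assumes f: "\<And>b. b \<in> Basis \<Longrightarrow> integrable lborel (f b)"
  shows "integrable lborel (\<lambda>x. \<Prod>b\<in>Basis. f b (x \<bullet> b))"
    and "(\<integral>x. (\<Prod>b\<in>Basis. f b (x \<bullet> b)) \<partial>lborel) = (\<Prod>b\<in>Basis. \<integral>t. f b t \<partial>lborel)"
proof -
  interpret product_sigma_finite "\<lambda>_::'a. lborel :: real measure" by standard
  have [measurable]: "f b \<in> borel_measurable borel" if "b \<in> Basis" for b using f[OF that] by auto
  let ?T = "\<lambda>g. \<Sum>b\<in>Basis. g b *\<^sub>R b :: 'a"
  have T: "?T \<in> (\<Pi>\<^sub>M b\<in>Basis. lborel) \<rightarrow>\<^sub>M borel" by measurable
  have m: "(\<lambda>x::'a. \<Prod>b\<in>Basis. f b (x \<bullet> b)) \<in> borel_measurable borel" by measurable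
  have e: "(\<Prod>b\<in>Basis. f b (?T g \<bullet> b)) = (\<Prod>b\<in>Basis. f b (g b))" for g
    by (intro prod.cong refl) simp
  show "integrable lborel (\<lambda>x. \<Prod>b\<in>Basis. f b (x \<bullet> b))"
    unfolding lborel_eq[where 'a='a] using product_integrable_prod[of Basis f] f
    by (subst integrable_distr_eq[OF T m]) (simp add: e)
  show "(\<integral>x. (\<Prod>b\<in>Basis. f b (x \<bullet> b)) \<partial>lborel) = (\<Prod>b\<in>Basis. \<integral>t. f b t \<partial>lborel)"
    using product_integral_prod[of Basis f] f
    by (subst lborel_eq[where 'a='a], subst integral_distr[OF T m]) (simp add: e)
qed

text \<open>Separate from \<open>fourier\<close>: kernels are Borel functions on an arbitrary
  Euclidean space, the line included, and are integrated over \<open>lborel\<close>, where Fubini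
  applies directly.\<close>

definition fourier_kernel :: "('a::euclidean_space \<Rightarrow> real) \<Rightarrow> 'a \<Rightarrow> complex" where
  "fourier_kernel \<phi> \<xi> = (\<integral>x. exp (- (2 * of_real pi * \<i> * of_real (x \<bullet> \<xi>))) * of_real (\<phi> x) \<partial>lborel)"

lemma norm_fourier_exp [simp]:
  "norm (exp (- (2 * complex_of_real pi * \<i> * complex_of_real t))) = 1" "norm (exp (2 * complex_of_real pi * \<i> * complex_of_real t)) = 1"
  by (simp_all add: norm_exp_eq_Re)

lemma fourier_exp_integrable:
  fixes f :: "'a::euclidean_space \<Rightarrow> complex"
  assumes "integrable lborel f"
  shows "integrable lborel (\<lambda>x. exp (- (2 * of_real pi * \<i> * of_real (x \<bullet> \<xi>))) * f x)"
proof -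
  have [measurable]: "f \<in> borel_measurable borel" using assms by auto
  show ?thesis
    by (rule Bochner_Integration.integrable_bound[OF assms]) (auto simp: norm_mult)
qed

definition vp_prod :: "'a::euclidean_space \<Rightarrow> real" where
  "vp_prod x = (\<Prod>b\<in>Basis. vp_normalized (x \<bullet> b))"

text \<open>A tensor product in place of a radial weight, so that its integrals factor into
  one-dimensional ones.\<close>

definition prod_weight :: "'a::euclidean_space \<Rightarrow> real" where
  "prod_weight x = (\<Prod>b\<in>Basis. 1 / (1 + (x \<bullet> b)\<^sup>2))"

lemma prod_weight_measurable [measurable]: "prod_weight \<in> borel_measurable borel"
  unfolding prod_weight_def by measurable

lemma prod_weight_nonneg: "0 \<le> prod_weight x"
  unfolding prod_weight_def by (intro prod_nonneg) (auto simp: add_nonneg_nonneg)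

lemma prod_weight_le_1: "prod_weight x \<le> 1"
  unfolding prod_weight_def by (intro prod_le_1) (auto simp: add_nonneg_nonneg add_pos_nonneg)

lemma prod_weight_integrable: "integrable lborel (prod_weight :: 'a::euclidean_space \<Rightarrow> real)"
  unfolding prod_weight_def[abs_def] by (rule lborel_prod_Basis(1)) (rule integrable_inverse_square)

lemma sum_le_prod_one_plus:
  fixes a :: "'i \<Rightarrow> real"
  assumes "finite I" "\<And>i. i \<in> I \<Longrightarrow> 0 \<le> a i"
  shows "1 + (\<Sum>i\<in>I. a i) \<le> (\<Prod>i\<in>I. 1 + a i)"
  using assms
proof (induction I)
  case (insert i I)
  have "1 + (a i + (\<Sum>i\<in>I. a i)) \<le> (1 + a i) * (1 + (\<Sum>i\<in>I. a i))"
    using insert by (simp add: algebra_simps sum_nonneg)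
  also have "\<dots> \<le> (1 + a i) * (\<Prod>i\<in>I. 1 + a i)" using insert by (intro mult_left_mono) auto
  finally show ?case using insert by simp
qed simp

lemma sqrt_norm_le_sum: "sqrt (norm (x::'a::euclidean_space)) \<le> (\<Sum>b\<in>Basis. sqrt \<bar>x \<bullet> b\<bar>)"
proof -
  have aux: "sqrt (\<Sum>b\<in>I. a b) \<le> (\<Sum>b\<in>I. sqrt (a b))" if "finite I" "\<And>b. 0 \<le> a b" for I :: "'a set" and a :: "'a \<Rightarrow> real"
    using that(1)
  proof (induction I)
    case (insert b I)
    have "sqrt (a b + sum a I) \<le> sqrt (a b) + sqrt (sum a I)"
      using that(2) by (intro sqrt_add_le_add_sqrt sum_nonneg) auto
    then show ?case using insert by simp
  qed simp
  have "sqrt (norm x) \<le> sqrt (\<Sum>b\<in>Basis. \<bar>x \<bullet> b\<bar>)" by (simp add: norm_le_l1)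
  also have "\<dots> \<le> (\<Sum>b\<in>Basis. sqrt \<bar>x \<bullet> b\<bar>)" by (rule aux) auto
  finally show ?thesis .
qed

text \<open>The root of the norm is at most the sum of the roots of the coordinates, hence at most
  the product of the factors 1 + sqrt |x_b|; this reduces the moment to one-dimensional integrals of
  \<open>decay_weight\<close>.\<close>

lemma prod_weight_sqrt_integrable: "integrable lborel (\<lambda>x::'a::euclidean_space. prod_weight x * sqrt (norm x))"
proof (rule Bochner_Integration.integrable_bound)
  show "integrable lborel (\<lambda>x::'a. \<Prod>b\<in>Basis. decay_weight (x \<bullet> b))"
    by (rule lborel_prod_Basis(1)) (rule integrable_decay_weight)
  show "AE x::'a in lborel. norm (prod_weight x * sqrt (norm x)) \<le> norm (\<Prod>b\<in>Basis. decay_weight (x \<bullet> b))"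
  proof (rule AE_I2)
    fix x :: 'a
    have "sqrt (norm x) \<le> 1 + (\<Sum>b\<in>Basis. sqrt \<bar>x \<bullet> b\<bar>)" using sqrt_norm_le_sum[of x] by linarith
    also have "\<dots> \<le> (\<Prod>b\<in>Basis. 1 + sqrt \<bar>x \<bullet> b\<bar>)" by (rule sum_le_prod_one_plus) auto
    finally have "prod_weight x * sqrt (norm x) \<le> prod_weight x * (\<Prod>b\<in>Basis. 1 + sqrt \<bar>x \<bullet> b\<bar>)"
      by (intro mult_left_mono prod_weight_nonneg)
    also have "\<dots> = (\<Prod>b\<in>Basis. decay_weight (x \<bullet> b))"
      unfolding prod_weight_def decay_weight_def prod.distrib[symmetric] by simp
    finally show "norm (prod_weight x * sqrt (norm x)) \<le> norm (\<Prod>b\<in>Basis. decay_weight (x \<bullet> b))"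
      using prod_weight_nonneg[of x] by (simp add: abs_mult)
  qed
qed auto

text \<open>The scale-free part of \<open>dyadic_kernels\<close>, apart from the vanishing mean:
  \<open>vp_prod\<close> itself has it, and it is stable under dilations and differences.\<close>

definition smoothing_kernel :: "('a::euclidean_space \<Rightarrow> real) \<Rightarrow> bool" where
  "smoothing_kernel \<phi> \<longleftrightarrow> bdd_kernel \<phi> \<and> integrable lborel (\<lambda>y. \<bar>\<phi> y\<bar> * sqrt (norm y)) \<and>
     (\<exists>K. \<forall>y. (\<integral>z. \<bar>\<phi> z - \<phi> (z - y)\<bar> \<partial>lborel) \<le> K * sqrt (norm y))"

lemma vp_prod_measurable [measurable]: "vp_prod \<in> borel_measurable borel"
  unfolding vp_prod_def by measurable

lemma vp_prod_even: "vp_prod (- x) = vp_prod x"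
  by (simp add: vp_prod_def vp_normalized_def vp_kernel_even)

lemma vp_prod_bounds:
  obtains C where "0 \<le> C" "\<And>x::'a::euclidean_space. \<bar>vp_prod x\<bar> \<le> C * prod_weight x"
    "\<And>(x::'a) h. norm h \<le> 1 \<Longrightarrow> \<bar>vp_prod (x + h) - vp_prod x\<bar> \<le> C * norm h * prod_weight x"
proof -
  obtain C where C: "1 \<le> C" "\<And>x. \<bar>vp_normalized x\<bar> \<le> C * (1 / (1 + x\<^sup>2))"
    "\<And>x h. \<bar>h\<bar> \<le> 1 \<Longrightarrow> \<bar>vp_normalized (x + h) - vp_normalized x\<bar> \<le> C * \<bar>h\<bar> * (1 / (1 + x\<^sup>2))"
    using vp_normalized_bounds by blast
  define n where "n = DIM('a)"
  define D where "D = (2 * C) ^ n * n"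
  have n1: "1 \<le> real n" using DIM_positive[where 'a='a] by (simp add: n_def)
  have "0 \<le> (2 * C) ^ n" using C(1) by simp
  then have D0: "(2 * C) ^ n \<le> D" "0 \<le> D" using mult_left_mono[OF n1, of "(2 * C) ^ n"] by (auto simp: D_def)
  \<comment> \<open>The factor 2 leaves room to bound the shifted value at t + h by the weight at t,
    as value plus increment.\<close>
  define w where "w t = 2 * C * (1 / (1 + t\<^sup>2))" for t :: real
  have w0: "0 < w t" for t using C(1) by (simp add: w_def add_pos_nonneg)
  have W: "(\<Prod>b\<in>Basis. w (x \<bullet> b)) = (2 * C) ^ n * prod_weight x" for x :: 'a
    unfolding w_def prod_weight_def prod.distrib n_def by simp
  have v1: "\<bar>vp_normalized t\<bar> \<le> w t" for t
  proof -
    have "C * (1 / (1 + t\<^sup>2)) \<le> w t" unfolding w_def using C(1) by (intro mult_right_mono) (auto simp: add_nonneg_nonneg)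
    then show ?thesis using C(2)[of t] by linarith
  qed
  have v2: "\<bar>vp_normalized (t + h) - vp_normalized t\<bar> \<le> w t * \<bar>h\<bar>" if "\<bar>h\<bar> \<le> 1" for t h
  proof -
    have "C * \<bar>h\<bar> * (1 / (1 + t\<^sup>2)) \<le> 2 * C * \<bar>h\<bar> * (1 / (1 + t\<^sup>2))"
      using C(1) by (intro mult_right_mono) (auto simp: add_nonneg_nonneg)
    then show ?thesis using C(3)[OF that, of t] by (simp add: w_def mult_ac)
  qed
  have v3: "\<bar>vp_normalized (t + h)\<bar> \<le> w t" if "\<bar>h\<bar> \<le> 1" for t h
  proof -
    have "C * \<bar>h\<bar> * (1 / (1 + t\<^sup>2)) \<le> C * 1 * (1 / (1 + t\<^sup>2))"
      using C(1) that by (intro mult_right_mono mult_left_mono) (auto simp: add_nonneg_nonneg)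
    moreover have "w t = C * (1 / (1 + t\<^sup>2)) + C * 1 * (1 / (1 + t\<^sup>2))" by (simp add: w_def)
    ultimately show ?thesis using C(2)[of t] C(3)[OF that, of t] by linarith
  qed
  show ?thesis
  proof
    show "0 \<le> D" by fact
    fix x :: 'a
    have "\<bar>vp_prod x\<bar> \<le> (\<Prod>b\<in>Basis. w (x \<bullet> b))"
      unfolding vp_prod_def abs_prod by (intro prod_mono) (auto simp: v1)
    also have "\<dots> \<le> D * prod_weight x" unfolding W by (rule mult_right_mono[OF D0(1) prod_weight_nonneg])
    finally show "\<bar>vp_prod x\<bar> \<le> D * prod_weight x" .
    fix h :: 'a assume h: "norm h \<le> 1"
    have hb: "\<bar>h \<bullet> b\<bar> \<le> norm h" "\<bar>h \<bullet> b\<bar> \<le> 1" if "b \<in> Basis" for b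
      using Basis_le_norm[OF that, of h] h by auto
    \<comment> \<open>Each factor is divided by its weight, because the telescoping bound
      \<open>norm_prod_diff\<close> for products requires factors of modulus at most 1.\<close>
    define z1 where "z1 b = vp_normalized (x \<bullet> b + h \<bullet> b) / w (x \<bullet> b)" for b
    define z2 where "z2 b = vp_normalized (x \<bullet> b) / w (x \<bullet> b)" for b
    have z: "norm (z1 b) \<le> 1" "norm (z2 b) \<le> 1" "norm (z1 b - z2 b) \<le> norm h" if "b \<in> Basis" for b
    proof -
      show "norm (z1 b) \<le> 1" "norm (z2 b) \<le> 1"
        using v3[OF hb(2)[OF that], of "x \<bullet> b"] v1[of "x \<bullet> b"] w0[of "x \<bullet> b"]
        by (simp_all add: z1_def z2_def abs_divide)
      have "norm (z1 b - z2 b) = \<bar>vp_normalized (x \<bullet> b + h \<bullet> b) - vp_normalized (x \<bullet> b)\<bar> / w (x \<bullet> b)"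
        using w0[of "x \<bullet> b"] by (simp add: z1_def z2_def diff_divide_distrib[symmetric])
      also have "\<dots> \<le> \<bar>h \<bullet> b\<bar>"
        using v2[OF hb(2)[OF that], of "x \<bullet> b"] w0[of "x \<bullet> b"] by (simp add: divide_le_eq mult.commute)
      finally show "norm (z1 b - z2 b) \<le> norm h" using hb(1)[OF that] by simp
    qed
    have "\<bar>vp_prod (x + h) - vp_prod x\<bar> = \<bar>(\<Prod>b\<in>Basis. w (x \<bullet> b)) * ((\<Prod>b\<in>Basis. z1 b) - (\<Prod>b\<in>Basis. z2 b))\<bar>"
    proof -
      have "w t * (u / w t) = u" for t u using w0[of t] by simp
      then show ?thesis
        unfolding right_diff_distrib prod.distrib[symmetric] z1_def z2_def vp_prod_def inner_add_left by simp
    qed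
    also have "\<dots> = (\<Prod>b\<in>Basis. w (x \<bullet> b)) * norm ((\<Prod>b\<in>Basis. z1 b) - (\<Prod>b\<in>Basis. z2 b))"
      using w0 by (simp add: abs_mult abs_prod less_imp_le abs_of_pos)
    also have "\<dots> \<le> (\<Prod>b\<in>Basis. w (x \<bullet> b)) * (\<Sum>b\<in>(Basis::'a set). norm (z1 b - z2 b))"
      using w0 z by (intro mult_left_mono norm_prod_diff prod_nonneg) (auto simp: less_imp_le)
    also have "\<dots> \<le> (\<Prod>b\<in>Basis. w (x \<bullet> b)) * (\<Sum>b\<in>(Basis::'a set). norm h)"
      using w0 z by (intro mult_left_mono sum_mono prod_nonneg) (auto simp: less_imp_le)
    also have "\<dots> = D * norm h * prod_weight x" by (simp add: W D_def n_def)
    finally show "\<bar>vp_prod (x + h) - vp_prod x\<bar> \<le> D * norm h * prod_weight x" .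
  qed
qed

text \<open>For translations of length at most 1 the bound linear in \<open>norm y\<close> is
  stronger than one in \<open>sqrt (norm y)\<close>; for longer ones
  \<open>sqrt (norm y) \<ge> 1\<close>, and twice the L^1 norm is enough.\<close>

lemma smoothing_kernel_vp_prod: "smoothing_kernel (vp_prod :: 'a::euclidean_space \<Rightarrow> real)"
proof -
  obtain C where C: "0 \<le> C" "\<And>x::'a. \<bar>vp_prod x\<bar> \<le> C * prod_weight x"
    "\<And>(x::'a) h. norm h \<le> 1 \<Longrightarrow> \<bar>vp_prod (x + h) - vp_prod x\<bar> \<le> C * norm h * prod_weight x"
    using vp_prod_bounds by blast
  have Cw: "0 \<le> C * prod_weight x" for x :: 'a using C(1) prod_weight_nonneg[of x] by simp
  have int: "integrable lborel (vp_prod :: 'a \<Rightarrow> real)"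
    by (rule Bochner_Integration.integrable_bound[OF integrable_mult_right[OF prod_weight_integrable, of C]])
       (use C(2) Cw in auto)
  have "bounded (range (vp_prod :: 'a \<Rightarrow> real))"
    unfolding bounded_iff
  proof (intro exI[of _ C] ballI)
    fix y assume "y \<in> range (vp_prod :: 'a \<Rightarrow> real)"
    then obtain x :: 'a where x: "y = vp_prod x" by auto
    have "C * prod_weight x \<le> C * 1" using C(1) by (intro mult_left_mono prod_weight_le_1)
    then show "norm y \<le> C" using C(2)[of x] x by simp
  qed
  with int have 1: "bdd_kernel (vp_prod :: 'a \<Rightarrow> real)" by (simp add: bdd_kernel_def)
  have 2: "integrable lborel (\<lambda>y::'a. \<bar>vp_prod y\<bar> * sqrt (norm y))"
  proof (rule Bochner_Integration.integrable_bound[OF integrable_mult_right[OF prod_weight_sqrt_integrable, of C]])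
    show "AE x::'a in lborel. norm (\<bar>vp_prod x\<bar> * sqrt (norm x)) \<le> norm (C * (prod_weight x * sqrt (norm x)))"
    proof (rule AE_I2)
      fix x :: 'a
      show "norm (\<bar>vp_prod x\<bar> * sqrt (norm x)) \<le> norm (C * (prod_weight x * sqrt (norm x)))"
        using mult_right_mono[OF C(2)[of x], of "sqrt (norm x)"] C(1) prod_weight_nonneg[of x]
        by (simp add: abs_mult mult.assoc)
    qed
  qed auto
  define I where "I = (\<integral>z. prod_weight (z::'a) \<partial>lborel)"
  define L where "L = (\<integral>z. \<bar>vp_prod (z::'a)\<bar> \<partial>lborel)"
  have I0: "0 \<le> I" "0 \<le> L" unfolding I_def L_def by (auto intro!: integral_nonneg_AE AE_I2 prod_weight_nonneg)
  have "(\<integral>z. \<bar>vp_prod z - vp_prod (z - y)\<bar> \<partial>lborel) \<le> (C * I + 2 * L) * sqrt (norm y)" for y :: 'a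
  proof (cases "norm y \<le> 1")
    case True
    have "norm y = sqrt (norm y) * sqrt (norm y)" by simp
    also have "\<dots> \<le> 1 * sqrt (norm y)" using True by (intro mult_right_mono) auto
    finally have y: "norm y \<le> sqrt (norm y)" by simp
    have "(\<integral>z. \<bar>vp_prod z - vp_prod (z - y)\<bar> \<partial>lborel) \<le> (\<integral>z. C * norm y * prod_weight (z::'a) \<partial>lborel)"
    proof (rule integral_mono)
      show "integrable lborel (\<lambda>z. \<bar>vp_prod z - vp_prod (z - y)\<bar>)"
        using bdd_kernelD(1)[OF bdd_kernel_diff_shift[OF 1, of y]] by simp
      show "integrable lborel (\<lambda>z::'a. C * norm y * prod_weight z)"
        by (rule integrable_mult_right[OF prod_weight_integrable])
      show "\<bar>vp_prod z - vp_prod (z - y)\<bar> \<le> C * norm y * prod_weight z" for z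
        using C(3)[of "- y" z] True by (simp add: abs_minus_commute)
    qed
    also have "\<dots> = C * I * norm y" by (simp add: I_def)
    also have "\<dots> \<le> C * I * sqrt (norm y)" using y C(1) I0 by (intro mult_left_mono) auto
    also have "\<dots> \<le> (C * I + 2 * L) * sqrt (norm y)" using I0 by (intro mult_right_mono) auto
    finally show ?thesis .
  next
    case False
    have "(\<integral>z. \<bar>vp_prod z - vp_prod (z - y)\<bar> \<partial>lborel) \<le> (\<integral>z. \<bar>vp_prod z\<bar> + \<bar>vp_prod (z - y)\<bar> \<partial>lborel)"
      using bdd_kernelD(1)[OF bdd_kernel_diff_shift[OF 1, of y]] int lborel_integrable_shift(2)[OF int, of y]
      by (intro integral_mono) auto
    also have "\<dots> = 2 * L"
      using int lborel_integrable_shift(2)[OF int, of y] lborel_integral_shift(2)[of "\<lambda>z::'a. \<bar>vp_prod z\<bar>" y]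
      by (simp add: L_def)
    also have "\<dots> \<le> (C * I + 2 * L) * 1" using C(1) I0 by simp
    also have "\<dots> \<le> (C * I + 2 * L) * sqrt (norm y)" using False C(1) I0 by (intro mult_left_mono) auto
    finally show ?thesis .
  qed
  with 1 2 show ?thesis unfolding smoothing_kernel_def by blast
qed

lemma smoothing_kernel_diff:
  assumes f: "smoothing_kernel f" and g: "smoothing_kernel g"
  shows "smoothing_kernel (\<lambda>x. f x - g x)"
proof -
  have bf: "bdd_kernel f" and bg: "bdd_kernel g" using f g by (auto simp: smoothing_kernel_def)
  note [measurable] = bdd_kernelD(2)[OF bf] bdd_kernelD(2)[OF bg]
  obtain A where A: "\<And>x. \<bar>f x\<bar> \<le> A" using bdd_kernel_bound[OF bf] by blast
  obtain B where B: "\<And>x. \<bar>g x\<bar> \<le> B" using bdd_kernel_bound[OF bg] by blast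
  obtain K L where K: "\<And>y. (\<integral>z. \<bar>f z - f (z - y)\<bar> \<partial>lborel) \<le> K * sqrt (norm y)"
    and L: "\<And>y. (\<integral>z. \<bar>g z - g (z - y)\<bar> \<partial>lborel) \<le> L * sqrt (norm y)"
    using f g by (auto simp: smoothing_kernel_def)
  have "\<bar>f x - g x\<bar> \<le> A + B" for x using A[of x] B[of x] abs_triangle_ineq4[of "f x" "g x"] by linarith
  then have 1: "bdd_kernel (\<lambda>x. f x - g x)"
    unfolding bdd_kernel_def bounded_iff using bdd_kernelD(1)[OF bf] bdd_kernelD(1)[OF bg] by auto
  have 2: "integrable lborel (\<lambda>y. \<bar>f y - g y\<bar> * sqrt (norm y))"
  proof (rule Bochner_Integration.integrable_bound)
    show "integrable lborel (\<lambda>y. \<bar>f y\<bar> * sqrt (norm y) + \<bar>g y\<bar> * sqrt (norm y))"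
      using f g by (auto simp: smoothing_kernel_def)
    show "AE x in lborel. norm (\<bar>f x - g x\<bar> * sqrt (norm x)) \<le> norm (\<bar>f x\<bar> * sqrt (norm x) + \<bar>g x\<bar> * sqrt (norm x))"
      by (intro AE_I2) (auto simp: abs_mult distrib_right[symmetric] intro!: mult_right_mono)
  qed auto
  have 3: "(\<integral>z. \<bar>(f z - g z) - (f (z - y) - g (z - y))\<bar> \<partial>lborel) \<le> (K + L) * sqrt (norm y)" for y
  proof -
    have i: "integrable lborel (\<lambda>z. f z - f (z - y))" "integrable lborel (\<lambda>z. g z - g (z - y))"
      using bdd_kernelD(1)[OF bdd_kernel_diff_shift[OF bf, of y]] bdd_kernelD(1)[OF bdd_kernel_diff_shift[OF bg, of y]] by auto
    have "(\<integral>z. \<bar>(f z - g z) - (f (z - y) - g (z - y))\<bar> \<partial>lborel) \<le> (\<integral>z. \<bar>f z - f (z - y)\<bar> + \<bar>g z - g (z - y)\<bar> \<partial>lborel)"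
    proof (rule integral_mono)
      show "integrable lborel (\<lambda>z. \<bar>f z - g z - (f (z - y) - g (z - y))\<bar>)"
        using bdd_kernelD(1)[OF bdd_kernel_diff_shift[OF 1, of y]] by simp
    qed (use i in auto)
    also have "\<dots> \<le> (K + L) * sqrt (norm y)" using i K[of y] L[of y] by (simp add: distrib_right)
    finally show ?thesis .
  qed
  from 1 2 3 show ?thesis unfolding smoothing_kernel_def by blast
qed

section \<open>Dilations and the dyadic family\<close>

definition dilate :: "real \<Rightarrow> ('a::euclidean_space \<Rightarrow> real) \<Rightarrow> 'a \<Rightarrow> real" where
  "dilate s \<phi> x = s ^ DIM('a) * \<phi> (s *\<^sub>R x)"

lemma dilate_integral:
  fixes F :: "'a::euclidean_space \<Rightarrow> 'b::{banach,second_countable_topology}"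
  assumes "0 < s" "F \<in> borel_measurable borel"
  shows "(\<integral>x. s ^ DIM('a) *\<^sub>R F (s *\<^sub>R x) \<partial>lborel) = (\<integral>x. F x \<partial>lborel)"
  using lborel_integral_affine[of s F 0] assms by simp

lemma dilate_integrable:
  fixes F :: "'a::euclidean_space \<Rightarrow> 'b::{banach,second_countable_topology}"
  assumes "0 < s" "integrable lborel F"
  shows "integrable lborel (\<lambda>x. F (s *\<^sub>R x))"
  using lborel_integrable_affine[of s F 0] assms by simp

text \<open>Integral and L^1 norm are invariant, the half-order moment shrinks by sqrt s and the
  modulus grows by sqrt s. For s = 2^j these are the powers required in
  \<open>dyadic_kernels\<close>.\<close>

lemma dilate_bounds:
  fixes \<phi> :: "'a::euclidean_space \<Rightarrow> real"
  assumes s: "0 < s" and \<phi>: "bdd_kernel \<phi>" and mom: "integrable lborel (\<lambda>y. \<bar>\<phi> y\<bar> * sqrt (norm y))"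
    and mod: "\<And>y. (\<integral>z. \<bar>\<phi> z - \<phi> (z - y)\<bar> \<partial>lborel) \<le> K * sqrt (norm y)"
  shows "bdd_kernel (dilate s \<phi>)"
    and "(\<integral>y. dilate s \<phi> y \<partial>lborel) = (\<integral>y. \<phi> y \<partial>lborel)"
    and "(\<integral>y. \<bar>dilate s \<phi> y\<bar> \<partial>lborel) = (\<integral>y. \<bar>\<phi> y\<bar> \<partial>lborel)"
    and "integrable lborel (\<lambda>y. \<bar>dilate s \<phi> y\<bar> * sqrt (norm y))"
    and "(\<integral>y. \<bar>dilate s \<phi> y\<bar> * sqrt (norm y) \<partial>lborel) = (\<integral>y. \<bar>\<phi> y\<bar> * sqrt (norm y) \<partial>lborel) / sqrt s"
    and "(\<integral>z. \<bar>dilate s \<phi> z - dilate s \<phi> (z - y)\<bar> \<partial>lborel) \<le> K * sqrt s * sqrt (norm y)"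
    and "fourier_kernel (dilate s \<phi>) \<xi> = fourier_kernel \<phi> (inverse s *\<^sub>R \<xi>)"
proof -
  note [measurable] = bdd_kernelD(2)[OF \<phi>]
  obtain A where A: "\<And>x. \<bar>\<phi> x\<bar> \<le> A" using bdd_kernel_bound[OF \<phi>] by blast
  have "\<bar>dilate s \<phi> x\<bar> \<le> s ^ DIM('a) * A" for x
    unfolding dilate_def using s A[of "s *\<^sub>R x"] by (simp add: abs_mult)
  then show "bdd_kernel (dilate s \<phi>)"
    unfolding bdd_kernel_def bounded_iff using dilate_integrable[OF s bdd_kernelD(1)[OF \<phi>]] by (auto simp: dilate_def[abs_def])
  show "(\<integral>y. dilate s \<phi> y \<partial>lborel) = (\<integral>y. \<phi> y \<partial>lborel)"
    using dilate_integral[OF s, of \<phi>] by (simp add: dilate_def[abs_def])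
  have ab: "\<bar>dilate s \<phi> y\<bar> = s ^ DIM('a) * \<bar>\<phi> (s *\<^sub>R y)\<bar>" for y using s by (simp add: dilate_def abs_mult)
  show "(\<integral>y. \<bar>dilate s \<phi> y\<bar> \<partial>lborel) = (\<integral>y. \<bar>\<phi> y\<bar> \<partial>lborel)"
    using dilate_integral[OF s, of "\<lambda>y. \<bar>\<phi> y\<bar>"] by (simp add: ab)
  have mo: "\<bar>dilate s \<phi> y\<bar> * sqrt (norm y) = s ^ DIM('a) *\<^sub>R (\<bar>\<phi> (s *\<^sub>R y)\<bar> * sqrt (norm (s *\<^sub>R y)) / sqrt s)" for y
    using s by (simp add: ab real_sqrt_mult)
  have i: "integrable lborel (\<lambda>y. \<bar>\<phi> y\<bar> * sqrt (norm y) / sqrt s)" using mom by simp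
  show "integrable lborel (\<lambda>y. \<bar>dilate s \<phi> y\<bar> * sqrt (norm y))"
    unfolding mo by (rule integrable_scaleR_right) (rule dilate_integrable[OF s i])
  show "(\<integral>y. \<bar>dilate s \<phi> y\<bar> * sqrt (norm y) \<partial>lborel) = (\<integral>y. \<bar>\<phi> y\<bar> * sqrt (norm y) \<partial>lborel) / sqrt s"
    unfolding mo by (subst dilate_integral[OF s]) auto
  have d: "\<bar>dilate s \<phi> z - dilate s \<phi> (z - y)\<bar> = s ^ DIM('a) *\<^sub>R \<bar>\<phi> (s *\<^sub>R z) - \<phi> (s *\<^sub>R z - s *\<^sub>R y)\<bar>" for z
    using s by (simp add: dilate_def right_diff_distrib[symmetric] abs_mult scaleR_diff_right)
  have "(\<integral>z. \<bar>dilate s \<phi> z - dilate s \<phi> (z - y)\<bar> \<partial>lborel) = (\<integral>z. \<bar>\<phi> z - \<phi> (z - s *\<^sub>R y)\<bar> \<partial>lborel)"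
    unfolding d by (rule dilate_integral[OF s, of "\<lambda>z. \<bar>\<phi> z - \<phi> (z - s *\<^sub>R y)\<bar>"]) measurable
  also have "\<dots> \<le> K * sqrt (norm (s *\<^sub>R y))" by (rule mod)
  finally show "(\<integral>z. \<bar>dilate s \<phi> z - dilate s \<phi> (z - y)\<bar> \<partial>lborel) \<le> K * sqrt s * sqrt (norm y)"
    using s by (simp add: real_sqrt_mult)
  have f: "exp (- (2 * of_real pi * \<i> * of_real (x \<bullet> \<xi>))) * complex_of_real (dilate s \<phi> x) =
     s ^ DIM('a) *\<^sub>R (exp (- (2 * of_real pi * \<i> * of_real ((s *\<^sub>R x) \<bullet> (inverse s *\<^sub>R \<xi>)))) * of_real (\<phi> (s *\<^sub>R x)))" for x
  proof -
    have "(s *\<^sub>R x) \<bullet> (inverse s *\<^sub>R \<xi>) = x \<bullet> \<xi>" using s by simp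
    then show ?thesis by (simp only: dilate_def scaleR_conv_of_real) (simp add: mult_ac)
  qed
  show "fourier_kernel (dilate s \<phi>) \<xi> = fourier_kernel \<phi> (inverse s *\<^sub>R \<xi>)"
    unfolding fourier_kernel_def f
    by (rule dilate_integral[OF s, of "\<lambda>x. exp (- (2 * of_real pi * \<i> * of_real (x \<bullet> (inverse s *\<^sub>R \<xi>)))) * of_real (\<phi> x)"]) measurable
qed

lemma smoothing_kernel_dilate:
  assumes "0 < s" "smoothing_kernel \<phi>"
  shows "smoothing_kernel (dilate s \<phi>)"
proof -
  obtain K where K: "\<And>y. (\<integral>z. \<bar>\<phi> z - \<phi> (z - y)\<bar> \<partial>lborel) \<le> K * sqrt (norm y)"
    and \<phi>: "bdd_kernel \<phi>" "integrable lborel (\<lambda>y. \<bar>\<phi> y\<bar> * sqrt (norm y))"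
    using assms by (auto simp: smoothing_kernel_def)
  show ?thesis using dilate_bounds(1,4,6)[OF assms(1) \<phi> K] unfolding smoothing_kernel_def by blast
qed

lemma fourier_kernel_vp_prod:
  "fourier_kernel vp_prod (\<xi>::'a::euclidean_space) =
     (\<Prod>b\<in>Basis. \<integral>t. exp (- (2 * of_real pi * \<i> * of_real (t * (\<xi> \<bullet> b)))) * of_real (vp_normalized t) \<partial>lborel)"
proof -
  have "exp (- (2 * of_real pi * \<i> * of_real (x \<bullet> \<xi>))) * of_real (vp_prod x) =
     (\<Prod>b\<in>Basis. exp (- (2 * of_real pi * \<i> * of_real ((x \<bullet> b) * (\<xi> \<bullet> b)))) * of_real (vp_normalized (x \<bullet> b)))" for x :: 'a
  proof -
    have "- (2 * of_real pi * \<i> * of_real (x \<bullet> \<xi>)) = (\<Sum>b\<in>Basis. - (2 * of_real pi * \<i> * complex_of_real ((x \<bullet> b) * (\<xi> \<bullet> b))))"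
      unfolding euclidean_inner[of x \<xi>] of_real_sum sum_distrib_left sum_negf ..
    then show ?thesis by (simp only: exp_sum[OF finite_Basis] vp_prod_def of_real_prod prod.distrib)
  qed
  then show ?thesis
    unfolding fourier_kernel_def using fourier_exp_integrable[of "\<lambda>t. complex_of_real (vp_normalized t)"] vp_normalized_integrable
    by (simp only:) (rule lborel_prod_Basis(2), simp)
qed

lemma fourier_kernel_vp_prod_eq_1:
  assumes "norm (\<xi>::'a::euclidean_space) \<le> 2"
  shows "fourier_kernel vp_prod \<xi> = 1"
  unfolding fourier_kernel_vp_prod
  by (rule prod.neutral, intro ballI vp_normalized_fourier_eq_1) (use assms Basis_le_norm[of _ \<xi>] in force)

text \<open>So long a vector has a coordinate of modulus at least 4, and a single vanishing factor
  suffices.\<close>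

lemma fourier_kernel_vp_prod_eq_0:
  assumes "4 * DIM('a) \<le> norm (\<xi>::'a::euclidean_space)"
  shows "fourier_kernel vp_prod \<xi> = 0"
proof -
  have "\<exists>b\<in>(Basis::'a set). 4 \<le> \<bar>\<xi> \<bullet> b\<bar>"
  proof (rule ccontr)
    assume "\<not> (\<exists>b\<in>(Basis::'a set). 4 \<le> \<bar>\<xi> \<bullet> b\<bar>)"
    then have lt: "\<bar>\<xi> \<bullet> b\<bar> < 4" if "b \<in> Basis" for b using that by (meson linorder_not_le)
    have "norm \<xi> \<le> (\<Sum>b\<in>Basis. \<bar>\<xi> \<bullet> b\<bar>)" by (rule norm_le_l1)
    also have "\<dots> < (\<Sum>b\<in>(Basis::'a set). 4)" using lt by (intro sum_strict_mono) auto
    finally show False using assms by simp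
  qed
  then obtain b :: 'a where b: "b \<in> Basis" "4 \<le> \<bar>\<xi> \<bullet> b\<bar>" by blast
  show ?thesis unfolding fourier_kernel_vp_prod
    by (rule prod_zero) (use b vp_normalized_fourier_eq_0 in auto)
qed

lemma fourier_kernel_0: "fourier_kernel \<phi> 0 = of_real (\<integral>x. \<phi> x \<partial>lborel)"
  by (simp add: fourier_kernel_def)

lemma fourier_kernel_diff:
  assumes "integrable lborel f" "integrable lborel g"
  shows "fourier_kernel (\<lambda>x. f x - g x) \<xi> = fourier_kernel f \<xi> - fourier_kernel g \<xi>"
  using fourier_exp_integrable[of "\<lambda>x. complex_of_real (f x)" \<xi>] fourier_exp_integrable[of "\<lambda>x. complex_of_real (g x)" \<xi>] assms
  by (simp add: fourier_kernel_def right_diff_distrib)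

text \<open>\<phi> is the difference of \<open>vp_prod\<close> and a wide dilate of it. Both
  transforms equal 1 at the origin, so the mean vanishes; on 1/2 \<le> |\<xi>| \<le> 2 the first is
  1 and the second is already 0.\<close>

theorem dyadic_kernels_exist:
  obtains \<psi> :: "int \<Rightarrow> 'a::euclidean_space \<Rightarrow> real" and K where
    "dyadic_kernels \<psi> K" "\<And>j y. \<psi> j (- y) = \<psi> j y"
    "\<And>j \<xi>. 2 powi (j - 1) \<le> norm \<xi> \<Longrightarrow> norm \<xi> \<le> 2 powi (j + 1) \<Longrightarrow> fourier_kernel (\<psi> j) \<xi> = 1"
proof -
  \<comment> \<open>For |\<xi>| \<ge> 1/2 the rescaled frequency \<xi> / r has norm at least 4 *
    DIM('a), which is the range of \<open>fourier_kernel_vp_prod_eq_0\<close>.\<close>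
  define r where "r = 1 / (8 * real DIM('a))"
  have r: "0 < r" by (simp add: r_def)
  define \<phi> :: "'a \<Rightarrow> real" where "\<phi> x = vp_prod x - dilate r vp_prod x" for x
  have sk: "smoothing_kernel \<phi>"
    unfolding \<phi>_def by (intro smoothing_kernel_diff smoothing_kernel_dilate smoothing_kernel_vp_prod r)
  obtain K where K: "\<And>y. (\<integral>z. \<bar>\<phi> z - \<phi> (z - y)\<bar> \<partial>lborel) \<le> K * sqrt (norm y)"
    and \<phi>: "bdd_kernel \<phi>" "integrable lborel (\<lambda>y. \<bar>\<phi> y\<bar> * sqrt (norm y))"
    using sk by (auto simp: smoothing_kernel_def)
  have iv: "integrable lborel (vp_prod :: 'a \<Rightarrow> real)" "integrable lborel (dilate r vp_prod :: 'a \<Rightarrow> real)"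
    using smoothing_kernel_vp_prod[where 'a='a] smoothing_kernel_dilate[OF r smoothing_kernel_vp_prod[where 'a='a]]
    by (auto simp: smoothing_kernel_def bdd_kernel_def)
  have dil: "fourier_kernel (dilate r vp_prod) \<xi> = fourier_kernel vp_prod (inverse r *\<^sub>R \<xi>)" for \<xi> :: 'a
    using smoothing_kernel_vp_prod[where 'a='a] dilate_bounds(7)[OF r] unfolding smoothing_kernel_def by blast
  have F: "fourier_kernel \<phi> \<xi> = fourier_kernel vp_prod \<xi> - fourier_kernel vp_prod (inverse r *\<^sub>R \<xi>)" for \<xi>
    unfolding \<phi>_def fourier_kernel_diff[OF iv] dil ..
  have "complex_of_real (\<integral>x. \<phi> x \<partial>lborel) = 0"
    unfolding fourier_kernel_0[symmetric] F by simp
  then have mean: "(\<integral>x. \<phi> x \<partial>lborel) = 0" by simp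
  have F1: "fourier_kernel \<phi> \<xi> = 1" if "1/2 \<le> norm \<xi>" "norm \<xi> \<le> 2" for \<xi>
  proof -
    have "4 * DIM('a) \<le> norm (inverse r *\<^sub>R \<xi>)" using that(1) r by (simp add: r_def field_simps)
    then show ?thesis unfolding F using that by (simp add: fourier_kernel_vp_prod_eq_1 fourier_kernel_vp_prod_eq_0)
  qed
  define K' where "K' = \<bar>K\<bar> + (\<integral>y. \<bar>\<phi> y\<bar> \<partial>lborel) + (\<integral>y. \<bar>\<phi> y\<bar> * sqrt (norm y) \<partial>lborel)"
  have n: "0 \<le> (\<integral>y. \<bar>\<phi> y\<bar> \<partial>lborel)" "0 \<le> (\<integral>y. \<bar>\<phi> y\<bar> * sqrt (norm y) \<partial>lborel)"
    by (auto intro!: integral_nonneg_AE AE_I2)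
  define \<psi> where "\<psi> j = dilate (2 powi j) \<phi>" for j :: int
  have s0: "0 < (2::real) powi j" for j by simp
  have sq: "sqrt (2 powi j) = sqrt 2 powi j" for j
    by (rule real_sqrt_unique) (simp_all add: power_int_mult_distrib[symmetric] power2_eq_square)
  note D = dilate_bounds[OF s0 \<phi> K]
  show ?thesis
  proof
    show "dyadic_kernels \<psi> K'"
    proof
      fix j y
      show "bdd_kernel (\<psi> j)" "(\<integral>y. \<psi> j y \<partial>lborel) = 0" "integrable lborel (\<lambda>y. \<bar>\<psi> j y\<bar> * sqrt (norm y))"
        using D(1,2,4) mean by (simp_all add: \<psi>_def)
      show "(\<integral>y. \<bar>\<psi> j y\<bar> \<partial>lborel) \<le> K'" using D(3) n by (simp add: \<psi>_def K'_def)
      show "(\<integral>y. \<bar>\<psi> j y\<bar> * sqrt (norm y) \<partial>lborel) \<le> K' / sqrt 2 powi j"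
        using D(5) n by (simp add: \<psi>_def K'_def sq divide_right_mono)
      have "(\<integral>z. \<bar>\<psi> j z - \<psi> j (z - y)\<bar> \<partial>lborel) \<le> K * sqrt 2 powi j * sqrt (norm y)"
        using D(6)[of j y] by (simp add: \<psi>_def sq)
      also have "\<dots> \<le> K' * sqrt 2 powi j * sqrt (norm y)"
      proof -
        have "K \<le> K'" using n unfolding K'_def by linarith
        then show ?thesis by (intro mult_right_mono) auto
      qed
      finally show "(\<integral>z. \<bar>\<psi> j z - \<psi> j (z - y)\<bar> \<partial>lborel) \<le> K' * sqrt 2 powi j * sqrt (norm y)" .
    qed
    show "\<psi> j (- y) = \<psi> j y" for j y
      by (simp add: \<psi>_def dilate_def \<phi>_def vp_prod_even)
    fix j and \<xi> :: 'a assume \<xi>: "2 powi (j - 1) \<le> norm \<xi>" "norm \<xi> \<le> 2 powi (j + 1)"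
    have "2 powi (j - 1) = (2::real) powi j / 2" "2 powi (j + 1) = (2::real) powi j * 2"
      by (simp_all add: power_int_diff power_int_add)
    then show "fourier_kernel (\<psi> j) \<xi> = 1"
      unfolding \<psi>_def D(7) using \<xi> s0[of j] by (intro F1) (simp_all add: field_simps)
  qed
qed

section \<open>Density of the Schwartz functions\<close>

lemma real_polynomial_function_derivative:
  fixes p :: "'a::real_normed_vector \<Rightarrow> real"
  assumes "real_polynomial_function p"
  shows "\<exists>D. (\<forall>x. (p has_derivative D x) (at x)) \<and> (\<forall>v. real_polynomial_function (\<lambda>x. D x v))"
  using assms
proof (induction p rule: real_polynomial_function.induct)
  case (linear f)
  then show ?case
    by (intro exI[of _ "\<lambda>x. f"]) (auto intro: bounded_linear_imp_has_derivative)
next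
  case (const c)
  then show ?case by (intro exI[of _ "\<lambda>x v. 0"]) auto
next
  case (add f g)
  then obtain F G where F: "\<And>x. (f has_derivative F x) (at x)" "\<And>v. real_polynomial_function (\<lambda>x. F x v)"
    and G: "\<And>x. (g has_derivative G x) (at x)" "\<And>v. real_polynomial_function (\<lambda>x. G x v)" by blast
  show ?case
    by (intro exI[of _ "\<lambda>x v. F x v + G x v"]) (use F G in \<open>auto intro!: has_derivative_add\<close>)
next
  case (mult f g)
  then obtain F G where F: "\<And>x. (f has_derivative F x) (at x)" "\<And>v. real_polynomial_function (\<lambda>x. F x v)"
    and G: "\<And>x. (g has_derivative G x) (at x)" "\<And>v. real_polynomial_function (\<lambda>x. G x v)" by blast
  show ?case
    by (intro exI[of _ "\<lambda>x v. f x * G x v + F x v * g x"])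
       (use F G mult.hyps in \<open>auto intro!: has_derivative_mult real_polynomial_function.intros(3,4)\<close>)
qed

lemma real_polynomial_function_growth:
  fixes p :: "'a::real_normed_vector \<Rightarrow> real"
  assumes "real_polynomial_function p"
  shows "\<exists>C k. 0 \<le> C \<and> (\<forall>x. \<bar>p x\<bar> \<le> C * (1 + norm x) ^ k)"
  using assms
proof (induction p rule: real_polynomial_function.induct)
  case (linear f)
  then obtain K where K: "\<And>x. norm (f x) \<le> norm x * K" "0 \<le> K" using bounded_linear.nonneg_bounded by blast
  have "\<bar>f x\<bar> \<le> K * (1 + norm x) ^ 1" for x
  proof -
    have "norm x * K \<le> K * (1 + norm x)" using K(2) by (simp add: algebra_simps)
    then show ?thesis using K(1)[of x] by simp
  qed
  then show ?case using K(2) by blast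
next
  case (const c)
  have "\<bar>c\<bar> \<le> \<bar>c\<bar> * (1 + norm x) ^ 0" for x :: 'a by simp
  then show ?case using abs_ge_zero by blast
next
  case (add f g)
  then obtain A k B m where A: "0 \<le> A" "\<And>x. \<bar>f x\<bar> \<le> A * (1 + norm x) ^ k"
    and B: "0 \<le> B" "\<And>x. \<bar>g x\<bar> \<le> B * (1 + norm x) ^ m" by blast
  have "\<bar>f x + g x\<bar> \<le> (A + B) * (1 + norm x) ^ (k + m)" for x
  proof -
    have "A * (1 + norm x) ^ k \<le> A * (1 + norm x) ^ (k + m)" "B * (1 + norm x) ^ m \<le> B * (1 + norm x) ^ (k + m)"
      using A B by (auto intro!: mult_left_mono power_increasing)
    then show ?thesis using A(2)[of x] B(2)[of x] by (simp add: distrib_right)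
  qed
  then show ?case using A(1) B(1) by (meson add_nonneg_nonneg)
next
  case (mult f g)
  then obtain A k B m where A: "0 \<le> A" "\<And>x. \<bar>f x\<bar> \<le> A * (1 + norm x) ^ k"
    and B: "0 \<le> B" "\<And>x. \<bar>g x\<bar> \<le> B * (1 + norm x) ^ m" by blast
  have "\<bar>f x * g x\<bar> \<le> (A * B) * (1 + norm x) ^ (k + m)" for x
  proof -
    have "\<bar>f x * g x\<bar> \<le> (A * (1 + norm x) ^ k) * (B * (1 + norm x) ^ m)"
      unfolding abs_mult using A B by (intro mult_mono) auto
    then show ?thesis by (simp add: power_add mult_ac)
  qed
  then show ?case using A(1) B(1) by (meson mult_nonneg_nonneg)
qed

text \<open>From \<open>(1 + x / k) ^ k \<le> exp x\<close> with x = a (1 + t), rescaled by (k /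
  a)^k.\<close>

lemma power_le_exp:
  fixes a :: real
  assumes a: "0 < a"
  shows "\<exists>C\<ge>0. \<forall>t\<ge>0. (1 + t) ^ k \<le> C * exp (a * t)"
proof (cases "k = 0")
  case True
  then show ?thesis using a by (intro exI[of _ 1]) auto
next
  case False
  have "(1 + t) ^ k \<le> ((k / a) ^ k * exp a) * exp (a * t)" if "0 \<le> t" for t
  proof -
    have "(a * (1 + t) / k) ^ k \<le> (1 + a * (1 + t) / k) ^ k"
      using a that by (intro power_mono) auto
    also have "\<dots> \<le> exp (a * (1 + t))"
    proof (rule exp_ge_one_plus_x_over_n_power_n)
      have "0 \<le> a * (1 + t)" using a that by simp
      then show "- real k \<le> a * (1 + t)" by linarith
    qed (use False in auto)
    finally have "(k / a) ^ k * (a * (1 + t) / k) ^ k \<le> (k / a) ^ k * exp (a * (1 + t))"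
      using a by (intro mult_left_mono) auto
    also have "(k / a) ^ k * (a * (1 + t) / k) ^ k = (1 + t) ^ k"
      unfolding power_mult_distrib[symmetric] using a False by simp
    also have "exp (a * (1 + t)) = exp a * exp (a * t)" by (simp add: distrib_left exp_add)
    finally show ?thesis by (simp add: mult.assoc)
  qed
  then show ?thesis using a by (intro exI[of _ "(k / a) ^ k * exp a"]) auto
qed

lemma frechet_derivative_eqI: "(f has_derivative D) (at x) \<Longrightarrow> frechet_derivative f (at x) = D"
  by (rule frechet_derivative_at[symmetric])

lemma has_derivative_of_real_exp:
  fixes q P :: "'a::real_normed_vector \<Rightarrow> real"
  assumes "(q has_derivative Dq) (at x)" "(P has_derivative DP) (at x)"
  shows "((\<lambda>x. complex_of_real (q x * exp (- P x))) has_derivative (\<lambda>v. of_real ((Dq v - q x * DP v) * exp (- P x)))) (at x)"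
proof -
  have "((\<lambda>x. q x * exp (- P x)) has_derivative (\<lambda>v. q x * (exp (- P x) * - DP v) + Dq v * exp (- P x))) (at x)"
    by (auto intro!: derivative_eq_intros assms simp: algebra_simps)
  then have "((\<lambda>x. complex_of_real (q x * exp (- P x))) has_derivative (\<lambda>v. of_real (q x * (exp (- P x) * - DP v) + Dq v * exp (- P x)))) (at x)"
    by (rule has_derivative_of_real)
  then show ?thesis by (simp add: algebra_simps)
qed

text \<open>The functions \<open>q exp(-P)\<close> with \<open>q\<close> ranging over the polynomials are closed under partial derivatives.\<close>

lemma poly_exp_schwartz:
  fixes q P :: "real^'n \<Rightarrow> real"
  assumes q: "real_polynomial_function q" and P: "real_polynomial_function P"
    and coercive: "0 < a" "\<And>x. a * norm x - b \<le> P x"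
  shows "(\<lambda>x. complex_of_real (q x * exp (- P x))) \<in> schwartz"
proof -
  have bdd: "bounded (range (\<lambda>x. norm x ^ k *\<^sub>R complex_of_real (q x * exp (- P x))))"
    if q: "real_polynomial_function q" for q :: "real^'n \<Rightarrow> real" and k :: nat
  proof -
    obtain C m where C: "0 \<le> C" "\<And>x. \<bar>q x\<bar> \<le> C * (1 + norm x) ^ m"
      using real_polynomial_function_growth[OF q] by blast
    obtain B where B: "0 \<le> B" "\<And>t. 0 \<le> t \<Longrightarrow> (1 + t) ^ (k + m) \<le> B * exp (a * t)"
      using power_le_exp[OF coercive(1)] by meson
    have "norm (norm x ^ k *\<^sub>R complex_of_real (q x * exp (- P x))) \<le> C * B * exp b" for x
    proof -
      have "norm (norm x ^ k *\<^sub>R complex_of_real (q x * exp (- P x))) = norm x ^ k * \<bar>q x\<bar> * exp (- P x)"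
        by (simp add: norm_mult abs_mult)
      also have "\<dots> \<le> (1 + norm x) ^ k * (C * (1 + norm x) ^ m) * exp (b - a * norm x)"
        using C coercive(2)[of x] by (intro mult_mono power_mono) auto
      also have "\<dots> = C * (1 + norm x) ^ (k + m) * exp (b - a * norm x)" by (simp add: power_add mult_ac)
      also have "\<dots> \<le> C * (B * exp (a * norm x)) * exp (b - a * norm x)"
        using B C(1) by (intro mult_right_mono mult_left_mono) auto
      also have "\<dots> = C * B * exp b" by (simp add: exp_diff)
      finally show ?thesis .
    qed
    then show ?thesis unfolding bounded_iff by blast
  qed
  obtain DP where DP: "\<And>x. (P has_derivative DP x) (at x)" "\<And>v. real_polynomial_function (\<lambda>x. DP x v)"
    using real_polynomial_function_derivative[OF P] by blast
  have "fold partial_deriv is (\<lambda>x. complex_of_real (q x * exp (- P x))) differentiable_on UNIV \<and>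
     (\<forall>k::nat. bounded (range (\<lambda>x. norm x ^ k *\<^sub>R fold partial_deriv is (\<lambda>x. complex_of_real (q x * exp (- P x))) x)))" for "is"
    using q
  proof (induction "is" arbitrary: q)
    case (Nil q)
    obtain Dq where Dq: "\<And>x. (q has_derivative Dq x) (at x)"
      using real_polynomial_function_derivative[OF Nil] by blast
    have "(\<lambda>x. complex_of_real (q x * exp (- P x))) differentiable_on UNIV"
      using has_derivative_of_real_exp[OF Dq DP(1)] unfolding differentiable_on_def differentiable_def by blast
    then show ?case using bdd[OF Nil] by simp
  next
    case (Cons i "is" q)
    obtain Dq where Dq: "\<And>x. (q has_derivative Dq x) (at x)" "\<And>v. real_polynomial_function (\<lambda>x. Dq x v)"
      using real_polynomial_function_derivative[OF Cons.prems] by blast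
    have eq: "partial_deriv i (\<lambda>x. complex_of_real (q x * exp (- P x))) =
        (\<lambda>x. complex_of_real ((Dq x (axis i 1) - q x * DP x (axis i 1)) * exp (- P x)))"
      unfolding partial_deriv_def frechet_derivative_eqI[OF has_derivative_of_real_exp[OF Dq(1) DP(1)]] ..
    have poly: "real_polynomial_function (\<lambda>x. Dq x (axis i 1) - q x * DP x (axis i 1))"
      using Dq(2) DP(2) Cons.prems by (intro real_polynomial_function_diff real_polynomial_function.intros(4))
    show ?case unfolding fold_simps(2) eq by (rule Cons.IH[OF poly])
  qed
  then show ?thesis unfolding schwartz_def by blast
qed

lemma schwartzD:
  assumes "f \<in> schwartz"
  shows "f differentiable_on UNIV" "bounded (range (\<lambda>x. norm x ^ k *\<^sub>R f x))" "partial_deriv i f \<in> schwartz"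
proof -
  have *: "fold partial_deriv ds f differentiable_on UNIV" "bounded (range (\<lambda>x. norm x ^ k *\<^sub>R fold partial_deriv ds f x))" for ds k
    using assms by (auto simp: schwartz_def)
  show "f differentiable_on UNIV" "bounded (range (\<lambda>x. norm x ^ k *\<^sub>R f x))"
    using *[where ds = "[]"] by auto
  show "partial_deriv i f \<in> schwartz"
    unfolding schwartz_def using *[where ds = "i # ds" for ds] by simp
qed

lemma schwartz_lincomb:
  assumes "f \<in> schwartz" "g \<in> schwartz"
  shows "(\<lambda>x. a * f x + b * g x) \<in> schwartz"
proof -
  have "fold partial_deriv is (\<lambda>x. a * f x + b * g x) differentiable_on UNIV \<and>
     (\<forall>k::nat. bounded (range (\<lambda>x. norm x ^ k *\<^sub>R fold partial_deriv is (\<lambda>x. a * f x + b * g x) x)))" for "is"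
    using assms
  proof (induction "is" arbitrary: f g)
    case (Nil f g)
    have "bounded (range (\<lambda>x. norm x ^ k *\<^sub>R (a * f x + b * g x)))" for k
    proof -
      obtain A B where A: "\<And>x. norm (norm x ^ k *\<^sub>R f x) \<le> A" and B: "\<And>x. norm (norm x ^ k *\<^sub>R g x) \<le> B"
        using schwartzD(2)[OF Nil(1), of k] schwartzD(2)[OF Nil(2), of k] unfolding bounded_iff by auto
      have "norm (norm x ^ k *\<^sub>R (a * f x + b * g x)) \<le> norm a * A + norm b * B" for x
      proof -
        have "norm x ^ k *\<^sub>R (a * f x + b * g x) = a * (norm x ^ k *\<^sub>R f x) + b * (norm x ^ k *\<^sub>R g x)"
          by (simp add: algebra_simps)
        also have "norm \<dots> \<le> norm a * norm (norm x ^ k *\<^sub>R f x) + norm b * norm (norm x ^ k *\<^sub>R g x)"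
          by (rule order_trans[OF norm_triangle_ineq]) (simp add: norm_mult)
        also have "\<dots> \<le> norm a * A + norm b * B" using A B by (intro add_mono mult_left_mono) auto
        finally show ?thesis .
      qed
      then show ?thesis unfolding bounded_iff by blast
    qed
    moreover have "(\<lambda>x. a * f x + b * g x) differentiable_on UNIV"
      using schwartzD(1)[OF Nil(1)] schwartzD(1)[OF Nil(2)]
      by (intro differentiable_on_add differentiable_on_mult) auto
    ultimately show ?case by simp
  next
    case (Cons i "is" f g)
    have d: "(f has_derivative frechet_derivative f (at x)) (at x)" "(g has_derivative frechet_derivative g (at x)) (at x)" for x
      using schwartzD(1)[OF Cons.prems(1)] schwartzD(1)[OF Cons.prems(2)]
      by (auto simp: differentiable_on_def frechet_derivative_works)
    have "((\<lambda>x. a * f x + b * g x) has_derivative (\<lambda>v. a * frechet_derivative f (at x) v + b * frechet_derivative g (at x) v)) (at x)" for x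
      using d by (intro has_derivative_add has_derivative_mult_right)
    then have "frechet_derivative (\<lambda>x. a * f x + b * g x) (at x) = (\<lambda>v. a * frechet_derivative f (at x) v + b * frechet_derivative g (at x) v)" for x
      by (rule frechet_derivative_eqI)
    then have "partial_deriv i (\<lambda>x. a * f x + b * g x) = (\<lambda>x. a * partial_deriv i f x + b * partial_deriv i g x)"
      by (simp add: partial_deriv_def)
    then show ?case using Cons.IH[OF schwartzD(3)[OF Cons.prems(1)] schwartzD(3)[OF Cons.prems(2)]] by simp
  qed
  then show ?thesis unfolding schwartz_def by blast
qed

lemma schwartz_diff: "f \<in> schwartz \<Longrightarrow> g \<in> schwartz \<Longrightarrow> (\<lambda>x. f x - g x) \<in> schwartz"
  using schwartz_lincomb[of f g 1 "-1"] by simp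

lemma schwartz_measurable: "f \<in> schwartz \<Longrightarrow> f \<in> borel_measurable borel"
  by (intro borel_measurable_continuous_onI differentiable_imp_continuous_on schwartzD(1))

text \<open>The product of the factors 1 + x_b^2 is at most (1 + |x|^2)^n \<le> 2^n (1 + |x|^(2 n)),
  so boundedness of f and of |x|^(2 n) f is all that enters.\<close>

lemma schwartz_decay:
  fixes f :: "real^'n \<Rightarrow> complex"
  assumes "f \<in> schwartz"
  obtains C where "0 \<le> C" "\<And>x. norm (f x) \<le> C * prod_weight x"
proof -
  define n where "n = CARD('n)"
  obtain A B where A: "\<And>x. norm (norm x ^ 0 *\<^sub>R f x) \<le> A" and B: "\<And>x. norm (norm x ^ (2 * n) *\<^sub>R f x) \<le> B"
    using schwartzD(2)[OF assms, of 0] schwartzD(2)[OF assms, of "2 * n"] unfolding bounded_iff by auto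
  have A: "norm (f x) \<le> A" for x using A[of x] by simp
  have B: "norm x ^ (2 * n) * norm (f x) \<le> B" for x using B[of x] by simp
  have A0: "0 \<le> A" using A[of 0] norm_ge_zero order_trans by blast
  have B0: "0 \<le> B" using B[of 0] by (meson mult_nonneg_nonneg norm_ge_zero order_trans zero_le_power)
  have "norm (f x) \<le> (2 ^ n * (A + B)) * prod_weight x" for x
  proof -
    define W where "W = (\<Prod>b\<in>Basis. 1 + (x \<bullet> b)\<^sup>2)"
    have W: "prod_weight x = 1 / W" "0 < W"
      unfolding prod_weight_def W_def by (auto simp: prod_dividef intro!: prod_pos add_pos_nonneg)
    have "W \<le> (\<Prod>b\<in>(Basis::(real^'n) set). 1 + (norm x)\<^sup>2)"
      unfolding W_def by (intro prod_mono) (auto simp: abs_le_square_iff[symmetric] Basis_le_norm)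
    also have "\<dots> = (1 + (norm x)\<^sup>2) ^ n" by (simp add: n_def)
    also have "\<dots> \<le> (2 * max 1 ((norm x)\<^sup>2)) ^ n" by (intro power_mono) auto
    also have "\<dots> = 2 ^ n * (max 1 ((norm x)\<^sup>2)) ^ n" by (rule power_mult_distrib)
    also have "\<dots> \<le> 2 ^ n * (1 + norm x ^ (2 * n))"
    proof -
      have "(max 1 ((norm x)\<^sup>2)) ^ n \<le> 1 + norm x ^ (2 * n)"
        by (cases "1 \<le> (norm x)\<^sup>2") (auto simp: max_def power_mult)
      then show ?thesis by (intro mult_left_mono) auto
    qed
    finally have "norm (f x) * W \<le> norm (f x) * (2 ^ n * (1 + norm x ^ (2 * n)))" by (intro mult_left_mono) auto
    also have "\<dots> = 2 ^ n * (norm (f x) + norm x ^ (2 * n) * norm (f x))" by (simp add: algebra_simps)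
    also have "\<dots> \<le> 2 ^ n * (A + B)" using A[of x] B[of x] by (intro mult_left_mono add_mono) auto
    finally show ?thesis using W by (simp add: pos_le_divide_eq)
  qed
  moreover have "0 \<le> 2 ^ n * (A + B)" using A0 B0 by simp
  ultimately show thesis using that by blast
qed

lemma schwartz_lp:
  fixes f :: "real^'n \<Rightarrow> complex"
  assumes f: "f \<in> schwartz" and p: "1 \<le> p"
  shows "f \<in> lp_space lborel p"
proof -
  have [measurable]: "f \<in> borel_measurable borel" by (rule schwartz_measurable[OF f])
  obtain C where C: "0 \<le> C" "\<And>x. norm (f x) \<le> C * prod_weight x" using schwartz_decay[OF f] by blast
  have "integrable lborel (\<lambda>x. norm (f x) powr p)"
  proof (rule Bochner_Integration.integrable_bound[OF integrable_mult_right[OF prod_weight_integrable, of "C powr p"]])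
    show "AE x in lborel. norm (norm (f x) powr p) \<le> norm (C powr p * prod_weight x)"
    proof (rule AE_I2)
      fix x
      have "norm (f x) powr p \<le> (C * prod_weight x) powr p" using C(2) p by (intro powr_mono2) auto
      also have "\<dots> = C powr p * prod_weight x powr p" by (rule powr_mult)
      also have "\<dots> \<le> C powr p * prod_weight x powr 1"
        using p prod_weight_nonneg[of x] prod_weight_le_1[of x] by (intro mult_left_mono powr_mono') auto
      finally show "norm (norm (f x) powr p) \<le> norm (C powr p * prod_weight x)"
        using prod_weight_nonneg[of x] by (simp add: abs_mult)
    qed
  qed auto
  then show ?thesis by (simp add: lp_space_def)
qed

section \<open>Simultaneous approximation in L^1 and L^p\<close>

lemma lp_dominated_convergence:
  assumes p: "1 \<le> p" and w: "w \<in> lp_space M p" and [measurable]: "\<And>k. f k \<in> borel_measurable M" "g \<in> borel_measurable M"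
    and dom: "\<And>k x. norm (f k x) \<le> norm (w x)" and lim: "\<And>x. (\<lambda>k. f k x) \<longlonglongrightarrow> g x"
  shows "(\<lambda>k. lp_norm M p (\<lambda>x. f k x - g x)) \<longlonglongrightarrow> 0"
proof -
  have [measurable]: "w \<in> borel_measurable M" by (rule lp_space_measurable[OF w])
  have g: "norm (g x) \<le> norm (w x)" for x
    by (rule Lim_bounded[OF tendsto_norm[OF lim]]) (use dom in auto)
  have "(\<lambda>k. \<integral>x. norm (f k x - g x) powr p \<partial>M) \<longlonglongrightarrow> (\<integral>x. 0 \<partial>M)"
  proof (rule integral_dominated_convergence[where w = "\<lambda>x. 2 powr p * norm (w x) powr p"])
    show "integrable M (\<lambda>x. 2 powr p * norm (w x) powr p)" using lp_space_integrable[OF w] by simp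
    show "AE x in M. (\<lambda>k. norm (f k x - g x) powr p) \<longlonglongrightarrow> 0"
    proof (rule AE_I2)
      fix x
      have "(\<lambda>k. f k x - g x) \<longlonglongrightarrow> g x - g x" by (intro tendsto_diff lim tendsto_const)
      then have "(\<lambda>k. norm (f k x - g x)) \<longlonglongrightarrow> 0" by (simp add: tendsto_norm_zero)
      then have "(\<lambda>k. norm (f k x - g x) powr p) \<longlonglongrightarrow> 0 powr p"
        using p by (intro tendsto_powr') auto
      then show "(\<lambda>k. norm (f k x - g x) powr p) \<longlonglongrightarrow> 0" by simp
    qed
    show "AE x in M. norm (norm (f k x - g x) powr p) \<le> 2 powr p * norm (w x) powr p" for k
    proof (rule AE_I2)
      fix x
      have "norm (f k x - g x) \<le> 2 * norm (w x)"
        using norm_triangle_ineq4[of "f k x" "g x"] dom[of k x] g[of x] by linarith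
      then have "norm (f k x - g x) powr p \<le> (2 * norm (w x)) powr p" using p by (intro powr_mono2) auto
      then show "norm (norm (f k x - g x) powr p) \<le> 2 powr p * norm (w x) powr p" by (simp add: powr_mult)
    qed
  qed auto
  then have "(\<lambda>k. (\<integral>x. norm (f k x - g x) powr p \<partial>M) powr (1 / p)) \<longlonglongrightarrow> (\<integral>x. 0 \<partial>M) powr (1 / p)"
    using p by (intro tendsto_powr') auto
  then show ?thesis by (simp add: lp_norm_def)
qed

text \<open>Both norms are approximated by the same function: L^1 convergence makes the images under
  a multiplier converge pointwise, while L^p convergence preserves the operator bound.\<close>

definition schwartz_approx :: "real \<Rightarrow> (real^'n \<Rightarrow> complex) \<Rightarrow> bool" where
  "schwartz_approx p f \<longleftrightarrow> f \<in> lp_space lborel 1 \<and> f \<in> lp_space lborel p \<and>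
     (\<forall>e>0. \<exists>g\<in>schwartz. lp_norm lborel 1 (\<lambda>x. g x - f x) < e \<and> lp_norm lborel p (\<lambda>x. g x - f x) < e)"

lemma schwartz_approx_schwartz: "1 \<le> p \<Longrightarrow> f \<in> schwartz \<Longrightarrow> schwartz_approx p f"
  unfolding schwartz_approx_def by (auto intro!: schwartz_lp bexI[of _ f])

lemma schwartz_approx_lincomb:
  assumes p: "1 \<le> p" and f: "schwartz_approx p f" and g: "schwartz_approx p g"
  shows "schwartz_approx p (\<lambda>x. a * f x + b * g x)"
  unfolding schwartz_approx_def
proof (intro conjI allI impI)
  have F: "f \<in> lp_space lborel 1" "f \<in> lp_space lborel p" and G: "g \<in> lp_space lborel 1" "g \<in> lp_space lborel p"
    using f g by (auto simp: schwartz_approx_def)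
  have p0: "0 < p" using p by simp
  show "(\<lambda>x. a * f x + b * g x) \<in> lp_space lborel 1" "(\<lambda>x. a * f x + b * g x) \<in> lp_space lborel p"
    using F G p by (intro lp_add(1) lp_mult(1); simp)+
  fix e :: real assume e: "0 < e"
  define d where "d = e / (norm a + norm b + 1)"
  have N: "0 < norm a + norm b + 1" by (simp add: add_nonneg_pos)
  have d: "0 < d" using e N by (simp add: d_def)
  have de: "norm a * d + norm b * d < e"
  proof -
    have "(norm a + norm b) * d < (norm a + norm b + 1) * d" using d by simp
    also have "\<dots> = e" using N by (simp add: d_def)
    finally show ?thesis by (simp add: distrib_right)
  qed
  obtain u v where u: "u \<in> schwartz" "lp_norm lborel 1 (\<lambda>x. u x - f x) < d" "lp_norm lborel p (\<lambda>x. u x - f x) < d"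
    and v: "v \<in> schwartz" "lp_norm lborel 1 (\<lambda>x. v x - g x) < d" "lp_norm lborel p (\<lambda>x. v x - g x) < d"
    using f[unfolded schwartz_approx_def, THEN conjunct2, THEN conjunct2, rule_format, OF d]
      g[unfolded schwartz_approx_def, THEN conjunct2, THEN conjunct2, rule_format, OF d] by blast
  have est: "lp_norm lborel r (\<lambda>x. (a * u x + b * v x) - (a * f x + b * g x)) < e"
    if r: "1 \<le> r" and "f \<in> lp_space lborel r" "g \<in> lp_space lborel r"
      "lp_norm lborel r (\<lambda>x. u x - f x) < d" "lp_norm lborel r (\<lambda>x. v x - g x) < d" for r
  proof -
    have r0: "0 < r" using r by simp
    have 1: "(\<lambda>x. u x - f x) \<in> lp_space lborel r" "(\<lambda>x. v x - g x) \<in> lp_space lborel r"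
      using lp_diff(1)[OF r schwartz_lp[OF u(1) r] that(2)] lp_diff(1)[OF r schwartz_lp[OF v(1) r] that(3)] by auto
    have "lp_norm lborel r (\<lambda>x. a * (u x - f x) + b * (v x - g x)) \<le> norm a * lp_norm lborel r (\<lambda>x. u x - f x) + norm b * lp_norm lborel r (\<lambda>x. v x - g x)"
      using lp_add(2)[OF r lp_mult(1)[OF r0 1(1), of a] lp_mult(1)[OF r0 1(2), of b]]
      by (simp add: lp_mult(2)[OF r0 1(1)] lp_mult(2)[OF r0 1(2)])
    also have "\<dots> \<le> norm a * d + norm b * d" using that by (intro add_mono mult_left_mono) auto
    finally show ?thesis using de by (simp add: algebra_simps)
  qed
  show "\<exists>g'\<in>schwartz. lp_norm lborel 1 (\<lambda>x. g' x - (a * f x + b * g x)) < e \<and> lp_norm lborel p (\<lambda>x. g' x - (a * f x + b * g x)) < e"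
    using schwartz_lincomb[OF u(1) v(1), of a b] est[OF _ F(1) G(1) u(2) v(2)] est[OF p F(2) G(2) u(3) v(3)]
    by (intro bexI[of _ "\<lambda>x. a * u x + b * v x"]) auto
qed

text \<open>An instance of \<open>poly_exp_schwartz\<close> with polynomial factor 0; coercivity of
  the sum of squares comes from |t| \<le> t^2 + 1.\<close>

lemma schwartz_zero: "(\<lambda>x::real^'n. 0) \<in> schwartz"
proof -
  have "norm x \<le> (\<Sum>i\<in>UNIV. (x $ i)\<^sup>2) + real CARD('n)" for x :: "real^'n"
  proof -
    have "\<bar>x $ i\<bar> \<le> (x $ i)\<^sup>2 + 1" for i
    proof -
      have "0 \<le> (\<bar>x $ i\<bar> - 1)\<^sup>2" by simp
      then have "2 * \<bar>x $ i\<bar> \<le> (x $ i)\<^sup>2 + 1" by (simp add: power2_diff)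
      then show ?thesis by linarith
    qed
    then have "(\<Sum>i\<in>UNIV. \<bar>x $ i\<bar>) \<le> (\<Sum>i\<in>UNIV. (x $ i)\<^sup>2 + 1)" by (rule sum_mono)
    then show ?thesis using norm_le_l1_cart[of x] by (simp add: sum.distrib)
  qed
  then have "1 * norm x - real CARD('n) \<le> (\<Sum>i\<in>UNIV. (x $ i)\<^sup>2)" for x :: "real^'n" by (simp add: algebra_simps)
  moreover have "real_polynomial_function (\<lambda>x::real^'n. \<Sum>i\<in>UNIV. (x $ i)\<^sup>2)"
    by (intro real_polynomial_function_sum real_polynomial_function_power real_polynomial_function.intros(1) bounded_linear_vec_nth) auto
  ultimately show ?thesis
    using poly_exp_schwartz[of "\<lambda>x. 0" "\<lambda>x. \<Sum>i\<in>UNIV. (x $ i)\<^sup>2" 1] real_polynomial_function.intros(2) by force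
qed

lemma schwartz_approx_zero: "1 \<le> p \<Longrightarrow> schwartz_approx p (\<lambda>x. 0)"
  by (intro schwartz_approx_schwartz schwartz_zero)

text \<open>Closure under dominated pointwise limits carries the approximation from Gaussian-like
  functions to boxes, Borel sets and finally arbitrary functions; each stage only has to supply a
  majorant lying in both spaces.\<close>

lemma schwartz_approx_dominated:
  fixes f :: "nat \<Rightarrow> real^'n \<Rightarrow> complex" and w :: "real^'n \<Rightarrow> 'b::{banach,second_countable_topology}"
  assumes p: "1 \<le> p" and w: "w \<in> lp_space lborel 1" "w \<in> lp_space lborel p"
    and f: "\<And>k. schwartz_approx p (f k)"
    and dom: "\<And>k x. norm (f k x) \<le> norm (w x)" and lim: "\<And>x. (\<lambda>k. f k x) \<longlonglongrightarrow> g x"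
  shows "schwartz_approx p g"
proof -
  have F: "f k \<in> lp_space lborel 1" "f k \<in> lp_space lborel p" for k
    using f[of k] by (auto simp: schwartz_approx_def)
  note [measurable] = lp_space_measurable[OF F(1)]
  have [measurable]: "g \<in> borel_measurable lborel" by (rule borel_measurable_LIMSEQ_metric[OF _ lim]) auto
  have g: "norm (g x) \<le> norm (w x)" for x
    by (rule Lim_bounded[OF tendsto_norm[OF lim]]) (use dom in auto)
  have G: "g \<in> lp_space lborel 1" "g \<in> lp_space lborel p"
    using lp_norm_mono(1)[OF _ w(1), of g] lp_norm_mono(1)[OF _ w(2), of g] p g by auto
  have l1: "(\<lambda>k. lp_norm lborel 1 (\<lambda>x. f k x - g x)) \<longlonglongrightarrow> 0"
    by (rule lp_dominated_convergence[OF _ w(1) _ _ dom lim]) auto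
  have lp: "(\<lambda>k. lp_norm lborel p (\<lambda>x. f k x - g x)) \<longlonglongrightarrow> 0"
    by (rule lp_dominated_convergence[OF p w(2) _ _ dom lim]) auto
  show ?thesis
    unfolding schwartz_approx_def
  proof (intro conjI G allI impI)
    fix e :: real assume e: "0 < e"
    have "\<forall>\<^sub>F k in sequentially. lp_norm lborel 1 (\<lambda>x. f k x - g x) < e / 2 \<and> lp_norm lborel p (\<lambda>x. f k x - g x) < e / 2"
      using order_tendstoD(2)[OF l1, of "e/2"] order_tendstoD(2)[OF lp, of "e/2"] e by (auto intro: eventually_conj)
    then obtain k where k: "lp_norm lborel 1 (\<lambda>x. f k x - g x) < e / 2" "lp_norm lborel p (\<lambda>x. f k x - g x) < e / 2"
      using eventually_happens'[OF sequentially_bot] by blast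
    obtain u where u: "u \<in> schwartz" "lp_norm lborel 1 (\<lambda>x. u x - f k x) < e / 2" "lp_norm lborel p (\<lambda>x. u x - f k x) < e / 2"
      using f[of k, unfolded schwartz_approx_def, THEN conjunct2, THEN conjunct2, rule_format, of "e/2"] e by auto
    have "lp_norm lborel 1 (\<lambda>x. u x - g x) < e"
      using lp_norm_triangle3[OF order_refl schwartz_lp[OF u(1) order_refl] F(1)[of k] G(1)] k(1) u(2) by linarith
    moreover have "lp_norm lborel p (\<lambda>x. u x - g x) < e"
      using lp_norm_triangle3[OF p schwartz_lp[OF u(1) p] F(2)[of k] G(2)] k(2) u(3) by linarith
    ultimately show "\<exists>u\<in>schwartz. lp_norm lborel 1 (\<lambda>x. u x - g x) < e \<and> lp_norm lborel p (\<lambda>x. u x - g x) < e"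
      using u(1) by blast
  qed
qed

text \<open>As \<open>k\<close> grows, \<open>exp (- (k + 1) t ^ (2 k + 2))\<close> tends to 1 for \<open>|t| < 1\<close> and to 0 for \<open>|t| \<ge> 1\<close>,
  so products of such functions approximate the indicator functions of open boxes.\<close>

lemma schwartz_approx_box:
  fixes a b :: "real^'n"
  assumes p: "1 \<le> p"
  shows "schwartz_approx p (\<lambda>x. of_real (indicator (box a b) x))"
proof (cases "box a b = {}")
  case True
  then show ?thesis using schwartz_approx_zero[OF p] by simp
next
  case False
  then have ab: "a $ i < b $ i" for i
    by (metis ex_in_conv less_trans mem_box_cart(1))
  define w where "w i = (b $ i - a $ i) / 2" for i
  define c where "c i = (a $ i + b $ i) / 2" for i
  define t where "t i x = (x $ i - c i) / w i" for i and x :: "real^'n"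
  have w: "0 < w i" for i using ab[of i] by (simp add: w_def)
  have box: "x \<in> box a b \<longleftrightarrow> (\<forall>i. \<bar>t i x\<bar> < 1)" for x
  proof -
    have "\<bar>t i x\<bar> < 1 \<longleftrightarrow> a $ i < x $ i \<and> x $ i < b $ i" for i
    proof -
      have "\<bar>t i x\<bar> < 1 \<longleftrightarrow> \<bar>x $ i - c i\<bar> < w i" using w[of i] by (simp add: t_def)
      also have "\<dots> \<longleftrightarrow> a $ i < x $ i \<and> x $ i < b $ i" by (auto simp: c_def w_def abs_less_iff field_simps)
      finally show ?thesis .
    qed
    then show ?thesis by (simp add: mem_box_cart)
  qed
  \<comment> \<open>The factor \<open>Suc k\<close> makes the limit 0 also on the boundary |t| = 1,
    where the powers alone would stay equal to 1.\<close>
  define P where "P k x = (\<Sum>i\<in>UNIV. real (Suc k) * t i x ^ (2 * Suc k))" for k x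
  define f where "f k x = complex_of_real (1 * exp (- P k x))" for k x
  have tpoly: "real_polynomial_function (t i)" for i
    unfolding t_def
    by (intro real_polynomial_function_divide real_polynomial_function_diff real_polynomial_function.intros(1,2) bounded_linear_vec_nth)
  have Ppoly: "real_polynomial_function (P k)" for k
    unfolding P_def by (intro real_polynomial_function_sum real_polynomial_function.intros(2,4) real_polynomial_function_power tpoly) auto
  \<comment> \<open>A lower bound uniform in k, comparing with the quadratic case. It provides both
    the coercivity of all P k and a common majorant.\<close>
  have pt: "s\<^sup>2 - 1 \<le> real (Suc k) * s ^ (2 * Suc k)" for k and s :: real
  proof (cases "1 \<le> s\<^sup>2")
    case True
    define X where "X = s ^ (2 * Suc k)"
    have "0 \<le> X" unfolding X_def power_mult by simp
    then have "1 * X \<le> real (Suc k) * X" by (intro mult_right_mono) auto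
    have "s\<^sup>2 \<le> (s\<^sup>2) ^ Suc k" using True by (rule self_le_power) simp
    also have "\<dots> = s ^ (2 * Suc k)" by (rule power_mult[symmetric])
    finally show ?thesis using \<open>1 * X \<le> _\<close> unfolding X_def by linarith
  next
    case False
    moreover have "0 \<le> s ^ (2 * Suc k)" unfolding power_mult by simp
    then have "0 \<le> real (Suc k) * s ^ (2 * Suc k)" by simp
    ultimately show ?thesis by linarith
  qed
  have PP: "P 0 x - real CARD('n) \<le> P k x" for k x
  proof -
    have "P 0 x - real CARD('n) = (\<Sum>i\<in>UNIV. (t i x)\<^sup>2 - 1)" by (simp add: P_def sum_subtractf)
    also have "\<dots> \<le> P k x" unfolding P_def by (intro sum_mono pt)
    finally show ?thesis .
  qed
  define W where "W = (\<Sum>i\<in>UNIV. w i)"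
  have wW: "w i \<le> W" for i unfolding W_def by (rule member_le_sum) (use w in \<open>auto simp: less_imp_le\<close>)
  have W: "0 < W" using w[of undefined] wW[of undefined] by linarith
  have coer: "1 / W * norm x - ((\<Sum>i\<in>UNIV. \<bar>c i\<bar>) / W + 2 * real CARD('n)) \<le> P k x" for x k
  proof -
    have "(\<bar>x $ i\<bar> - \<bar>c i\<bar>) / W \<le> (t i x)\<^sup>2 + 1" for i
    proof -
      have "(\<bar>x $ i\<bar> - \<bar>c i\<bar>) / W \<le> \<bar>x $ i - c i\<bar> / W" using W by (intro divide_right_mono) auto
      also have "\<dots> \<le> \<bar>x $ i - c i\<bar> / w i" using W w[of i] wW[of i] by (intro divide_left_mono) auto
      also have "\<dots> = \<bar>t i x\<bar>" using w[of i] by (simp add: t_def)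
      also have "\<dots> \<le> (t i x)\<^sup>2 + 1"
      proof -
        have "0 \<le> (\<bar>t i x\<bar> - 1)\<^sup>2" by simp
        then have "2 * \<bar>t i x\<bar> \<le> (t i x)\<^sup>2 + 1" by (simp add: power2_diff)
        then show ?thesis by linarith
      qed
      finally show ?thesis .
    qed
    then have "(\<Sum>i\<in>UNIV. (\<bar>x $ i\<bar> - \<bar>c i\<bar>) / W) \<le> (\<Sum>i\<in>UNIV. (t i x)\<^sup>2 + 1)" by (rule sum_mono)
    also have "\<dots> = P 0 x + real CARD('n)" by (simp add: P_def sum.distrib)
    finally have "((\<Sum>i\<in>UNIV. \<bar>x $ i\<bar>) - (\<Sum>i\<in>UNIV. \<bar>c i\<bar>)) / W \<le> P 0 x + real CARD('n)"
      by (simp add: sum_divide_distrib[symmetric] sum_subtractf)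
    moreover have "norm x / W \<le> (\<Sum>i\<in>UNIV. \<bar>x $ i\<bar>) / W"
      using W norm_le_l1_cart[of x] by (intro divide_right_mono) auto
    ultimately show ?thesis using PP[of x k] by (simp add: diff_divide_distrib)
  qed
  have fS: "f k \<in> schwartz" for k
    unfolding f_def by (rule poly_exp_schwartz[OF real_polynomial_function.intros(2) Ppoly _ coer]) (use W in auto)
  \<comment> \<open>As P 0 exceeds P k by at most the dimension, the first function of the sequence,
    enlarged by the exponential of the dimension, dominates all others.\<close>
  define g where "g x = complex_of_real (exp (real CARD('n))) * f 0 x" for x
  have g: "g \<in> lp_space lborel 1" "g \<in> lp_space lborel p"
    unfolding g_def using lp_mult(1)[OF _ schwartz_lp[OF fS]] p by auto
  show ?thesis
  proof (rule schwartz_approx_dominated[OF p g schwartz_approx_schwartz[OF p fS]])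
    fix k x
    have "exp (- P k x) \<le> exp (real CARD('n) - P 0 x)" using PP[of x k] by simp
    then show "norm (f k x) \<le> norm (g x)"
      by (simp add: f_def g_def norm_mult mult_exp_exp)
  next
    fix x
    show "(\<lambda>k. f k x) \<longlonglongrightarrow> of_real (indicator (box a b) x)"
    proof (cases "x \<in> box a b")
      case True
      have "(\<lambda>k. real (Suc k) * t i x ^ (2 * Suc k)) \<longlonglongrightarrow> 0" for i
      proof -
        have "\<bar>t i x\<bar>\<^sup>2 < 1" using True box power_strict_mono[of "\<bar>t i x\<bar>" 1 2] by simp
        then have "(\<lambda>n. of_nat n * ((t i x)\<^sup>2) ^ n) \<longlonglongrightarrow> 0"
          by (intro powser_times_n_limit_0) simp
        then show ?thesis unfolding power_mult by (rule LIMSEQ_Suc)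
      qed
      then have "(\<lambda>k. P k x) \<longlonglongrightarrow> (\<Sum>i\<in>(UNIV::'n set). 0)" unfolding P_def by (intro tendsto_sum)
      then have "(\<lambda>k. complex_of_real (1 * exp (- P k x))) \<longlonglongrightarrow> of_real (1 * exp (- (\<Sum>i\<in>(UNIV::'n set). 0)))"
        by (intro tendsto_intros)
      then show ?thesis using True by (simp add: f_def)
    next
      case False
      then obtain i where i: "1 \<le> \<bar>t i x\<bar>" using box by (auto simp: not_less)
      have le: "real (Suc k) \<le> P k x" for k
      proof -
        have "1 \<le> \<bar>t i x\<bar> ^ (2 * Suc k)" using i by (rule one_le_power)
        then have "1 \<le> t i x ^ (2 * Suc k)" by (simp add: power_mult)
        then have "real (Suc k) * 1 \<le> real (Suc k) * t i x ^ (2 * Suc k)" by (intro mult_left_mono) auto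
        also have "\<dots> \<le> P k x"
          unfolding P_def by (rule member_le_sum[OF UNIV_I _ finite]) (simp add: power_mult del: mult_Suc_right power_Suc)
        finally show ?thesis by simp
      qed
      have "(\<lambda>k. exp (- P k x)) \<longlonglongrightarrow> 0"
      proof (rule tendsto_sandwich[OF always_eventually always_eventually tendsto_const])
        show "\<forall>k. 0 \<le> exp (- P k x)" by simp
        show "\<forall>k. exp (- P k x) \<le> inverse (exp 1) ^ Suc k"
        proof
          fix k
          have "exp (- P k x) \<le> exp (real (Suc k) * - 1)" using le[of k] by simp
          also have "\<dots> = inverse (exp 1) ^ Suc k" unfolding exp_of_nat_mult exp_minus ..
          finally show "exp (- P k x) \<le> inverse (exp 1) ^ Suc k" .
        qed
        have "(\<lambda>k. inverse (exp 1 :: real) ^ k) \<longlonglongrightarrow> 0" by (rule LIMSEQ_realpow_zero) (auto simp: inverse_less_1_iff)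
        then show "(\<lambda>k. inverse (exp 1 :: real) ^ Suc k) \<longlonglongrightarrow> 0" by (rule LIMSEQ_Suc)
      qed
      then have "(\<lambda>k. complex_of_real (1 * exp (- P k x))) \<longlonglongrightarrow> of_real (1 * 0)" by (intro tendsto_intros)
      then show ?thesis using False by (simp add: f_def)
    qed
  qed
qed

lemma lp_indicator:
  assumes "A \<in> sets M" "emeasure M A < \<infinity>" "0 < p"
  shows "(\<lambda>x. complex_of_real (indicator A x)) \<in> lp_space M p"
proof -
  have "norm (complex_of_real (indicator A x)) powr p = indicator A x" for x
    by (auto simp: indicator_def)
  then show ?thesis using assms by (simp add: lp_space_def)
qed

text \<open>Dynkin's argument with the boxes as intersection-stable generator. Intersecting with a
  fixed box keeps complements and countable unions of finite measure, so the class stays inside L^1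
  and L^p.\<close>

lemma schwartz_approx_bounded_set:
  fixes A :: "(real^'n) set"
  assumes p: "1 \<le> p" and A: "A \<in> sets borel"
  shows "schwartz_approx p (\<lambda>x. of_real (indicator (A \<inter> box l u) x))"
proof -
  let ?G = "range (\<lambda>(a, b). box a b :: (real^'n) set)"
  have mem: "A \<in> sigma_sets UNIV ?G" using A unfolding borel_eq_box by simp
  have stable: "Int_stable ?G"
    by (auto simp: Int_stable_def box_Int_box)
  have "?G \<subseteq> Pow UNIV" by simp
  with stable show ?thesis using mem
  proof (induction A rule: sigma_sets_induct_disjoint)
    case (basic A)
    then show ?case using schwartz_approx_box[OF p] by (auto simp: box_Int_box)
  next
    case empty
    then show ?case using schwartz_approx_zero[OF p] by simp
  next
    case (compl A)
    have "complex_of_real (indicator ((UNIV - A) \<inter> box l u) x) =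
       1 * of_real (indicator (box l u) x) + (-1) * of_real (indicator (A \<inter> box l u) x)" for x
      by (auto simp: indicator_def)
    then show ?case using schwartz_approx_lincomb[OF p schwartz_approx_box[OF p] compl(2), of 1 l u "-1"] by simp
  next
    case (union A)
    define f where "f k x = (\<Sum>i<k. complex_of_real (indicator (A i \<inter> box l u) x))" for k x
    have f: "schwartz_approx p (f k)" for k
    proof (induction k)
      case 0
      then show ?case using schwartz_approx_zero[OF p] by (simp add: f_def)
    next
      case (Suc k)
      then show ?case using schwartz_approx_lincomb[OF p Suc union(3)[of k], of 1 1] by (simp add: f_def)
    qed
    have fe: "f k x = of_real (indicator ((\<Union>i<k. A i) \<inter> box l u) x)" for k x
    proof -
      have "disjoint_family_on (\<lambda>i. A i \<inter> box l u) {..<k}"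
        using union(1) by (auto simp: disjoint_family_on_def)
      then have "indicator (\<Union>i<k. A i \<inter> box l u) x = (\<Sum>i<k. indicator (A i \<inter> box l u) x :: complex)"
        by (intro indicator_UN_disjoint) simp
      moreover have "(\<Union>i<k. A i \<inter> box l u) = (\<Union>i<k. A i) \<inter> box l u" by auto
      ultimately show ?thesis unfolding f_def of_real_indicator by metis
    qed
    have bx: "emeasure lborel (box l u) < \<infinity>" by (simp add: emeasure_lborel_box_eq)
    show ?case
    proof (rule schwartz_approx_dominated[OF p _ _ f])
      show "(\<lambda>x. complex_of_real (indicator (box l u) x)) \<in> lp_space lborel 1"
        "(\<lambda>x. complex_of_real (indicator (box l u) x)) \<in> lp_space lborel p"
        using p bx by (auto intro!: lp_indicator)
      show "norm (f k x) \<le> norm (complex_of_real (indicator (box l u) x))" for k x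
        by (auto simp: fe indicator_def)
      show "(\<lambda>k. f k x) \<longlonglongrightarrow> of_real (indicator (\<Union> (range A) \<inter> box l u) x)" for x
      proof (rule tendsto_eventually)
        show "\<forall>\<^sub>F k in sequentially. f k x = of_real (indicator (\<Union> (range A) \<inter> box l u) x)"
        proof (cases "x \<in> \<Union> (range A)")
          case True
          then obtain i where i: "x \<in> A i" by auto
          show ?thesis using eventually_gt_at_top[of i]
            by eventually_elim (use i in \<open>auto simp: fe indicator_def\<close>)
        qed (auto simp: fe indicator_def)
      qed
    qed
  qed
qed

lemma schwartz_approx_indicator:
  fixes A :: "(real^'n) set"
  assumes p: "1 \<le> p" and A: "A \<in> sets borel" "emeasure lborel A < \<infinity>"
  shows "schwartz_approx p (\<lambda>x. of_real (indicator A x))"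
proof (rule schwartz_approx_dominated[OF p _ _ schwartz_approx_bounded_set[OF p A(1)]])
  show "(\<lambda>x. complex_of_real (indicator A x)) \<in> lp_space lborel 1"
    "(\<lambda>x. complex_of_real (indicator A x)) \<in> lp_space lborel p"
    using p A by (auto intro!: lp_indicator)
  let ?B = "\<lambda>k::nat. box (\<chi> i. - real k) (\<chi> i. real k) :: (real^'n) set"
  show "norm (complex_of_real (indicator (A \<inter> ?B k) x)) \<le> norm (complex_of_real (indicator A x))" for k x
    by (auto simp: indicator_def)
  show "(\<lambda>k. complex_of_real (indicator (A \<inter> ?B k) x)) \<longlonglongrightarrow> of_real (indicator A x)" for x
  proof (rule tendsto_eventually)
    obtain N :: nat where N: "norm x < N" using reals_Archimedean2 by blast
    have "x \<in> ?B k" if "N \<le> k" for k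
      unfolding mem_box_cart
    proof (intro allI)
      fix i
      have "\<bar>x $ i\<bar> < real k" using component_le_norm_cart[of x i] N that by linarith
      then show "(\<chi> i. - real k) $ i < x $ i \<and> x $ i < (\<chi> i. real k) $ i" by auto
    qed
    then show "\<forall>\<^sub>F k in sequentially. complex_of_real (indicator (A \<inter> ?B k) x) = of_real (indicator A x)"
      by (intro eventually_mono[OF eventually_ge_at_top[of N]]) (auto simp: indicator_def)
  qed
qed

lemma schwartz_approx_sum:
  assumes "1 \<le> p" "finite I" "\<And>i. i \<in> I \<Longrightarrow> schwartz_approx p (f i)"
  shows "schwartz_approx p (\<lambda>x. \<Sum>i\<in>I. f i x)"
  using assms(2,3)
proof (induction I)
  case empty
  then show ?case using schwartz_approx_zero[OF assms(1)] by simp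
next
  case (insert i I)
  then show ?case using schwartz_approx_lincomb[OF assms(1), of "f i" "\<lambda>x. \<Sum>i\<in>I. f i x" 1 1] by simp
qed

lemma schwartz_approx_all:
  fixes f :: "real^'n \<Rightarrow> complex"
  assumes p: "1 \<le> p" and f: "f \<in> lp_space lborel 1" "f \<in> lp_space lborel p"
  shows "schwartz_approx p f"
proof -
  have [measurable]: "f \<in> borel_measurable lborel" using lp_space_measurable[OF f(1)] .
  obtain s where s: "\<And>i. simple_function lborel (s i)" "\<And>x. (\<lambda>i. s i x) \<longlonglongrightarrow> f x"
    "\<And>i x. norm (s i x) \<le> 2 * norm (f x)"
    using borel_measurable_implies_sequence_metric[of f lborel 0] by auto
  have "schwartz_approx p (s i)" for i
  proof -
    have [measurable]: "s i \<in> borel_measurable lborel" by (rule borel_measurable_simple_function[OF s(1)])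
    have fin: "finite (range (s i))" using s(1)[of i] by (simp add: simple_function_def)
    have int: "integrable lborel (\<lambda>x. norm (s i x))"
      by (rule Bochner_Integration.integrable_bound[of _ "\<lambda>x. 2 * norm (f x)"])
         (use s(3) lp_space_integrable[OF f(1)] in \<open>auto simp: abs_mult\<close>)
    \<comment> \<open>The summand \<open>0 * 0\<close> plays the part of \<open>b * g x\<close> with
      the zero function, giving each term the shape of
      \<open>schwartz_approx_lincomb\<close>.\<close>
    have eq: "s i = (\<lambda>x. \<Sum>y\<in>range (s i). y * of_real (indicator (s i -` {y}) x) + 0 * 0)"
    proof
      fix x
      have "(\<Sum>y\<in>range (s i). y * of_real (indicator (s i -` {y}) x)) = (\<Sum>y\<in>range (s i). if y = s i x then y else 0)"
        by (intro sum.cong refl) (auto simp: indicator_def)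
      then show "s i x = (\<Sum>y\<in>range (s i). y * of_real (indicator (s i -` {y}) x) + 0 * 0)" using fin by simp
    qed
    have ap: "schwartz_approx p (\<lambda>x. \<Sum>y\<in>range (s i). y * of_real (indicator (s i -` {y}) x) + 0 * 0)"
    proof (rule schwartz_approx_sum[OF p fin])
      fix y
      show "schwartz_approx p (\<lambda>x. y * complex_of_real (indicator (s i -` {y}) x) + 0 * 0)"
      proof (cases "y = 0")
        case False
        have A: "s i -` {y} \<in> sets borel"
          using measurable_sets[of "s i" lborel borel "{y}"] by simp
        have "integrable lborel (indicator (s i -` {y}) :: _ \<Rightarrow> real)"
        proof (rule Bochner_Integration.integrable_bound)
          show "integrable lborel (\<lambda>x. norm (s i x) / norm y)" using int by simp
          show "AE x in lborel. norm (indicator (s i -` {y}) x :: real) \<le> norm (norm (s i x) / norm y)"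
            using False by (intro AE_I2) (auto simp: indicator_def)
        qed (use A in auto)
        then have "emeasure lborel (s i -` {y}) < \<infinity>" by (simp add: integrable_indicator_iff)
        then show ?thesis
          using schwartz_approx_lincomb[OF p schwartz_approx_indicator[OF p A] schwartz_approx_zero[OF p], of y 0] by simp
      qed (use schwartz_approx_zero[OF p] in simp)
    qed
    show ?thesis by (subst eq) (rule ap)
  qed
  note S = this
  have "(\<lambda>x. 2 *\<^sub>R f x) \<in> lp_space lborel 1" "(\<lambda>x. 2 *\<^sub>R f x) \<in> lp_space lborel p"
    using lp_scaleR(1)[OF _ f(1)] lp_scaleR(1)[OF _ f(2)] p by auto
  then show ?thesis
    by (rule schwartz_approx_dominated[OF p _ _ S]) (use s in auto)
qed

lemma schwartz_dense_both:
  fixes f :: "real^'n \<Rightarrow> complex"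
  assumes p: "1 \<le> p" and f: "f \<in> lp_space lborel 1" "f \<in> lp_space lborel p"
  obtains g where "\<And>k. g k \<in> schwartz" "(\<lambda>k. lp_norm lborel 1 (\<lambda>x. g k x - f x)) \<longlonglongrightarrow> 0"
    "(\<lambda>k. lp_norm lborel p (\<lambda>x. g k x - f x)) \<longlonglongrightarrow> 0"
proof -
  have "\<exists>g\<in>schwartz. lp_norm lborel 1 (\<lambda>x. g x - f x) < inverse (real (Suc k)) \<and> lp_norm lborel p (\<lambda>x. g x - f x) < inverse (real (Suc k))" for k
    using schwartz_approx_all[OF assms] by (simp add: schwartz_approx_def)
  then obtain g where g: "\<And>k. g k \<in> schwartz" "\<And>k. lp_norm lborel 1 (\<lambda>x. g k x - f x) < inverse (real (Suc k))"
     "\<And>k. lp_norm lborel p (\<lambda>x. g k x - f x) < inverse (real (Suc k))" by metis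
  have l: "(\<lambda>k. r k) \<longlonglongrightarrow> 0" if "\<And>k. r k < inverse (real (Suc k))" "\<And>k. 0 \<le> r k" for r
    by (rule tendsto_sandwich[OF always_eventually always_eventually tendsto_const LIMSEQ_inverse_real_of_nat])
       (use that in \<open>auto intro: less_imp_le simp del: of_nat_Suc\<close>)
  show thesis using that[OF g(1)] l[OF g(2)] l[OF g(3)] by simp
qed

text \<open>Restricting f to the set where both |f| and |x| are at most k puts it into L^1 as well,
  where simultaneous approximation is available; dominated convergence removes the
  restriction.\<close>

lemma schwartz_dense:
  fixes f :: "real^'n \<Rightarrow> complex"
  assumes p: "1 \<le> p" and f: "f \<in> lp_space lborel p"
  obtains g where "\<And>k. g k \<in> schwartz" "(\<lambda>k. lp_norm lborel p (\<lambda>x. g k x - f x)) \<longlonglongrightarrow> 0"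
proof -
  have [measurable]: "f \<in> borel_measurable borel" using lp_space_measurable[OF f] by simp
  define A where "A k = {x. norm (f x) \<le> real k \<and> norm x \<le> real k}" for k
  have [measurable]: "A k \<in> sets borel" for k unfolding A_def by measurable
  define h where "h k x = of_real (indicator (A k) x) * f x" for k x
  have [measurable]: "h k \<in> borel_measurable borel" for k unfolding h_def[abs_def] by measurable
  have h_le: "norm (h k x) \<le> norm (f x)" for k x by (auto simp: h_def indicator_def)
  have hp: "h k \<in> lp_space lborel p" for k
    by (rule lp_norm_mono(1)[OF _ f]) (use p h_le in auto)
  have h1: "h k \<in> lp_space lborel 1" for k
  proof (rule lp_norm_mono(1))
    have "emeasure lborel (A k) \<le> emeasure lborel (cball (0::real^'n) (real k))"
      by (intro emeasure_mono) (auto simp: A_def)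
    also have "\<dots> < \<infinity>" by (rule emeasure_lborel_cball_finite)
    finally show "(\<lambda>x. real k *\<^sub>R complex_of_real (indicator (A k) x)) \<in> lp_space lborel 1"
      by (intro lp_scaleR(1) lp_indicator) auto
    show "AE x in lborel. norm (h k x) \<le> norm (real k *\<^sub>R complex_of_real (indicator (A k) x))"
      by (intro AE_I2) (auto simp: h_def indicator_def A_def)
  qed auto
  have "(\<lambda>k. lp_norm lborel p (\<lambda>x. h k x - f x)) \<longlonglongrightarrow> 0"
  proof (rule lp_dominated_convergence[OF p f])
    fix x
    obtain N :: nat where N: "max (norm (f x)) (norm x) < N" using reals_Archimedean2 by blast
    show "(\<lambda>k. h k x) \<longlonglongrightarrow> f x"
    proof (rule tendsto_eventually)
      show "\<forall>\<^sub>F k in sequentially. h k x = f x"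
        using eventually_ge_at_top[of N] by eventually_elim (use N in \<open>auto simp: h_def indicator_def A_def\<close>)
    qed
  qed (use h_le in auto)
  note lim = this
  have "\<exists>g\<in>schwartz. lp_norm lborel p (\<lambda>x. g x - h k x) < inverse (real (Suc k))" for k
    using schwartz_approx_all[OF p h1[of k] hp[of k], unfolded schwartz_approx_def, THEN conjunct2, THEN conjunct2, rule_format, OF inverse_Suc[of k]]
    by blast
  then obtain g where g: "\<And>k. g k \<in> schwartz" "\<And>k. lp_norm lborel p (\<lambda>x. g k x - h k x) < inverse (real (Suc k))" by metis
  have "(\<lambda>k. lp_norm lborel p (\<lambda>x. g k x - f x)) \<longlonglongrightarrow> 0"
  proof (rule tendsto_sandwich[OF always_eventually always_eventually tendsto_const])
    show "\<forall>k. lp_norm lborel p (\<lambda>x. g k x - f x) \<le> inverse (real (Suc k)) + lp_norm lborel p (\<lambda>x. h k x - f x)"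
    proof
      fix k
      show "lp_norm lborel p (\<lambda>x. g k x - f x) \<le> inverse (real (Suc k)) + lp_norm lborel p (\<lambda>x. h k x - f x)"
        using lp_norm_triangle3[OF p schwartz_lp[OF g(1)[of k] p] hp[of k] f] g(2)[of k] by linarith
    qed
    show "(\<lambda>k. inverse (real (Suc k)) + lp_norm lborel p (\<lambda>x. h k x - f x)) \<longlonglongrightarrow> 0"
      using tendsto_add[OF LIMSEQ_inverse_real_of_nat lim] by simp
  qed simp
  then show thesis using that g(1) by blast
qed

section \<open>Multipliers supported in annuli\<close>

text \<open>The finite sums of the nonnegative numbers b are bounded, hence small over every finite
  set avoiding a suitable J0. The assumed bound transfers this to the functions, the net of partial
  sums is Cauchy, and completeness gives the limit.\<close>

lemma lp_unconditional_sum: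
  fixes u :: "'i \<Rightarrow> 'a \<Rightarrow> 'b::{banach,second_countable_topology}"
  assumes q: "1 \<le> q" and u: "\<And>j. u j \<in> lp_space M q" and b: "\<And>j. 0 \<le> b j"
    and bound: "\<And>J. finite J \<Longrightarrow> lp_norm M q (\<lambda>x. \<Sum>j\<in>J. u j x) \<le> sqrt (\<Sum>j\<in>J. b j)"
    and D: "\<And>J. finite J \<Longrightarrow> (\<Sum>j\<in>J. b j) \<le> D"
  shows "\<exists>h\<in>lp_space M q. ((\<lambda>F. lp_norm M q (\<lambda>x. (\<Sum>j\<in>F. u j x) - h x)) \<longlongrightarrow> 0) (finite_subsets_at_top UNIV)"
proof -
  define s where "s J x = (\<Sum>j\<in>J. u j x)" for J x
  have s: "s J \<in> lp_space M q" for J unfolding s_def by (rule lp_sum(1)[OF q u])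
  define \<Sigma> where "\<Sigma> = (SUP J\<in>{J. finite J}. \<Sum>j\<in>J. b j)"
  have bdd: "bdd_above ((\<lambda>J. \<Sum>j\<in>J. b j) ` {J. finite J})" using D by (auto intro!: bdd_aboveI)
  have tail: "\<exists>J0. finite J0 \<and> (\<forall>J. finite J \<and> J \<inter> J0 = {} \<longrightarrow> (\<Sum>j\<in>J. b j) < e)" if "0 < e" for e
  proof -
    have ne: "{J :: 'i set. finite J} \<noteq> {}" using finite.emptyI by blast
    have "\<Sigma> - e < \<Sigma>" using that by simp
    then have "\<exists>J0\<in>{J. finite J}. \<Sigma> - e < (\<Sum>j\<in>J0. b j)"
      using less_cSUP_iff[OF ne bdd, of "\<Sigma> - e"] unfolding \<Sigma>_def by (rule iffD1[rotated])
    then obtain J0 where J0: "finite J0" "\<Sigma> - e < (\<Sum>j\<in>J0. b j)" by blast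
    have "(\<Sum>j\<in>J. b j) < e" if J: "finite J" "J \<inter> J0 = {}" for J
    proof -
      have "(\<Sum>j\<in>J \<union> J0. b j) \<le> \<Sigma>"
        unfolding \<Sigma>_def using J J0 by (intro cSUP_upper bdd) auto
      then show ?thesis using J J0 by (simp add: sum.union_disjoint)
    qed
    then show ?thesis using J0(1) by blast
  qed
  have tail2: "\<exists>J0. finite J0 \<and> (\<forall>F G. finite F \<and> finite G \<and> J0 \<subseteq> F \<and> J0 \<subseteq> G \<longrightarrow> lp_norm M q (\<lambda>x. s F x - s G x) < e)" if e: "0 < e" for e
  proof -
    obtain J0 where J0: "finite J0" "\<And>J. finite J \<Longrightarrow> J \<inter> J0 = {} \<Longrightarrow> (\<Sum>j\<in>J. b j) < (e/2)\<^sup>2"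
      using tail[of "(e/2)\<^sup>2"] e by auto
    have small: "lp_norm M q (s J) < e / 2" if "finite J" "J \<inter> J0 = {}" for J
    proof -
      have "sqrt (\<Sum>j\<in>J. b j) < sqrt ((e/2)\<^sup>2)" using J0(2)[OF that] by (rule real_sqrt_less_mono)
      then show ?thesis using bound[OF that(1)] e unfolding s_def[abs_def] by simp
    qed
    have "lp_norm M q (\<lambda>x. s F x - s G x) < e" if "finite F" "finite G" "J0 \<subseteq> F" "J0 \<subseteq> G" for F G
    proof -
      \<comment> \<open>The common part cancels, and both remaining index sets are disjoint from
        J0.\<close>
      have "s F x - s G x = s (F - G) x - s (G - F) x" for x
      proof -
        have "s F x = s (F - G) x + s (F \<inter> G) x" "s G x = s (G - F) x + s (F \<inter> G) x"
          unfolding s_def using that(1,2)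
          by (subst sum.union_disjoint[symmetric]; auto intro!: sum.cong)+
        then show ?thesis by simp
      qed
      then have "lp_norm M q (\<lambda>x. s F x - s G x) \<le> lp_norm M q (s (F - G)) + lp_norm M q (s (G - F))"
        using lp_diff(2)[OF q s s, of "F - G" "G - F"] by simp
      then show ?thesis using small[of "F - G"] small[of "G - F"] that by force
    qed
    then show ?thesis using J0(1) by blast
  qed
  obtain J0 where J0: "\<And>n. finite (J0 n)"
    "\<And>n F G. finite F \<Longrightarrow> finite G \<Longrightarrow> J0 n \<subseteq> F \<Longrightarrow> J0 n \<subseteq> G \<Longrightarrow> lp_norm M q (\<lambda>x. s F x - s G x) < inverse (real (Suc n))"
    using tail2[OF inverse_Suc] by metis
  \<comment> \<open>An increasing sequence of index sets extracts from the net a sequence to which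
    completeness applies; its limit is then shown to be the limit of the net.\<close>
  define K where "K n = (\<Union>m\<le>n. J0 m)" for n
  have K: "finite (K n)" "m \<le> n \<Longrightarrow> J0 m \<subseteq> K n" for m n using J0(1) by (auto simp: K_def)
  have ex: "\<exists>n. inverse (real (Suc n)) < e" if "0 < e" for e using reals_Archimedean[OF that] .
  have "\<exists>N. \<forall>m\<ge>N. \<forall>n\<ge>N. lp_norm M q (\<lambda>x. s (K m) x - s (K n) x) < e" if e: "0 < e" for e
  proof -
    obtain N where N: "inverse (real (Suc N)) < e" using ex[OF e] by blast
    have "lp_norm M q (\<lambda>x. s (K m) x - s (K n) x) < e" if "N \<le> m" "N \<le> n" for m n
      using J0(2)[OF K(1) K(1) K(2) K(2), OF that] N by linarith
    then show ?thesis by blast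
  qed
  from lp_complete[OF q s this]
  obtain h where h: "h \<in> lp_space M q" "(\<lambda>k. lp_norm M q (\<lambda>x. s (K k) x - h x)) \<longlonglongrightarrow> 0" by blast
  have "((\<lambda>F. lp_norm M q (\<lambda>x. s F x - h x)) \<longlongrightarrow> 0) (finite_subsets_at_top UNIV)"
  proof (rule tendstoI)
    fix e :: real assume e: "0 < e"
    obtain N where N: "inverse (real (Suc N)) < e / 2" using ex[of "e/2"] e by auto
    have "\<forall>\<^sub>F k in sequentially. lp_norm M q (\<lambda>x. s (K k) x - h x) < e / 2"
      using order_tendstoD(2)[OF h(2), of "e/2"] e by simp
    then have "\<forall>\<^sub>F k in sequentially. lp_norm M q (\<lambda>x. s (K k) x - h x) < e / 2 \<and> N \<le> k"
      using eventually_ge_at_top by (rule eventually_conj)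
    then obtain k where k: "lp_norm M q (\<lambda>x. s (K k) x - h x) < e / 2" "N \<le> k"
      using eventually_happens'[OF sequentially_bot] by blast
    show "\<forall>\<^sub>F F in finite_subsets_at_top UNIV. dist (lp_norm M q (\<lambda>x. s F x - h x)) 0 < e"
      unfolding eventually_finite_subsets_at_top
    proof (intro exI[of _ "J0 N"] conjI allI impI)
      fix F assume F: "finite F \<and> J0 N \<subseteq> F \<and> F \<subseteq> UNIV"
      have "lp_norm M q (\<lambda>x. s F x - s (K k) x) < inverse (real (Suc N))"
        using F K(1) K(2)[OF k(2)] by (intro J0(2)) auto
      then show "dist (lp_norm M q (\<lambda>x. s F x - h x)) 0 < e"
        using lp_norm_triangle3[OF q s s h(1), of F "K k"] k(1) N by (simp add: dist_real_def)
    qed (use J0(1) in auto)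
  qed
  then show ?thesis using h(1) unfolding s_def by blast
qed

lemma lp_norm_limit_le:
  assumes q: "1 \<le> q" and s: "\<And>F. s F \<in> lp_space M q" and h: "h \<in> lp_space M q"
    and B: "\<forall>\<^sub>F F in \<F>. lp_norm M q (s F) \<le> B" and nt: "\<F> \<noteq> bot"
    and lim: "((\<lambda>F. lp_norm M q (\<lambda>x. s F x - h x)) \<longlongrightarrow> 0) \<F>"
  shows "lp_norm M q h \<le> B"
proof (rule tendsto_upperbound[OF _ _ nt])
  show "((\<lambda>F. lp_norm M q h - lp_norm M q (\<lambda>x. s F x - h x)) \<longlongrightarrow> lp_norm M q h) \<F>"
    using tendsto_diff[OF tendsto_const lim] by simp
  show "\<forall>\<^sub>F F in \<F>. lp_norm M q h - lp_norm M q (\<lambda>x. s F x - h x) \<le> B"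
    using B
  proof eventually_elim
    case (elim F)
    then show ?case
      using lp_norm_triangle_sub[OF q h s[of F]] lp_norm_diff_commute[of M q h "s F"] by linarith
  qed
qed

lemma lp_norm_tendsto:
  assumes q: "1 \<le> q" and s: "\<And>k. s k \<in> lp_space M q" and h: "h \<in> lp_space M q"
    and lim: "(\<lambda>k. lp_norm M q (\<lambda>x. s k x - h x)) \<longlonglongrightarrow> 0"
  shows "(\<lambda>k. lp_norm M q (s k)) \<longlonglongrightarrow> lp_norm M q h"
proof -
  have "\<bar>lp_norm M q (s k) - lp_norm M q h\<bar> \<le> lp_norm M q (\<lambda>x. s k x - h x)" for k
    using lp_norm_triangle_sub[OF q h s[of k]] lp_norm_triangle_sub[OF q s[of k] h]
      lp_norm_diff_commute[of M q h "s k"] by linarith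
  then have "(\<lambda>k. lp_norm M q (s k) - lp_norm M q h) \<longlonglongrightarrow> 0"
    by (intro Lim_null_comparison[OF _ lim]) auto
  then show ?thesis by (simp add: LIM_zero_iff)
qed

section \<open>From Lebesgue measurable functions to Borel representatives, and Fourier
  integrals\<close>

lemma Lp_norm_eq:
  assumes p: "0 < p"
  shows Lp_iff_lp_space: "f \<in> Lp p \<longleftrightarrow> f \<in> lp_space lebesgue p"
    and Lp_norm_eq_lp_norm: "f \<in> lp_space lebesgue p \<Longrightarrow> Lp_norm p f = ennreal (lp_norm lebesgue p f)"
proof -
  define I where "I = (\<integral>\<^sup>+ x. ennreal (norm (f x) powr p) \<partial>lebesgue)"
  have eq: "f \<in> borel_measurable lebesgue \<Longrightarrow> integrable lebesgue (\<lambda>x. norm (f x) powr p) \<longleftrightarrow> I \<noteq> \<infinity>"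
    by (simp add: integrable_iff_bounded I_def less_top)
  have L: "Lp_norm p f = (if I = \<infinity> then \<infinity> else ennreal (enn2real I powr (1 / p)))"
    by (simp add: Lp_norm_def I_def Let_def)
  show "f \<in> Lp p \<longleftrightarrow> f \<in> lp_space lebesgue p"
    unfolding Lp_def lp_space_def using eq L by (auto simp: less_top)
  assume f: "f \<in> lp_space lebesgue p"
  then have "I = ennreal (\<integral>x. norm (f x) powr p \<partial>lebesgue)"
    unfolding I_def by (intro nn_integral_eq_integral) (auto simp: lp_space_def)
  then show "Lp_norm p f = ennreal (lp_norm lebesgue p f)"
    unfolding L lp_norm_def by simp
qed

lemma lp_space_lebesgue_borel:
  assumes "f \<in> borel_measurable borel"
  shows "f \<in> lp_space lebesgue p \<longleftrightarrow> f \<in> lp_space lborel p" "lp_norm lebesgue p f = lp_norm lborel p f"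
proof -
  have m: "(\<lambda>x. norm (f x) powr p) \<in> borel_measurable lborel" using assms by measurable
  show "f \<in> lp_space lebesgue p \<longleftrightarrow> f \<in> lp_space lborel p"
    using assms integrable_completion[OF m] by (auto simp: lp_space_def measurable_completion)
  show "lp_norm lebesgue p f = lp_norm lborel p f"
    by (simp add: lp_norm_def integral_completion[OF m])
qed

lemma lebesgue_ex_borel_complex:
  fixes f :: "'a::euclidean_space \<Rightarrow> complex"
  assumes f: "f \<in> borel_measurable lebesgue"
  obtains g where "g \<in> borel_measurable borel" "AE x in lebesgue. f x = g x"
proof -
  have "(\<lambda>x. Re (f x)) \<in> borel_measurable lebesgue" "(\<lambda>x. Im (f x)) \<in> borel_measurable lebesgue"
    using f by measurable
  then obtain r i where r: "r \<in> borel_measurable lborel" "AE x in lborel. Re (f x) = r x"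
    and i: "i \<in> borel_measurable lborel" "AE x in lborel. Im (f x) = i x"
    using completion_ex_borel_measurable_real by metis
  have [measurable]: "r \<in> borel_measurable borel" "i \<in> borel_measurable borel" using r(1) i(1) by auto
  have "AE x in lborel. f x = Complex (r x) (i x)" using r(2) i(2) by eventually_elim (simp add: complex_eq_iff)
  then have "AE x in lebesgue. f x = Complex (r x) (i x)" by (rule AE_completion)
  moreover have "(\<lambda>x. Complex (r x) (i x)) \<in> borel_measurable borel"
    unfolding Complex_eq by measurable
  ultimately show thesis using that by blast
qed

text \<open>A symbol is only Lebesgue measurable, whereas Fubini is available for Borel functions on
  the product space. Inside the integral a null set may be changed, so the inverse transform agrees
  at every point.\<close>

lemma inv_fourier_borel_representative:
  fixes F :: "real^'n \<Rightarrow> complex"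
  assumes F: "integrable lebesgue F"
  shows "\<exists>G. integrable lborel G \<and> (AE x in lebesgue. F x = G x) \<and>
    (\<forall>x. inv_fourier F x = (\<integral>\<xi>. exp (2 * of_real pi * \<i> * of_real (x \<bullet> \<xi>)) * G \<xi> \<partial>lborel))"
proof -
  have Fm: "F \<in> borel_measurable lebesgue" using F by auto
  obtain G where G: "G \<in> borel_measurable borel" "AE x in lebesgue. F x = G x"
    using lebesgue_ex_borel_complex[OF Fm] by blast
  have Gl: "G \<in> borel_measurable lborel" using G(1) by simp
  have "integrable lebesgue G"
    using integrable_cong_AE_imp[OF F measurable_completion[OF Gl]] G(2) by auto
  then have Gi: "integrable lborel G" using integrable_completion[OF Gl] by simp
  have "inv_fourier F x = (\<integral>\<xi>. exp (2 * of_real pi * \<i> * of_real (x \<bullet> \<xi>)) * G \<xi> \<partial>lborel)" for x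
  proof -
    have e: "(\<lambda>\<xi>. exp (2 * of_real pi * \<i> * of_real (x \<bullet> \<xi>)) :: complex) \<in> borel_measurable lborel" by measurable
    have "inv_fourier F x = (\<integral>\<xi>. exp (2 * of_real pi * \<i> * of_real (x \<bullet> \<xi>)) * G \<xi> \<partial>lebesgue)"
      unfolding inv_fourier_def
    proof (rule integral_cong_AE)
      show "AE \<xi> in lebesgue. exp (2 * of_real pi * \<i> * of_real (x \<bullet> \<xi>)) * F \<xi> = exp (2 * of_real pi * \<i> * of_real (x \<bullet> \<xi>)) * G \<xi>"
        using G(2) by eventually_elim simp
    qed (intro borel_measurable_times Fm measurable_completion[OF Gl] measurable_completion[OF e])+
    also have "\<dots> = (\<integral>\<xi>. exp (2 * of_real pi * \<i> * of_real (x \<bullet> \<xi>)) * G \<xi> \<partial>lborel)"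
      by (rule integral_completion) (intro borel_measurable_times e Gl)
    finally show ?thesis .
  qed
  then show ?thesis using Gi G(2) by blast
qed

lemma fourier_exp_integrable':
  fixes G :: "'a::euclidean_space \<Rightarrow> complex"
  assumes "integrable lborel G"
  shows "integrable lborel (\<lambda>\<xi>. exp (2 * of_real pi * \<i> * of_real (x \<bullet> \<xi>)) * G \<xi>)"
proof -
  have [measurable]: "G \<in> borel_measurable borel" using assms by auto
  show ?thesis
    by (rule Bochner_Integration.integrable_bound[OF assms]) (auto simp: norm_mult)
qed

lemma inv_fourier_measurable:
  assumes "integrable lebesgue F"
  shows "inv_fourier F \<in> borel_measurable borel"
proof -
  obtain G where G: "integrable lborel G" "AE x in lebesgue. F x = G x"
    "\<And>x. inv_fourier F x = (\<integral>\<xi>. exp (2 * of_real pi * \<i> * of_real (x \<bullet> \<xi>)) * G \<xi> \<partial>lborel)"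
    using inv_fourier_borel_representative[OF assms] by blast
  have [measurable]: "G \<in> borel_measurable borel" using G(1) by auto
  have "(\<lambda>x. \<integral>\<xi>. exp (2 * of_real pi * \<i> * of_real (x \<bullet> \<xi>)) * G \<xi> \<partial>lborel) \<in> borel_measurable borel"
    by (rule sigma_finite_measure.borel_measurable_lebesgue_integral) (auto intro: sigma_finite_lborel)
  then show ?thesis using G(3) by (simp cong: measurable_cong)
qed

lemma inv_fourier_exp_integrable:
  assumes F: "integrable lebesgue F"
  shows "integrable lebesgue (\<lambda>\<xi>. exp (2 * of_real pi * \<i> * of_real (x \<bullet> \<xi>)) * F \<xi>)"
proof (rule Bochner_Integration.integrable_bound[OF F])
  have e: "(\<lambda>\<xi>. exp (2 * of_real pi * \<i> * of_real (x \<bullet> \<xi>)) :: complex) \<in> borel_measurable lborel" by measurable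
  show "(\<lambda>\<xi>. exp (2 * of_real pi * \<i> * of_real (x \<bullet> \<xi>)) * F \<xi>) \<in> borel_measurable lebesgue"
    using F by (intro borel_measurable_times measurable_completion[OF e]) auto
qed (auto simp: norm_mult)

lemma inv_fourier_diff:
  assumes "integrable lebesgue F" "integrable lebesgue G"
  shows "inv_fourier (\<lambda>\<xi>. F \<xi> - G \<xi>) x = inv_fourier F x - inv_fourier G x"
  unfolding inv_fourier_def right_diff_distrib
  by (rule Bochner_Integration.integral_diff[OF inv_fourier_exp_integrable[OF assms(1)] inv_fourier_exp_integrable[OF assms(2)]])

lemma norm_inv_fourier_le:
  assumes F: "integrable lebesgue F"
  shows "norm (inv_fourier F x) \<le> (\<integral>\<xi>. norm (F \<xi>) \<partial>lebesgue)"
  unfolding inv_fourier_def by (rule order_trans[OF integral_norm_bound]) (simp add: norm_mult)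

text \<open>Fubini turns the convolution into multiplication of the integrand by
  \<open>fourier_kernel \<phi>\<close>, which is 1 wherever F is nonzero. No Fourier inversion
  enters, since the function is given as an inverse transform.\<close>

lemma conv_inv_fourier:
  fixes F :: "real^'n \<Rightarrow> complex"
  assumes F: "integrable lebesgue F" and \<phi>: "bdd_kernel \<phi>" and one: "\<And>\<xi>. F \<xi> \<noteq> 0 \<Longrightarrow> fourier_kernel \<phi> \<xi> = 1"
  shows "conv \<phi> (inv_fourier F) x = inv_fourier F x"
proof -
  obtain G where G: "integrable lborel G" "AE x in lebesgue. F x = G x"
    "\<And>x. inv_fourier F x = (\<integral>\<xi>. exp (2 * of_real pi * \<i> * of_real (x \<bullet> \<xi>)) * G \<xi> \<partial>lborel)"
    using inv_fourier_borel_representative[OF F] by blast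
  note [measurable] = bdd_kernelD(2)[OF \<phi>]
  have [measurable]: "G \<in> borel_measurable borel" using G(1) by auto
  define H where "H y \<xi> = exp (2 * of_real pi * \<i> * of_real ((x - y) \<bullet> \<xi>)) * G \<xi>" for y \<xi>
  have Hm: "(\<lambda>(y, \<xi>). H y \<xi>) \<in> borel_measurable (borel \<Otimes>\<^sub>M borel)" unfolding H_def by measurable
  have Hi: "integrable lborel (H y)" for y unfolding H_def by (rule fourier_exp_integrable'[OF G(1)])
  have Hb: "(\<integral>\<xi>. norm (H y \<xi>) \<partial>lborel) \<le> (\<integral>\<xi>. norm (G \<xi>) \<partial>lborel)" for y by (simp add: H_def norm_mult)
  have inner: "(\<integral>y. \<phi> y *\<^sub>R H y \<xi> \<partial>lborel) = exp (2 * of_real pi * \<i> * of_real (x \<bullet> \<xi>)) * G \<xi> * fourier_kernel \<phi> \<xi>" for \<xi>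
  proof -
    have "\<phi> y *\<^sub>R H y \<xi> = exp (2 * of_real pi * \<i> * of_real (x \<bullet> \<xi>)) * G \<xi> * (exp (- (2 * of_real pi * \<i> * of_real (y \<bullet> \<xi>))) * of_real (\<phi> y))" for y
    proof -
      have "exp (2 * of_real pi * \<i> * of_real ((x - y) \<bullet> \<xi>)) = exp (2 * of_real pi * \<i> * of_real (x \<bullet> \<xi>)) * exp (- (2 * of_real pi * \<i> * complex_of_real (y \<bullet> \<xi>)))"
        by (simp add: inner_diff_left right_diff_distrib flip: exp_add)
      then show ?thesis by (simp add: H_def scaleR_conv_of_real mult_ac)
    qed
    then show ?thesis unfolding fourier_kernel_def by (simp only: integral_mult_right_zero)
  qed
  have "conv \<phi> (inv_fourier F) x = (\<integral>y. \<phi> y *\<^sub>R (\<integral>\<xi>. H y \<xi> \<partial>lborel) \<partial>lborel)"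
    unfolding conv_def G(3) H_def ..
  also have "\<dots> = (\<integral>\<xi>. (\<integral>y. \<phi> y *\<^sub>R H y \<xi> \<partial>lborel) \<partial>lborel)"
    by (rule Fubini_kernel(3)[OF bdd_kernelD(1)[OF \<phi>] Hm Hi Hb, symmetric])
  also have "\<dots> = (\<integral>\<xi>. exp (2 * of_real pi * \<i> * of_real (x \<bullet> \<xi>)) * G \<xi> * fourier_kernel \<phi> \<xi> \<partial>lborel)"
    by (simp only: inner)
  also have "\<dots> = (\<integral>\<xi>. exp (2 * of_real pi * \<i> * of_real (x \<bullet> \<xi>)) * G \<xi> \<partial>lborel)"
  proof (rule integral_cong_AE)
    \<comment> \<open>Fubini also supplies the measurability of the product with
      \<open>fourier_kernel \<phi>\<close>. The equality holds almost everywhere only, since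
      \<open>one\<close> is about F and the integrand contains its representative G.\<close>
    have "integrable lborel (\<lambda>\<xi>. \<integral>y. \<phi> y *\<^sub>R H y \<xi> \<partial>lborel)"
      by (rule Fubini_kernel(1)[OF bdd_kernelD(1)[OF \<phi>] Hm Hi Hb])
    then show "(\<lambda>\<xi>. exp (2 * of_real pi * \<i> * of_real (x \<bullet> \<xi>)) * G \<xi> * fourier_kernel \<phi> \<xi>) \<in> borel_measurable lborel"
      unfolding inner by auto
    have "AE \<xi> in lborel. F \<xi> = G \<xi>" using G(2) by (simp add: AE_completion_iff)
    then show "AE \<xi> in lborel. exp (2 * of_real pi * \<i> * of_real (x \<bullet> \<xi>)) * G \<xi> * fourier_kernel \<phi> \<xi> = exp (2 * of_real pi * \<i> * of_real (x \<bullet> \<xi>)) * G \<xi>"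
      by eventually_elim (use one in force)
  qed measurable
  finally show ?thesis unfolding G(3) .
qed

lemma fourier_eq_lborel:
  assumes "g \<in> borel_measurable borel"
  shows "fourier g \<xi> = (\<integral>x. exp (- (2 * of_real pi * \<i> * of_real (x \<bullet> \<xi>))) * g x \<partial>lborel)"
  unfolding fourier_def using assms by (intro integral_completion) measurable

lemma lp_space_1_integrable: "f \<in> lp_space M 1 \<Longrightarrow> integrable M f"
  using integrable_norm_iff[of f M] by (auto simp: lp_space_def)

lemma lp_norm_1: "lp_norm M 1 f = (\<integral>x. norm (f x) \<partial>M)"
  by (simp add: lp_norm_def)

lemma fourier_bound:
  assumes "g \<in> lp_space lborel 1"
  shows "norm (fourier g \<xi>) \<le> lp_norm lborel 1 g"
proof -
  have m: "g \<in> borel_measurable borel" using lp_space_measurable[OF assms] by simp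
  show ?thesis unfolding fourier_eq_lborel[OF m] lp_norm_1
    by (rule order_trans[OF integral_norm_bound]) (simp add: norm_mult)
qed

lemma fourier_measurable:
  assumes "g \<in> borel_measurable borel"
  shows "fourier g \<in> borel_measurable borel"
proof -
  have [measurable]: "g \<in> borel_measurable borel" by fact
  have "(\<lambda>\<xi>. \<integral>x. exp (- (2 * of_real pi * \<i> * of_real (x \<bullet> \<xi>))) * g x \<partial>lborel) \<in> borel_measurable borel"
    by (rule sigma_finite_measure.borel_measurable_lebesgue_integral) (auto intro: sigma_finite_lborel)
  then show ?thesis using fourier_eq_lborel[OF assms] by (simp cong: measurable_cong)
qed

lemma fourier_diff:
  assumes f: "f \<in> lp_space lborel 1" and g: "g \<in> lp_space lborel 1"
  shows "fourier (\<lambda>x. f x - g x) \<xi> = fourier f \<xi> - fourier g \<xi>"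
proof -
  have m: "f \<in> borel_measurable borel" "g \<in> borel_measurable borel" "(\<lambda>x. f x - g x) \<in> borel_measurable borel"
    using lp_space_measurable[OF f] lp_space_measurable[OF g] by simp_all
  show ?thesis unfolding fourier_eq_lborel[OF m(1)] fourier_eq_lborel[OF m(2)] fourier_eq_lborel[OF m(3)] right_diff_distrib
    by (intro Bochner_Integration.integral_diff fourier_exp_integrable lp_space_1_integrable f g)
qed

lemma fourier_conv:
  assumes g: "g \<in> lp_space lborel 1" and \<phi>: "bdd_kernel \<phi>"
  shows "fourier (conv \<phi> g) \<xi> = fourier_kernel \<phi> \<xi> * fourier g \<xi>"
proof -
  note [measurable] = bdd_kernelD(2)[OF \<phi>]
  have m [measurable]: "g \<in> borel_measurable borel" using lp_space_measurable[OF g] by simp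
  have gi: "integrable lborel g" by (rule lp_space_1_integrable[OF g])
  define E where "E x = exp (- (2 * of_real pi * \<i> * complex_of_real (x \<bullet> \<xi>)))" for x
  have [measurable]: "E \<in> borel_measurable borel" unfolding E_def by measurable
  define H where "H y x = E x * g (x - y)" for y x
  have Hm: "(\<lambda>(y, x). H y x) \<in> borel_measurable (borel \<Otimes>\<^sub>M borel)" unfolding H_def by measurable
  have Hi: "integrable lborel (H y)" for y
    unfolding H_def E_def by (rule fourier_exp_integrable[OF lborel_integrable_shift(2)[OF gi]])
  have nE: "norm (E x) = 1" for x by (simp add: E_def)
  have Hb: "(\<integral>x. norm (H y x) \<partial>lborel) \<le> (\<integral>x. norm (g x) \<partial>lborel)" for y
    using lborel_integral_shift(2)[of "\<lambda>x. norm (g x)" y] by (simp add: H_def norm_mult nE)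
  have Hy: "(\<integral>x. H y x \<partial>lborel) = E y * fourier g \<xi>" for y
  proof -
    have "(\<integral>x. H y x \<partial>lborel) = (\<integral>x. E (x + y) * g x \<partial>lborel)"
      unfolding H_def using lborel_integral_shift(2)[of "\<lambda>x. E (x + y) * g x" y] by simp
    also have "\<dots> = (\<integral>x. E y * (E x * g x) \<partial>lborel)"
    proof -
      have "E (x + y) = E y * E x" for x
        by (simp add: E_def inner_add_left distrib_left mult_exp_exp add.commute)
      then show ?thesis by (simp add: mult.assoc)
    qed
    finally show ?thesis unfolding fourier_eq_lborel[OF m] E_def by (simp only: integral_mult_right_zero)
  qed
  have cm: "conv \<phi> g \<in> borel_measurable borel" by measurable
  have "fourier (conv \<phi> g) \<xi> = (\<integral>x. (\<integral>y. \<phi> y *\<^sub>R H y x \<partial>lborel) \<partial>lborel)"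
    unfolding fourier_eq_lborel[OF cm] E_def[symmetric] conv_def integral_mult_right_zero[symmetric] H_def by simp
  also have "\<dots> = (\<integral>y. \<phi> y *\<^sub>R (\<integral>x. H y x \<partial>lborel) \<partial>lborel)"
    by (rule Fubini_kernel(3)[OF bdd_kernelD(1)[OF \<phi>] Hm Hi Hb])
  also have "\<dots> = (\<integral>y. (E y * of_real (\<phi> y)) * fourier g \<xi> \<partial>lborel)"
    unfolding Hy by (simp add: scaleR_conv_of_real mult_ac)
  also have "\<dots> = fourier_kernel \<phi> \<xi> * fourier g \<xi>"
    unfolding fourier_kernel_def E_def by (simp only: integral_mult_left_zero)
  finally show ?thesis .
qed

section \<open>A single multiplier with dyadic symbol and its extension to L^p\<close>

lemma LIMSEQ_zero_if_bounded_multiple: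
  fixes a :: "nat \<Rightarrow> 'a::real_normed_vector" and b :: "nat \<Rightarrow> real"
  assumes "\<And>k. norm (a k) \<le> V * b k" "b \<longlonglongrightarrow> 0"
  shows "a \<longlonglongrightarrow> 0"
proof (rule Lim_null_comparison[OF always_eventually])
  show "\<forall>k. norm (a k) \<le> V * b k" using assms(1) by blast
  show "(\<lambda>k. V * b k) \<longlonglongrightarrow> 0" using tendsto_mult_left[OF assms(2), of V] by simp
qed

text \<open>The bound is required on Schwartz functions only, where the operator is given by its
  integral formula and no choice of an extension is involved.\<close>

locale bounded_multiplier =
  fixes p q A :: real and j :: int and m :: "real^'n \<Rightarrow> complex"
  assumes p: "1 < p" and q: "1 < q" and symbol: "dyadic_symbol j m" and A: "0 \<le> A"
    and bound: "\<And>g. g \<in> schwartz \<Longrightarrow> Lp_norm q (inv_fourier (\<lambda>\<xi>. m \<xi> * fourier g \<xi>)) \<le> ennreal A * Lp_norm p g"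
begin

definition T :: "(real^'n \<Rightarrow> complex) \<Rightarrow> real^'n \<Rightarrow> complex" where
  "T g = inv_fourier (\<lambda>\<xi>. m \<xi> * fourier g \<xi>)"

lemma exponents: "1 \<le> p" "0 < p" "1 \<le> q" "0 < q"
  using p q by auto

text \<open>Bounded with bounded support. Hence the defining integral of T g converges absolutely
  for every integrable g, and T maps L^1 continuously into the bounded functions.\<close>

lemma symbol_integrable: "integrable lebesgue m"
proof -
  obtain B where B: "\<And>\<xi>. norm (m \<xi>) \<le> B"
    using symbol unfolding dyadic_symbol_def bounded_iff by auto
  have supp: "m \<xi> = 0" if "\<xi> \<notin> cball 0 (2 powi (j + 1))" for \<xi>
    using symbol that by (auto simp: dyadic_symbol_def)
  show ?thesis
  proof (rule integrableI_bounded_set[where A = "cball 0 (2 powi (j + 1))" and B = B])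
    show "m \<in> borel_measurable lebesgue" using symbol by (simp add: dyadic_symbol_def)
    show "emeasure lebesgue (cball (0::real^'n) (2 powi (j + 1))) < \<infinity>"
      using emeasure_lborel_cball_finite[of "0::real^'n" "2 powi (j + 1)"] by simp
  qed (use B supp in auto)
qed

lemma symbol_fourier_integrable:
  assumes g: "g \<in> lp_space lborel 1"
  shows "integrable lebesgue (\<lambda>\<xi>. m \<xi> * fourier g \<xi>)"
    and "(\<integral>\<xi>. norm (m \<xi> * fourier g \<xi>) \<partial>lebesgue) \<le> (\<integral>\<xi>. norm (m \<xi>) \<partial>lebesgue) * lp_norm lborel 1 g"
proof -
  have "g \<in> borel_measurable borel" using lp_space_measurable[OF g] by simp
  then have fm: "fourier g \<in> borel_measurable lborel" using fourier_measurable by simp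
  have bd: "norm (m \<xi> * fourier g \<xi>) \<le> norm (m \<xi>) * lp_norm lborel 1 g" for \<xi>
    unfolding norm_mult by (intro mult_left_mono fourier_bound g) auto
  have i: "integrable lebesgue (\<lambda>\<xi>. norm (m \<xi>) * lp_norm lborel 1 g)" using symbol_integrable by simp
  show int: "integrable lebesgue (\<lambda>\<xi>. m \<xi> * fourier g \<xi>)"
  proof (rule Bochner_Integration.integrable_bound[OF i])
    show "(\<lambda>\<xi>. m \<xi> * fourier g \<xi>) \<in> borel_measurable lebesgue"
      using borel_measurable_integrable[OF symbol_integrable] measurable_completion[OF fm]
      by (rule borel_measurable_times)
  qed (use bd in auto)
  have "(\<integral>\<xi>. norm (m \<xi> * fourier g \<xi>) \<partial>lebesgue) \<le> (\<integral>\<xi>. norm (m \<xi>) * lp_norm lborel 1 g \<partial>lebesgue)"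
    using int i bd by (intro integral_mono) auto
  then show "(\<integral>\<xi>. norm (m \<xi> * fourier g \<xi>) \<partial>lebesgue) \<le> (\<integral>\<xi>. norm (m \<xi>) \<partial>lebesgue) * lp_norm lborel 1 g"
    by simp
qed

lemma T_measurable: "g \<in> lp_space lborel 1 \<Longrightarrow> T g \<in> borel_measurable borel"
  unfolding T_def by (intro inv_fourier_measurable symbol_fourier_integrable)

lemma T_diff:
  assumes "f \<in> lp_space lborel 1" "g \<in> lp_space lborel 1"
  shows "T (\<lambda>x. f x - g x) x = T f x - T g x"
  unfolding T_def fourier_diff[OF assms] right_diff_distrib
  by (intro inv_fourier_diff symbol_fourier_integrable assms)

lemma T_sup_bound:
  assumes "g \<in> lp_space lborel 1"
  shows "norm (T g x) \<le> (\<integral>\<xi>. norm (m \<xi>) \<partial>lebesgue) * lp_norm lborel 1 g"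
  unfolding T_def using norm_inv_fourier_le[OF symbol_fourier_integrable(1)[OF assms], of x]
    symbol_fourier_integrable(2)[OF assms] by linarith

lemma T_schwartz:
  assumes g: "g \<in> schwartz"
  shows "T g \<in> lp_space lborel q" "lp_norm lborel q (T g) \<le> A * lp_norm lborel p g"
proof -
  have g1: "g \<in> lp_space lborel 1" and gp: "g \<in> lp_space lborel p"
    using schwartz_lp[OF g] exponents by auto
  have gm: "g \<in> borel_measurable borel" using lp_space_measurable[OF g1] by simp
  have Tm: "T g \<in> borel_measurable borel" by (rule T_measurable[OF g1])
  have "Lp_norm p g = ennreal (lp_norm lborel p g)"
    using Lp_norm_eq_lp_norm[OF exponents(2)] gp lp_space_lebesgue_borel[OF gm] by metis
  then have le: "Lp_norm q (T g) \<le> ennreal (A * lp_norm lborel p g)"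
    using bound[OF g] A by (simp add: T_def ennreal_mult)
  then have "Lp_norm q (T g) < \<infinity>" by (simp add: order_le_less_trans)
  then have "T g \<in> Lp q" using measurable_completion[of "T g" lborel borel] Tm by (simp add: Lp_def)
  then have 1: "T g \<in> lp_space lebesgue q" using Lp_iff_lp_space[OF exponents(4)] by blast
  then show "T g \<in> lp_space lborel q" using lp_space_lebesgue_borel(1)[OF Tm] by blast
  show "lp_norm lborel q (T g) \<le> A * lp_norm lborel p g"
    using le A unfolding Lp_norm_eq_lp_norm[OF exponents(4) 1] lp_space_lebesgue_borel(2)[OF Tm] by simp
qed

text \<open>Needed for convolutions of Schwartz functions with the kernels, which are in L^1 and L^p
  but need not be Schwartz functions. Along an approximating sequence the images converge pointwise
  by the L^1 sup bound, and Fatou's lemma keeps the L^q bound.\<close>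

lemma T_bound:
  assumes u: "u \<in> lp_space lborel 1" "u \<in> lp_space lborel p"
  shows "T u \<in> lp_space lborel q" "lp_norm lborel q (T u) \<le> A * lp_norm lborel p u"
proof -
  obtain g where g: "\<And>k. g k \<in> schwartz" and l1: "(\<lambda>k. lp_norm lborel 1 (\<lambda>x. g k x - u x)) \<longlonglongrightarrow> 0"
    and lp: "(\<lambda>k. lp_norm lborel p (\<lambda>x. g k x - u x)) \<longlonglongrightarrow> 0"
    using schwartz_dense_both[OF exponents(1) u] by blast
  have g1: "g k \<in> lp_space lborel 1" and gp: "g k \<in> lp_space lborel p" for k
    using schwartz_lp[OF g] exponents by auto
  define V where "V = (\<integral>\<xi>. norm (m \<xi>) \<partial>lebesgue)"
  have pt: "(\<lambda>k. T (g k) x) \<longlonglongrightarrow> T u x" for x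
  proof -
    have "norm (T (g k) x - T u x) \<le> V * lp_norm lborel 1 (\<lambda>x. g k x - u x)" for k
      unfolding T_diff[OF g1 u(1), symmetric] V_def
      by (rule T_sup_bound[OF lp_diff(1)[OF _ g1 u(1)]]) simp
    from this l1 have "(\<lambda>k. T (g k) x - T u x) \<longlonglongrightarrow> 0"
      by (rule LIMSEQ_zero_if_bounded_multiple)
    then show ?thesis by (simp add: LIM_zero_iff)
  qed
  have Tum: "T u \<in> borel_measurable lborel" using T_measurable[OF u(1)] by simp
  have main: "T u \<in> lp_space lborel q \<and> lp_norm lborel q (T u) \<le> A * (lp_norm lborel p u + e)" if e: "0 < e" for e
  proof -
    obtain N where N: "\<And>k. N \<le> k \<Longrightarrow> lp_norm lborel p (\<lambda>x. g k x - u x) < e"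
      using order_tendstoD(2)[OF lp e] unfolding eventually_sequentially by blast
    have B: "lp_norm lborel q (T (g (k + N))) \<le> A * (lp_norm lborel p u + e)" for k
    proof -
      have "lp_norm lborel p (g (k + N)) \<le> lp_norm lborel p u + e"
        using lp_norm_triangle_sub[OF exponents(1) gp u(2), of "k + N"] N[of "k + N"] by simp
      then show ?thesis using T_schwartz(2)[OF g, of "k + N"] A mult_left_mono order_trans by meson
    qed
    have lim: "AE x in lborel. (\<lambda>k. T (g (k + N)) x) \<longlonglongrightarrow> T u x"
      by (intro AE_I2 LIMSEQ_ignore_initial_segment pt)
    show ?thesis using lp_Fatou[OF exponents(4) T_schwartz(1)[OF g] B Tum lim] by blast
  qed
  show "T u \<in> lp_space lborel q" using main[of 1] by simp
  show "lp_norm lborel q (T u) \<le> A * lp_norm lborel p u"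
  proof (rule field_le_epsilon)
    fix e :: real assume e: "0 < e"
    \<comment> \<open>The divisor A + 1 covers the case A = 0.\<close>
    have "lp_norm lborel q (T u) \<le> A * (lp_norm lborel p u + e / (A + 1))" using main[of "e / (A + 1)"] e A by simp
    also have "\<dots> \<le> A * lp_norm lborel p u + e"
    proof -
      have "A * (e / (A + 1)) \<le> (A + 1) * (e / (A + 1))" using e A by (intro mult_right_mono) auto
      also have "\<dots> = e" using A by simp
      finally show ?thesis by (simp add: distrib_left)
    qed
    finally show "lp_norm lborel q (T u) \<le> A * lp_norm lborel p u + e" .
  qed
qed

lemma T_reproducing:
  assumes u: "u \<in> lp_space lborel 1" and \<phi>: "bdd_kernel \<phi>"
    and one: "\<And>\<xi>. 2 powi (j - 1) \<le> norm \<xi> \<Longrightarrow> norm \<xi> \<le> 2 powi (j + 1) \<Longrightarrow> fourier_kernel \<phi> \<xi> = 1"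
  shows "conv \<phi> (T u) = T u" "T (conv \<phi> u) = T u"
proof -
  have m1: "fourier_kernel \<phi> \<xi> = 1" if "m \<xi> \<noteq> 0" for \<xi>
    using symbol that one by (auto simp: dyadic_symbol_def)
  show "conv \<phi> (T u) = T u"
    unfolding T_def by (intro ext conv_inv_fourier[OF symbol_fourier_integrable(1)[OF u] \<phi>] m1) auto
  have "m \<xi> * fourier (conv \<phi> u) \<xi> = m \<xi> * fourier u \<xi>" for \<xi>
    unfolding fourier_conv[OF u \<phi>] using m1[of \<xi>] by (cases "m \<xi> = 0") auto
  then have "(\<lambda>\<xi>. m \<xi> * fourier (conv \<phi> u) \<xi>) = (\<lambda>\<xi>. m \<xi> * fourier u \<xi>)" by (rule ext)
  then show "T (conv \<phi> u) = T u" unfolding T_def by (rule arg_cong)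
qed

lemma schwartz_lp_lebesgue: "g \<in> schwartz \<Longrightarrow> g \<in> lp_space lebesgue p"
  using lp_space_lebesgue_borel(1)[OF schwartz_measurable] schwartz_lp exponents(1) by blast

lemma T_lp_lebesgue:
  assumes "g \<in> schwartz"
  shows "T g \<in> lp_space lebesgue q" "lp_norm lebesgue q (T g) \<le> A * lp_norm lebesgue p g"
proof -
  have m: "T g \<in> borel_measurable borel" by (rule T_measurable[OF schwartz_lp[OF assms]]) simp
  show "T g \<in> lp_space lebesgue q" "lp_norm lebesgue q (T g) \<le> A * lp_norm lebesgue p g"
    using T_schwartz[OF assms] lp_space_lebesgue_borel[OF m] lp_space_lebesgue_borel[OF schwartz_measurable[OF assms]]
    by auto
qed

lemma T_diff_bound:
  assumes "f \<in> schwartz" "g \<in> schwartz"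
  shows "lp_norm lebesgue q (\<lambda>x. T f x - T g x) \<le> A * lp_norm lebesgue p (\<lambda>x. f x - g x)"
proof -
  have "T (\<lambda>x. f x - g x) = (\<lambda>x. T f x - T g x)"
    by (rule ext) (rule T_diff[OF schwartz_lp[OF assms(1) order_refl] schwartz_lp[OF assms(2) order_refl]])
  then show ?thesis using T_lp_lebesgue(2)[OF schwartz_diff[OF assms]] by simp
qed

text \<open>The predicate under the choice operator in \<open>density_extension\<close>, specialised
  to T.\<close>

definition extends_to :: "(real^'n \<Rightarrow> complex) \<Rightarrow> (real^'n \<Rightarrow> complex) \<Rightarrow> bool" where
  "extends_to f h \<longleftrightarrow> h \<in> Lp q \<and>
        (\<forall>g :: nat \<Rightarrow> (real^'n \<Rightarrow> complex).
           range g \<subseteq> schwartz \<and> (\<lambda>k. Lp_norm p (\<lambda>x. g k x - f x)) \<longlonglongrightarrow> 0 \<longrightarrow>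
           (\<lambda>k. Lp_norm q (\<lambda>x. T (g k) x - h x)) \<longlonglongrightarrow> 0)"

lemma extends_to_iff:
  assumes f: "f \<in> lp_space lebesgue p"
  shows "extends_to f h \<longleftrightarrow> h \<in> lp_space lebesgue q \<and>
     (\<forall>g. (\<forall>k. g k \<in> schwartz) \<and> (\<lambda>k. lp_norm lebesgue p (\<lambda>x. g k x - f x)) \<longlonglongrightarrow> 0 \<longrightarrow>
       (\<lambda>k. lp_norm lebesgue q (\<lambda>x. T (g k) x - h x)) \<longlonglongrightarrow> 0)"
proof -
  have 1: "(\<lambda>k. Lp_norm p (\<lambda>x. g k x - f x)) \<longlonglongrightarrow> 0 \<longleftrightarrow> (\<lambda>k. lp_norm lebesgue p (\<lambda>x. g k x - f x)) \<longlonglongrightarrow> 0"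
    if "\<And>k. g k \<in> schwartz" for g
    unfolding Lp_norm_eq_lp_norm[OF exponents(2) lp_diff(1)[OF exponents(1) schwartz_lp_lebesgue[OF that] f]]
    by (simp add: ennreal_tendsto_0_iff)
  have 2: "(\<lambda>k. Lp_norm q (\<lambda>x. T (g k) x - h x)) \<longlonglongrightarrow> 0 \<longleftrightarrow> (\<lambda>k. lp_norm lebesgue q (\<lambda>x. T (g k) x - h x)) \<longlonglongrightarrow> 0"
    if "\<And>k. g k \<in> schwartz" "h \<in> lp_space lebesgue q" for g
    unfolding Lp_norm_eq_lp_norm[OF exponents(4) lp_diff(1)[OF exponents(3) T_lp_lebesgue(1)[OF that(1)] that(2)]]
    by (simp add: ennreal_tendsto_0_iff)
  show ?thesis
    unfolding extends_to_def Lp_iff_lp_space[OF exponents(4)] image_subset_iff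
    using 1 2 by (intro conj_cong refl iff_allI imp_cong) auto
qed

text \<open>One approximating sequence is enough: T is Lipschitz between the norms, so any other
  sequence with the same limit has images approaching the same function.\<close>

lemma extends_toI:
  assumes f: "f \<in> lp_space lebesgue p" and h: "h \<in> lp_space lebesgue q" and g0: "\<And>k. g0 k \<in> schwartz"
    and l0: "(\<lambda>k. lp_norm lebesgue p (\<lambda>x. g0 k x - f x)) \<longlonglongrightarrow> 0" "(\<lambda>k. lp_norm lebesgue q (\<lambda>x. T (g0 k) x - h x)) \<longlonglongrightarrow> 0"
  shows "extends_to f h"
  unfolding extends_to_iff[OF f]
proof (intro conjI h allI impI, elim conjE)
  fix g assume g: "\<forall>k. g k \<in> schwartz" and l: "(\<lambda>k. lp_norm lebesgue p (\<lambda>x. g k x - f x)) \<longlonglongrightarrow> 0"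
  have g: "g k \<in> schwartz" for k using g by simp
  have est: "lp_norm lebesgue q (\<lambda>x. T (g k) x - h x) \<le>
    A * (lp_norm lebesgue p (\<lambda>x. g k x - f x) + lp_norm lebesgue p (\<lambda>x. g0 k x - f x)) + lp_norm lebesgue q (\<lambda>x. T (g0 k) x - h x)" for k
  proof -
    have "lp_norm lebesgue p (\<lambda>x. g k x - g0 k x) \<le> lp_norm lebesgue p (\<lambda>x. g k x - f x) + lp_norm lebesgue p (\<lambda>x. g0 k x - f x)"
      using lp_norm_triangle3[OF exponents(1) schwartz_lp_lebesgue[OF g] f schwartz_lp_lebesgue[OF g0], of k k]
        lp_norm_diff_commute[of lebesgue p f "g0 k"] by simp
    then have "A * lp_norm lebesgue p (\<lambda>x. g k x - g0 k x) \<le> A * (lp_norm lebesgue p (\<lambda>x. g k x - f x) + lp_norm lebesgue p (\<lambda>x. g0 k x - f x))"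
      using A by (rule mult_left_mono)
    then show ?thesis
      using lp_norm_triangle3[OF exponents(3) T_lp_lebesgue(1)[OF g] T_lp_lebesgue(1)[OF g0] h, of k k] T_diff_bound[OF g g0, of k k]
      by linarith
  qed
  define r where "r k = A * (lp_norm lebesgue p (\<lambda>x. g k x - f x) + lp_norm lebesgue p (\<lambda>x. g0 k x - f x)) + lp_norm lebesgue q (\<lambda>x. T (g0 k) x - h x)" for k
  have "r \<longlonglongrightarrow> A * (0 + 0) + 0"
    unfolding r_def by (intro tendsto_intros l l0)
  then have "r \<longlonglongrightarrow> 0" by simp
  have "norm (lp_norm lebesgue q (\<lambda>x. T (g k) x - h x)) \<le> 1 * r k" for k
    using est[of k] by (simp add: r_def)
  from this \<open>r \<longlonglongrightarrow> 0\<close> show "(\<lambda>k. lp_norm lebesgue q (\<lambda>x. T (g k) x - h x)) \<longlonglongrightarrow> 0"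
    by (rule LIMSEQ_zero_if_bounded_multiple)
qed

text \<open>The same sequence approximates f and its Borel representative f': the former is what the
  operator is applied to, the latter what is convolved.\<close>

lemma schwartz_dense_lebesgue:
  assumes f: "f \<in> lp_space lebesgue p"
  obtains f' g where "f' \<in> lp_space lborel p" "lp_norm lborel p f' = lp_norm lebesgue p f" "\<And>k. g k \<in> schwartz"
    "(\<lambda>k. lp_norm lborel p (\<lambda>x. g k x - f' x)) \<longlonglongrightarrow> 0" "(\<lambda>k. lp_norm lebesgue p (\<lambda>x. g k x - f x)) \<longlonglongrightarrow> 0"
proof -
  obtain f' where f': "f' \<in> borel_measurable borel" "AE x in lebesgue. f x = f' x"
    using lebesgue_ex_borel_complex[OF lp_space_measurable[OF f]] by blast
  have f'm: "f' \<in> borel_measurable lebesgue" using f'(1) by (simp add: measurable_completion)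
  have "AE x in lebesgue. norm (f' x) = norm (f x)" using f'(2) by eventually_elim simp
  then have f'p: "f' \<in> lp_space lborel p" "lp_norm lborel p f' = lp_norm lebesgue p f"
    using lp_norm_eq_norm[OF exponents(2) f f'm] lp_space_lebesgue_borel[OF f'(1)] by auto
  obtain g where g: "\<And>k. g k \<in> schwartz" "(\<lambda>k. lp_norm lborel p (\<lambda>x. g k x - f' x)) \<longlonglongrightarrow> 0"
    using schwartz_dense[OF exponents(1) f'p(1)] by blast
  have "lp_norm lborel p (\<lambda>x. g k x - f' x) = lp_norm lebesgue p (\<lambda>x. g k x - f x)" for k
  proof -
    have gm: "g k \<in> borel_measurable borel" by (rule schwartz_measurable[OF g(1)])
    then have dm: "(\<lambda>x. g k x - f' x) \<in> borel_measurable borel" using f'(1) by measurable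
    have gl: "g k \<in> borel_measurable lebesgue" using gm by (simp add: measurable_completion)
    have "lp_norm lebesgue p (\<lambda>x. g k x - f' x) = lp_norm lebesgue p (\<lambda>x. g k x - f x)"
    proof (rule lp_norm_cong_AE)
      show "AE x in lebesgue. g k x - f' x = g k x - f x" using f'(2) by eventually_elim simp
    qed (intro borel_measurable_diff gl f'm lp_space_measurable[OF f])+
    then show ?thesis using lp_space_lebesgue_borel(2)[OF dm] by metis
  qed
  then show thesis using that[OF f'p g] g(2) by simp
qed

lemma extends_to_exists:
  assumes f: "f \<in> lp_space lebesgue p"
  shows "\<exists>h. extends_to f h"
proof -
  obtain f' g where g: "\<And>k. g k \<in> schwartz" "(\<lambda>k. lp_norm lebesgue p (\<lambda>x. g k x - f x)) \<longlonglongrightarrow> 0"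
    by (rule schwartz_dense_lebesgue[OF f]) blast
  have "\<exists>N. \<forall>m\<ge>N. \<forall>n\<ge>N. lp_norm lebesgue q (\<lambda>x. T (g m) x - T (g n) x) < e" if e: "0 < e" for e
  proof -
    define d where "d = e / (2 * (A + 1))"
    have d: "0 < d" using e A by (simp add: d_def)
    obtain N where N: "\<And>k. N \<le> k \<Longrightarrow> lp_norm lebesgue p (\<lambda>x. g k x - f x) < d"
      using order_tendstoD(2)[OF g(2) d] unfolding eventually_sequentially by blast
    have "lp_norm lebesgue q (\<lambda>x. T (g m) x - T (g n) x) < e" if "N \<le> m" "N \<le> n" for m n
    proof -
      have "lp_norm lebesgue p (\<lambda>x. g m x - g n x) \<le> 2 * d"
        using lp_norm_triangle3[OF exponents(1) schwartz_lp_lebesgue[OF g(1)] f schwartz_lp_lebesgue[OF g(1)], of m n]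
          lp_norm_diff_commute[of lebesgue p f "g n"] N[OF that(1)] N[OF that(2)] by simp
      then have "A * lp_norm lebesgue p (\<lambda>x. g m x - g n x) \<le> A * (2 * d)" using A by (rule mult_left_mono)
      also have "\<dots> < (A + 1) * (2 * d)" using d by simp
      also have "\<dots> = e"
      proof -
        have "A + 1 \<noteq> 0" using A by linarith
        then show ?thesis by (simp add: d_def divide_simps)
      qed
      finally show ?thesis using T_diff_bound[OF g(1) g(1), of m n] by simp
    qed
    then show ?thesis by blast
  qed
  from lp_complete[OF exponents(3) T_lp_lebesgue(1)[OF g(1)] this]
  obtain h where "h \<in> lp_space lebesgue q" "(\<lambda>k. lp_norm lebesgue q (\<lambda>x. T (g k) x - h x)) \<longlonglongrightarrow> 0" by blast
  then show ?thesis using extends_toI[OF f _ g] by blast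
qed

text \<open>Both branches of \<open>multiplier_op\<close> satisfy the same characterisation: on a
  Schwartz function the constant sequence shows it for the integral formula, elsewhere it is the
  property of the chosen function, whose existence follows by completeness.\<close>

lemma multiplier_op_extends:
  assumes f: "f \<in> lp_space lebesgue p"
  shows "extends_to f (multiplier_op p q m f)"
proof (cases "f \<in> schwartz")
  case True
  then have "multiplier_op p q m f = T f" by (simp add: multiplier_op_def T_def Let_def)
  moreover have "extends_to f (T f)"
    by (rule extends_toI[OF f T_lp_lebesgue(1)[OF True], of "\<lambda>k. f"]) (use True in simp_all)
  ultimately show ?thesis by simp
next
  case False
  then have "multiplier_op p q m f = (SOME h. extends_to f h)"
    by (simp add: multiplier_op_def density_extension_def extends_to_def T_def[abs_def] Let_def)
  then show ?thesis using someI_ex[OF extends_to_exists[OF f]] by simp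
qed

lemma multiplier_op_lp: "f \<in> lp_space lebesgue p \<Longrightarrow> multiplier_op p q m f \<in> lp_space lebesgue q"
  using multiplier_op_extends extends_to_iff by blast

lemma multiplier_op_limit:
  assumes "f \<in> lp_space lebesgue p" "\<And>k. g k \<in> schwartz" "(\<lambda>k. lp_norm lebesgue p (\<lambda>x. g k x - f x)) \<longlonglongrightarrow> 0"
  shows "(\<lambda>k. lp_norm lebesgue q (\<lambda>x. T (g k) x - multiplier_op p q m f x)) \<longlonglongrightarrow> 0"
  using multiplier_op_extends[OF assms(1)] extends_to_iff[OF assms(1)] assms(2,3) by blast

end

text \<open>The reproducing formulas hold for T on integrable functions, not for the chosen values
  at a general f. The inequality is therefore shown for Schwartz g k tending to f; for finite J both
  sides depend continuously on g k in L^p, the right-hand side through the Borel representative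
  f'.\<close>

lemma multiplier_sum_bound:
  fixes m :: "int \<Rightarrow> real^'n \<Rightarrow> complex" and \<psi> :: "int \<Rightarrow> real^'n \<Rightarrow> real"
  assumes p: "1 < p" and q: "2 \<le> q" and \<psi>: "dyadic_kernels \<psi> K"
    and one: "\<And>j \<xi>. 2 powi (j - 1) \<le> norm \<xi> \<Longrightarrow> norm \<xi> \<le> 2 powi (j + 1) \<Longrightarrow> fourier_kernel (\<psi> j) \<xi> = 1"
    and m: "\<And>j. bounded_multiplier p q A j (m j)"
    and f: "f \<in> lp_space lebesgue p"
  obtains f' where "f' \<in> lp_space lborel p" "lp_norm lborel p f' = lp_norm lebesgue p f"
    "\<And>J. finite J \<Longrightarrow> lp_norm lebesgue q (\<lambda>x. \<Sum>j\<in>J. multiplier_op p q (m j) f x)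
      \<le> sqrt (\<Sum>j\<in>J. dyadic_kernels.sq_const K q * A\<^sup>2 * (lp_norm lborel p (conv (\<psi> j) f'))\<^sup>2)"
proof -
  interpret dyadic_kernels \<psi> K by (rule \<psi>)
  interpret M: bounded_multiplier p q A j "m j" for j by (rule m)
  note ex = M.exponents
  obtain f' g where f': "f' \<in> lp_space lborel p" "lp_norm lborel p f' = lp_norm lebesgue p f" and g: "\<And>k. g k \<in> schwartz"
    "(\<lambda>k. lp_norm lborel p (\<lambda>x. g k x - f' x)) \<longlonglongrightarrow> 0" "(\<lambda>k. lp_norm lebesgue p (\<lambda>x. g k x - f x)) \<longlonglongrightarrow> 0"
    by (rule M.schwartz_dense_lebesgue[OF f]) blast
  have g1: "g k \<in> lp_space lborel 1" and gp: "g k \<in> lp_space lborel p" for k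
    using schwartz_lp[OF g(1)] ex(1) by auto
  define c where "c = sq_const q"
  have c0: "0 \<le> c" by (simp add: c_def sq_const_def)
  have "lp_norm lebesgue q (\<lambda>x. \<Sum>j\<in>J. multiplier_op p q (m j) f x)
      \<le> sqrt (\<Sum>j\<in>J. c * A\<^sup>2 * (lp_norm lborel p (conv (\<psi> j) f'))\<^sup>2)" if J: "finite J" for J
  proof -
    define s where "s k x = (\<Sum>j\<in>J. M.T j (g k) x)" for k x
    define h where "h x = (\<Sum>j\<in>J. multiplier_op p q (m j) f x)" for x
    have s: "s k \<in> lp_space lebesgue q" for k
      unfolding s_def by (rule lp_sum(1)[OF ex(3)]) (rule M.T_lp_lebesgue(1)[OF g(1)])
    have h: "h \<in> lp_space lebesgue q"
      unfolding h_def by (rule lp_sum(1)[OF ex(3)]) (rule M.multiplier_op_lp[OF f])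
    have sh: "(\<lambda>k. lp_norm lebesgue q (\<lambda>x. s k x - h x)) \<longlonglongrightarrow> 0"
    proof (rule Lim_null_comparison[OF always_eventually])
      show "(\<lambda>k. \<Sum>j\<in>J. lp_norm lebesgue q (\<lambda>x. M.T j (g k) x - multiplier_op p q (m j) f x)) \<longlonglongrightarrow> 0"
        by (intro tendsto_null_sum M.multiplier_op_limit[OF f g(1) g(3)])
      show "\<forall>k. norm (lp_norm lebesgue q (\<lambda>x. s k x - h x)) \<le> (\<Sum>j\<in>J. lp_norm lebesgue q (\<lambda>x. M.T j (g k) x - multiplier_op p q (m j) f x))"
      proof
        fix k
        have "lp_norm lebesgue q (\<lambda>x. \<Sum>j\<in>J. M.T j (g k) x - multiplier_op p q (m j) f x) \<le> (\<Sum>j\<in>J. lp_norm lebesgue q (\<lambda>x. M.T j (g k) x - multiplier_op p q (m j) f x))"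
          by (rule lp_sum(2)[OF ex(3)]) (rule lp_diff(1)[OF ex(3) M.T_lp_lebesgue(1)[OF g(1)] M.multiplier_op_lp[OF f]])
        then show "norm (lp_norm lebesgue q (\<lambda>x. s k x - h x)) \<le> (\<Sum>j\<in>J. lp_norm lebesgue q (\<lambda>x. M.T j (g k) x - multiplier_op p q (m j) f x))"
          by (simp add: s_def h_def sum_subtractf)
      qed
    qed
    have "lp_norm lebesgue q (s k) \<le> sqrt (\<Sum>j\<in>J. c * A\<^sup>2 * (lp_norm lborel p (conv (\<psi> j) (g k)))\<^sup>2)" for k
    proof -
      \<comment> \<open>The kernel is inserted on the output side, bringing the sum into the form
        required by \<open>square_sum_bound\<close>.\<close>
      have sk: "s k = (\<lambda>x. \<Sum>j\<in>J. conv (\<psi> j) (M.T j (g k)) x)"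
      proof -
        have "conv (\<psi> j) (M.T j (g k)) = M.T j (g k)" for j by (rule M.T_reproducing(1)[OF g1 bdd one])
        then show ?thesis by (simp add: s_def[abs_def])
      qed
      have Tl: "M.T j (g k) \<in> lp_space lborel q" for j by (rule M.T_schwartz(1)[OF g(1)])
      have sm: "s k \<in> borel_measurable borel"
        unfolding s_def by (intro borel_measurable_sum M.T_measurable g1)
      have "lp_norm lebesgue q (s k) = lp_norm lborel q (s k)" by (rule lp_space_lebesgue_borel(2)[OF sm])
      also have "\<dots> \<le> sqrt (c * (\<Sum>j\<in>J. (lp_norm lborel q (M.T j (g k)))\<^sup>2))"
        unfolding sk c_def by (rule square_sum_bound[OF q J Tl])
      also have "\<dots> \<le> sqrt (c * (\<Sum>j\<in>J. (A * lp_norm lborel p (conv (\<psi> j) (g k)))\<^sup>2))"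
      proof (intro real_sqrt_le_mono mult_left_mono sum_mono power_mono c0)
        fix j
        \<comment> \<open>The second use of the kernel, on the input side: it replaces the norm of g
          k by that of its piece at scale j, which is square summable over j.\<close>
        have "M.T j (conv (\<psi> j) (g k)) = M.T j (g k)" by (rule M.T_reproducing(2)[OF g1 bdd one])
        moreover have "lp_norm lborel q (M.T j (conv (\<psi> j) (g k))) \<le> A * lp_norm lborel p (conv (\<psi> j) (g k))"
          by (rule M.T_bound(2)[OF conv_lp(1)[OF order_refl bdd g1] conv_lp(1)[OF ex(1) bdd gp]])
        ultimately show "lp_norm lborel q (M.T j (g k)) \<le> A * lp_norm lborel p (conv (\<psi> j) (g k))" by simp
      qed auto
      finally show ?thesis by (simp add: sum_distrib_left power_mult_distrib mult.assoc)
    qed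
    note est = this
    have "(\<lambda>k. lp_norm lborel p (conv (\<psi> j) (g k))) \<longlonglongrightarrow> lp_norm lborel p (conv (\<psi> j) f')" for j
    proof (rule lp_norm_tendsto[OF ex(1) conv_lp(1)[OF ex(1) bdd gp] conv_lp(1)[OF ex(1) bdd f'(1)]])
      have "norm (lp_norm lborel p (\<lambda>x. conv (\<psi> j) (g k) x - conv (\<psi> j) f' x)) \<le> (\<integral>y. \<bar>\<psi> j y\<bar> \<partial>lborel) * lp_norm lborel p (\<lambda>x. g k x - f' x)" for k
        unfolding conv_diff_right[OF ex(1) bdd gp f'(1), symmetric]
        using conv_lp(2)[OF ex(1) bdd lp_diff(1)[OF ex(1) gp f'(1)], of j k] by simp
      from this g(2) show "(\<lambda>k. lp_norm lborel p (\<lambda>x. conv (\<psi> j) (g k) x - conv (\<psi> j) f' x)) \<longlonglongrightarrow> 0"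
        by (rule LIMSEQ_zero_if_bounded_multiple)
    qed
    then have "(\<lambda>k. sqrt (\<Sum>j\<in>J. c * A\<^sup>2 * (lp_norm lborel p (conv (\<psi> j) (g k)))\<^sup>2)) \<longlonglongrightarrow> sqrt (\<Sum>j\<in>J. c * A\<^sup>2 * (lp_norm lborel p (conv (\<psi> j) f'))\<^sup>2)"
      by (intro tendsto_intros)
    from LIMSEQ_le[OF lp_norm_tendsto[OF ex(3) s h sh] this] est
    show ?thesis unfolding h_def by blast
  qed
  then show thesis using that[OF f'] unfolding c_def by blast
qed

section \<open>Chirps, operator norms and the summation of the operators\<close>

lemma norm_chirp [simp]: "norm (chirp \<alpha> f x) = norm (f x)" "norm (inv_chirp \<alpha> f x) = norm (f x)"
  by (simp_all add: chirp_def inv_chirp_def norm_mult)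

lemma chirp_inv_chirp [simp]: "chirp \<alpha> (inv_chirp \<alpha> f) = f"
  by (rule ext) (simp add: chirp_def inv_chirp_def mult.assoc[symmetric] mult_exp_exp)

lemma Lp_norm_chirp [simp]: "Lp_norm p (chirp \<alpha> f) = Lp_norm p f" "Lp_norm p (inv_chirp \<alpha> f) = Lp_norm p f"
  by (simp_all add: Lp_norm_def)

lemma chirp_measurable:
  fixes f :: "real^'n \<Rightarrow> complex"
  assumes "f \<in> borel_measurable lebesgue"
  shows "chirp \<alpha> f \<in> borel_measurable lebesgue" "inv_chirp \<alpha> f \<in> borel_measurable lebesgue"
proof -
  have e: "(\<lambda>x::real^'n. exp (\<i> * complex_of_real (pi * (norm x)\<^sup>2 * cot \<alpha>))) \<in> borel_measurable lborel"
    "(\<lambda>x::real^'n. exp (- (\<i> * complex_of_real (pi * (norm x)\<^sup>2 * cot \<alpha>)))) \<in> borel_measurable lborel"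
    by measurable
  show "chirp \<alpha> f \<in> borel_measurable lebesgue" "inv_chirp \<alpha> f \<in> borel_measurable lebesgue"
    unfolding chirp_def inv_chirp_def by (intro borel_measurable_times measurable_completion[OF e(1)] measurable_completion[OF e(2)] assms)+
qed

lemma lp_chirp:
  assumes "f \<in> lp_space lebesgue p"
  shows "chirp \<alpha> f \<in> lp_space lebesgue p" "inv_chirp \<alpha> f \<in> lp_space lebesgue p"
  using assms chirp_measurable by (auto simp: lp_space_def)

text \<open>The infimum of the admissible constants is itself admissible, by using admissible
  constants exceeding it by a small d and letting d tend to 0.\<close>

lemma Lp_op_norm_bound:
  assumes f: "f \<in> Lp p" and fin: "Lp_op_norm p q T < \<infinity>"
  shows "Lp_norm q (T f) \<le> Lp_op_norm p q T * Lp_norm p f"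
proof (rule ennreal_le_epsilon)
  fix e :: real assume e: "0 < e"
  obtain N where N: "0 \<le> N" "Lp_norm p f = ennreal N"
    using f by (cases "Lp_norm p f") (auto simp: Lp_def)
  obtain L where L: "0 \<le> L" "Lp_op_norm p q T = ennreal L"
    using fin by (cases "Lp_op_norm p q T") auto
  define d where "d = e / (N + 1)"
  have d: "0 < d" using e N by (simp add: d_def)
  have "Lp_op_norm p q T < ennreal (L + d)" using L d by (simp add: ennreal_lessI)
  then obtain C where C: "\<forall>f\<in>Lp p. Lp_norm q (T f) \<le> C * Lp_norm p f" "C < ennreal (L + d)"
    unfolding Lp_op_norm_def Inf_less_iff by blast
  have "Lp_norm q (T f) \<le> C * ennreal N" using C(1) f N by auto
  also have "\<dots> \<le> ennreal (L + d) * ennreal N" using C(2) by (intro mult_right_mono) auto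
  also have "\<dots> = ennreal (L * N + d * N)" using L d N by (simp add: ennreal_mult[symmetric] distrib_right)
  also have "\<dots> \<le> ennreal (L * N + e)"
  proof -
    have "d * N \<le> d * (N + 1)" using d by (intro mult_left_mono) auto
    also have "\<dots> = e" using N by (simp add: d_def)
    finally show ?thesis by (intro ennreal_leI) simp
  qed
  also have "\<dots> = Lp_op_norm p q T * Lp_norm p f + ennreal e"
    using L N e by (simp add: ennreal_mult[symmetric] ennreal_plus[symmetric] del: ennreal_plus)
  finally show "Lp_norm q (T f) \<le> Lp_op_norm p q T * Lp_norm p f + ennreal e" .
qed

lemma Lp_has_sum_iff:
  assumes q: "1 \<le> q" and u: "\<And>j. u j \<in> lp_space lebesgue q"
  shows "Lp_has_sum q u h \<longleftrightarrow> h \<in> lp_space lebesgue q \<and>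
     ((\<lambda>F. lp_norm lebesgue q (\<lambda>x. (\<Sum>j\<in>F. u j x) - h x)) \<longlongrightarrow> 0) (finite_subsets_at_top UNIV)"
proof -
  have q0: "0 < q" using q by simp
  have "Lp_norm q (\<lambda>x. (\<Sum>j\<in>F. u j x) - h x) = ennreal (lp_norm lebesgue q (\<lambda>x. (\<Sum>j\<in>F. u j x) - h x))"
    if "h \<in> lp_space lebesgue q" for F
    by (rule Lp_norm_eq_lp_norm[OF q0 lp_diff(1)[OF q lp_sum(1)[OF q u] that]])
  moreover have "((\<lambda>F. ennreal (r F)) \<longlongrightarrow> 0) \<F> \<longleftrightarrow> (r \<longlongrightarrow> 0) \<F>" if "\<And>F. 0 \<le> r F" for r :: "int set \<Rightarrow> real" and \<F>
    using tendsto_ennreal_iff[of r \<F> 0] that by simp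
  ultimately show ?thesis
    unfolding Lp_has_sum_def Lp_iff_lp_space[OF q0] by auto
qed

theorem theorem6p3:
  fixes \<alpha> p q :: real
  assumes "\<forall>k::int. \<alpha> \<noteq> of_int k * pi"
    and "1 < p" and "p \<le> 2" and "2 \<le> q"
  shows "\<exists>C::real. C > 0 \<and>
    (\<forall>T :: int \<Rightarrow> (real^'n \<Rightarrow> complex) \<Rightarrow> (real^'n \<Rightarrow> complex).
       (\<forall>j. \<exists>m. dyadic_symbol j m \<and> T j = inv_chirp \<alpha> \<circ> multiplier_op p q m \<circ> chirp \<alpha>) \<longrightarrow>
       (SUP j. Lp_op_norm p q (T j)) < \<infinity> \<longrightarrow>
       (\<forall>f\<in>Lp p. \<exists>h. Lp_has_sum q (\<lambda>j. T j f) h) \<and>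
       Lp_op_norm p q (\<lambda>f. Lp_sum q (\<lambda>j. T j f))
         \<le> ennreal C * (SUP j. Lp_op_norm p q (T j)))"
proof -
  have q1: "1 < q" "1 \<le> q" "0 < q" and p1: "1 \<le> p" "0 < p" using assms by auto
  obtain \<psi> :: "int \<Rightarrow> real^'n \<Rightarrow> real" and K where \<psi>: "dyadic_kernels \<psi> K" "\<And>j y. \<psi> j (- y) = \<psi> j y"
    "\<And>j \<xi>. 2 powi (j - 1) \<le> norm \<xi> \<Longrightarrow> norm \<xi> \<le> 2 powi (j + 1) \<Longrightarrow> fourier_kernel (\<psi> j) \<xi> = 1"
    using dyadic_kernels_exist by blast
  interpret dyadic_kernels \<psi> K by (rule \<psi>(1))
  \<comment> \<open>\<open>p / (p - 1)\<close> is the conjugate exponent, at which the dual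
    inequality uses the original one. The final bound will be governed by sqrt c.\<close>
  define c where "c = sq_const q * sq_const (p / (p - 1))"
  have sq0: "0 \<le> sq_const r" for r by (simp add: sq_const_def)
  have c0: "0 \<le> c" by (simp add: c_def sq0)
  have main: "(\<forall>f\<in>Lp p. \<exists>h. Lp_has_sum q (\<lambda>j. T j f) h) \<and>
       Lp_op_norm p q (\<lambda>f. Lp_sum q (\<lambda>j. T j f)) \<le> ennreal (sqrt c + 1) * (SUP j. Lp_op_norm p q (T j))"
    if multipliers: "\<forall>j. \<exists>m. dyadic_symbol j m \<and> T j = inv_chirp \<alpha> \<circ> multiplier_op p q m \<circ> chirp \<alpha>"
      and fin: "(SUP j. Lp_op_norm p q (T j)) < \<infinity>" for T :: "int \<Rightarrow> (real^'n \<Rightarrow> complex) \<Rightarrow> (real^'n \<Rightarrow> complex)"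
  proof -
    obtain m where m: "\<And>j. dyadic_symbol j (m j)" "\<And>j. T j = inv_chirp \<alpha> \<circ> multiplier_op p q (m j) \<circ> chirp \<alpha>"
      using multipliers by metis
    obtain A where A: "0 \<le> A" "(SUP j. Lp_op_norm p q (T j)) = ennreal A"
      using fin by (cases "SUP j. Lp_op_norm p q (T j)") auto
    have T_bound: "Lp_norm q (T j f) \<le> ennreal A * Lp_norm p f" if "f \<in> Lp p" for j f
    proof -
      have le: "Lp_op_norm p q (T j) \<le> ennreal A" unfolding A(2)[symmetric] by (rule SUP_upper) simp
      then have "Lp_norm q (T j f) \<le> Lp_op_norm p q (T j) * Lp_norm p f"
        using that by (intro Lp_op_norm_bound) (auto simp: order_le_less_trans)
      also have "\<dots> \<le> ennreal A * Lp_norm p f" using le by (rule mult_right_mono) simp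
      finally show ?thesis .
    qed
    have M: "bounded_multiplier p q A j (m j)" for j
    proof
      fix g :: "real^'n \<Rightarrow> complex" assume g: "g \<in> schwartz"
      have "g \<in> lp_space lebesgue p"
        using lp_space_lebesgue_borel(1)[OF schwartz_measurable[OF g]] schwartz_lp[OF g p1(1)] by blast
      \<comment> \<open>T j is tested on \<open>inv_chirp \<alpha> g\<close>: the inner chirp
        cancels and the outer one preserves the norm, which leaves the bound for the bare multiplier
        on Schwartz functions.\<close>
      then have "inv_chirp \<alpha> g \<in> Lp p" unfolding Lp_iff_lp_space[OF p1(2)] by (rule lp_chirp)
      from T_bound[OF this, of j]
      have "Lp_norm q (multiplier_op p q (m j) g) \<le> ennreal A * Lp_norm p g" by (simp add: m(2))
      then show "Lp_norm q (inv_fourier (\<lambda>\<xi>. m j \<xi> * fourier g \<xi>)) \<le> ennreal A * Lp_norm p g"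
        using g by (simp add: multiplier_op_def Let_def)
    qed (use assms q1 A m in auto)
    interpret M: bounded_multiplier p q A j "m j" for j by (rule M)
    \<comment> \<open>The norm bound is shown for every sum h, since \<open>Lp_sum\<close> picks an
      unspecified one.\<close>
    have key: "(\<exists>h. Lp_has_sum q (\<lambda>j. T j f) h) \<and>
        (\<forall>h. Lp_has_sum q (\<lambda>j. T j f) h \<longrightarrow> Lp_norm q h \<le> ennreal (sqrt c + 1) * ennreal A * Lp_norm p f)"
      if f: "f \<in> Lp p" for f
    proof -
      have f: "f \<in> lp_space lebesgue p" using f Lp_iff_lp_space[OF p1(2)] by blast
      have cf: "chirp \<alpha> f \<in> lp_space lebesgue p" by (rule lp_chirp[OF f])
      have ncf: "lp_norm lebesgue p (chirp \<alpha> f) = lp_norm lebesgue p f" by (simp add: lp_norm_def)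
      obtain f' where f': "f' \<in> lp_space lborel p" "lp_norm lborel p f' = lp_norm lebesgue p (chirp \<alpha> f)"
        "\<And>J. finite J \<Longrightarrow> lp_norm lebesgue q (\<lambda>x. \<Sum>j\<in>J. multiplier_op p q (m j) (chirp \<alpha> f) x)
          \<le> sqrt (\<Sum>j\<in>J. sq_const q * A\<^sup>2 * (lp_norm lborel p (conv (\<psi> j) f'))\<^sup>2)"
        by (rule multiplier_sum_bound[OF assms(2,4) \<psi>(1,3) M cf]) blast+
      define b where "b j = sq_const q * A\<^sup>2 * (lp_norm lborel p (conv (\<psi> j) f'))\<^sup>2" for j
      define D where "D = c * A\<^sup>2 * (lp_norm lebesgue p f)\<^sup>2"
      have b0: "0 \<le> b j" for j by (simp add: b_def sq0)
      have bD: "(\<Sum>j\<in>J. b j) \<le> D" if "finite J" for J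
      proof -
        have "(\<Sum>j\<in>J. b j) = sq_const q * A\<^sup>2 * (\<Sum>j\<in>J. (lp_norm lborel p (conv (\<psi> j) f'))\<^sup>2)"
          by (simp add: b_def sum_distrib_left)
        also have "\<dots> \<le> sq_const q * A\<^sup>2 * (sq_const (p / (p - 1)) * (lp_norm lborel p f')\<^sup>2)"
          by (intro mult_left_mono square_sum_bound_dual assms \<psi>(2) that f'(1) mult_nonneg_nonneg sq0) auto
        finally show ?thesis by (simp add: D_def c_def f'(2) ncf mult_ac)
      qed
      have u: "T j f \<in> lp_space lebesgue q" for j
        unfolding m(2) o_def by (intro lp_chirp M.multiplier_op_lp cf)
      have ub: "lp_norm lebesgue q (\<lambda>x. \<Sum>j\<in>J. T j f x) \<le> sqrt (\<Sum>j\<in>J. b j)" if "finite J" for J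
      proof -
        \<comment> \<open>All T j share the same chirps, so the outer one leaves the sum as a factor
          of modulus 1.\<close>
        have "norm (\<Sum>j\<in>J. T j f x) = norm (\<Sum>j\<in>J. multiplier_op p q (m j) (chirp \<alpha> f) x)" for x
        proof -
          have "(\<Sum>j\<in>J. T j f x) = inv_chirp \<alpha> (\<lambda>x. \<Sum>j\<in>J. multiplier_op p q (m j) (chirp \<alpha> f) x) x"
            by (simp add: m(2) inv_chirp_def sum_distrib_left)
          then show ?thesis by simp
        qed
        then have "lp_norm lebesgue q (\<lambda>x. \<Sum>j\<in>J. T j f x) = lp_norm lebesgue q (\<lambda>x. \<Sum>j\<in>J. multiplier_op p q (m j) (chirp \<alpha> f) x)"
          by (simp add: lp_norm_def)
        then show ?thesis using f'(3)[OF that] by (simp add: b_def)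
      qed
      note has_sum = Lp_has_sum_iff[OF q1(2), of "\<lambda>j. T j f", OF u]
      have 1: "\<exists>h. Lp_has_sum q (\<lambda>j. T j f) h"
        using lp_unconditional_sum[OF q1(2) u b0 ub bD] unfolding has_sum by blast
      have 2: "Lp_norm q h \<le> ennreal (sqrt c + 1) * ennreal A * Lp_norm p f" if h: "Lp_has_sum q (\<lambda>j. T j f) h" for h
      proof -
        have h1: "h \<in> lp_space lebesgue q"
          and h2: "((\<lambda>F. lp_norm lebesgue q (\<lambda>x. (\<Sum>j\<in>F. T j f x) - h x)) \<longlongrightarrow> 0) (finite_subsets_at_top UNIV)"
          using h unfolding has_sum by auto
        have ev: "\<forall>\<^sub>F F in finite_subsets_at_top UNIV. lp_norm lebesgue q (\<lambda>x. \<Sum>j\<in>F. T j f x) \<le> sqrt D"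
          unfolding eventually_finite_subsets_at_top
        proof (intro exI[of _ "{}"] conjI allI impI)
          fix F :: "int set" assume "finite F \<and> {} \<subseteq> F \<and> F \<subseteq> UNIV"
          then show "lp_norm lebesgue q (\<lambda>x. \<Sum>j\<in>F. T j f x) \<le> sqrt D"
            using ub[of F] real_sqrt_le_mono[OF bD[of F]] by linarith
        qed auto
        have "lp_norm lebesgue q h \<le> sqrt D"
          by (rule lp_norm_limit_le[OF q1(2) lp_sum(1)[OF q1(2) u] h1 ev _ h2]) simp
        also have "\<dots> = sqrt c * A * lp_norm lebesgue p f"
          using A(1) by (simp add: D_def real_sqrt_mult)
        also have "\<dots> \<le> (sqrt c + 1) * A * lp_norm lebesgue p f"
          using A(1) by (intro mult_right_mono) auto
        finally have "ennreal (lp_norm lebesgue q h) \<le> ennreal ((sqrt c + 1) * A * lp_norm lebesgue p f)"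
          by (rule ennreal_leI)
        then show ?thesis
          using A(1) c0 unfolding Lp_norm_eq_lp_norm[OF q1(3) h1] Lp_norm_eq_lp_norm[OF p1(2) f]
          by (simp add: ennreal_mult)
      qed
      show ?thesis using 1 2 by blast
    qed
    have "Lp_op_norm p q (\<lambda>f. Lp_sum q (\<lambda>j. T j f)) \<le> ennreal (sqrt c + 1) * ennreal A"
      unfolding Lp_op_norm_def
    proof (rule Inf_lower, rule CollectI, rule ballI)
      fix f :: "real^'n \<Rightarrow> complex" assume f: "f \<in> Lp p"
      have "Lp_has_sum q (\<lambda>j. T j f) (Lp_sum q (\<lambda>j. T j f))"
        unfolding Lp_sum_def by (rule someI_ex[OF key[OF f, THEN conjunct1]])
      then show "Lp_norm q (Lp_sum q (\<lambda>j. T j f)) \<le> ennreal (sqrt c + 1) * ennreal A * Lp_norm p f"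
        by (rule key[OF f, THEN conjunct2, rule_format])
    qed
    then have "Lp_op_norm p q (\<lambda>f. Lp_sum q (\<lambda>j. T j f)) \<le> ennreal (sqrt c + 1) * (SUP j. Lp_op_norm p q (T j))"
      unfolding A(2) .
    moreover have "\<forall>f\<in>Lp p. \<exists>h. Lp_has_sum q (\<lambda>j. T j f) h"
      by (intro ballI key[THEN conjunct1])
    ultimately show ?thesis by (rule conjI[rotated])
  qed
  \<comment> \<open>The added 1 keeps the constant positive even if c is 0.\<close>
  have "0 < sqrt c + 1" using c0 by (simp add: add_nonneg_pos)
  with main show ?thesis by blast
qed

end
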